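(* Let $p:(E,A)\to Y$ be a stratified fibration pair with $E$, $A$ and $Y$ paracompact of finite cohomological dimension and with $Y$ also locally compact. Suppose that for each compact $K\subset Y$, $p^{-1}(K)\cap A$ is cocompact in $p^{-1}(K)$, i.e. $p^{-1}(K)-p^{-1}(K)\cap A$ is compact. Then $IH^\infty_*(E,A)\cong IH^{fc}_*(E,A)$.
   Context: Filtered spaces. A filtered space is a space $X$ with a finite filtration $X=X^n\supset X^{n-1}\supset\cdots\supset X^0\supset X^{-1}=\emptyset$ (superscripts are labels); $n$ is the filtered dimension and $X_i=X^i-X^{i-1}$ is the $i$th stratum. Subspaces carry the restricted filtration with the same labels. Intersection chains. A perversity is a function $\bar p:\mathbb{Z}^{\ge 1}\to\mathbb{Z}$ with $\bar p(k)\le\bar p(k+1)\le\bar p(k)+1$; fix one and suppress it. A singular simplex $\sigma:\Delta^i\to X$ is allowable if $\sigma^{-1}(X^{n-k}-X^{n-k-1})$ is contained in the $(i-k+\bar p(k))$-skeleton of $\Delta^i$ for all $k\ge1$. A chain $\xi$ is allowable if every simplex of $\xi$ and of $\partial\xi$ (with nonzero coefficient) is allowable. $IC^\infty_*(X)$ is the complex of allowable locally finite (possibly infinite) singular chains: each point of $X$ has a neighborhood meeting only finitely many simplices of the chain. $|\xi|$ is the support of $\xi$. For $A\subset X$, $IC^\infty_*(A_X)$ is the subcomplex of $\xi\in IC^\infty_*(X)$ with $|\xi|\subset A$ (so locally finite in $X$), and $IH^\infty_*(X,A)=H_*(IC^\infty_*(X)/IC^\infty_*(A_X))$. Coefficients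 are fixed and suppressed; with $R$ a ring with unit of finite cohomological dimension they may be: a constant group or $R$-module; a local system of groups or $R$-modules on $X-X^{n-1}$; or, if $\bar p(2)>0$, a stratified system equal to a local system on $X-X^{n-1}$ and to $0$ on $X^{n-1}$. Stratified fibration pairs. A map $F:Z\times I\to X$ to a filtered space is a stratum-preserving homotopy (stratum-preserving along $I$) if $F(\{z\}\times I)$ lies in a single stratum of $X$ for each $z$. For filtered $E\supset A$ and $Y$, $p:(E,A)\to Y$ is a stratified fibration pair if for every pair $(Z,X)$, map of pairs $f:(Z,X)\to(E,A)$ and stratum-preserving homotopy $F:Z\times I\to Y$ with $F(z,0)=pf(z)$, there is $\tilde F:(Z,X)\times I\to(E,A)$ (so $\tilde F(X\times I)\subset A$), stratum-preserving along $I$, with $p\tilde F=F$ and $\tilde F(z,0)=f(z)$. Fiberwise compact supports. $IC^{fc}_*(E)$ is the subcomplex of $\xi\in IC^\infty_*(E)$ such that each $y\in Y$ has a neighborhood $N$ with $|\xi|\cap p^{-1}(N)=K\cap p^{-1}(N)$ for some compact $K\subset E$; $IC^{fc}_*(A)$ is defined in the same way for $p|_A:A\to Y$ and is a subcomplex of $IC^{fc}_*(E)$. $IH^{fc}_*(E,A)=H_*(IC^{fc}_*(E)/IC^{fc}_*(A))$. *)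

theory Defs
  imports "HOL-Analysis.Analysis" "HOL-Homology.Homology"
    "HOL-Algebra.Module" "HOL-Algebra.AbelCoset"
begin

section \<open>Left modules over a ring with unit\<close>

text \<open>The library locale \<open>module\<close> is restricted to commutative rings.  Groups of coefficients are
  the case where the ring is the ring of integers.  The fields \<open>mult\<close> and \<open>one\<close> of the library
  record are not used.\<close>

definition left_module :: "'r ring \<Rightarrow> ('r, 'm) module \<Rightarrow> bool" where
  "left_module R M \<longleftrightarrow> ring R \<and> abelian_group M \<and>
     (\<forall>a\<in>carrier R. \<forall>x\<in>carrier M. a \<odot>\<^bsub>M\<^esub> x \<in> carrier M) \<and>
     (\<forall>a\<in>carrier R. \<forall>b\<in>carrier R. \<forall>x\<in>carrier M.
        (a \<oplus>\<^bsub>R\<^esub> b) \<odot>\<^bsub>M\<^esub> x = a \<odot>\<^bsub>M\<^esub> x \<oplus>\<^bsub>M\<^esub> b \<odot>\<^bsub>M\<^esub> x) \<and>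
     (\<forall>a\<in>carrier R. \<forall>x\<in>carrier M. \<forall>y\<in>carrier M.
        a \<odot>\<^bsub>M\<^esub> (x \<oplus>\<^bsub>M\<^esub> y) = a \<odot>\<^bsub>M\<^esub> x \<oplus>\<^bsub>M\<^esub> a \<odot>\<^bsub>M\<^esub> y) \<and>
     (\<forall>a\<in>carrier R. \<forall>b\<in>carrier R. \<forall>x\<in>carrier M.
        (a \<otimes>\<^bsub>R\<^esub> b) \<odot>\<^bsub>M\<^esub> x = a \<odot>\<^bsub>M\<^esub> (b \<odot>\<^bsub>M\<^esub> x)) \<and>
     (\<forall>x\<in>carrier M. \<one>\<^bsub>R\<^esub> \<odot>\<^bsub>M\<^esub> x = x)"

definition linear_maps :: "'r ring \<Rightarrow> ('r, 'm) module \<Rightarrow> ('r, 'n) module \<Rightarrow> ('m \<Rightarrow> 'n) set" where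
  "linear_maps R M N = {h. h \<in> carrier M \<rightarrow> carrier N \<and>
     (\<forall>x\<in>carrier M. \<forall>y\<in>carrier M. h (x \<oplus>\<^bsub>M\<^esub> y) = h x \<oplus>\<^bsub>N\<^esub> h y) \<and>
     (\<forall>a\<in>carrier R. \<forall>x\<in>carrier M. h (a \<odot>\<^bsub>M\<^esub> x) = a \<odot>\<^bsub>N\<^esub> h x)}"

definition module_isomorphic :: "'r ring \<Rightarrow> ('r, 'm) module \<Rightarrow> ('r, 'n) module \<Rightarrow> bool" where
  "module_isomorphic R M N \<longleftrightarrow> (\<exists>h\<in>linear_maps R M N. bij_betw h (carrier M) (carrier N))"

definition quotient_module :: "('r, 'm) module \<Rightarrow> 'm set \<Rightarrow> ('r, 'm set) module" where
  "quotient_module M N =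
     \<lparr>carrier = a_rcosets\<^bsub>M\<^esub> N, mult = undefined, one = undefined,
      zero = N, add = set_add M,
      smult = (\<lambda>a X. \<Union>x\<in>X. a_r_coset M N (a \<odot>\<^bsub>M\<^esub> x))\<rparr>"

text \<open>A complex consists of modules \<open>C i\<close> and maps \<open>d i\<close> from \<open>C i\<close> to \<open>C (i - 1)\<close>, for \<open>i :: nat\<close>.
  As \<open>0 - 1 = 0\<close> on natural numbers, degree \<open>0\<close> is treated separately.\<close>

definition homology :: "(nat \<Rightarrow> ('r, 'm) module) \<Rightarrow> (nat \<Rightarrow> 'm \<Rightarrow> 'm) \<Rightarrow> nat \<Rightarrow> ('r, 'm set) module"
  where
  "homology C d i =
     quotient_module
       (C i \<lparr>carrier := {z \<in> carrier (C i). i = 0 \<or> d i z = \<zero>\<^bsub>C (i - 1)\<^esub>}\<rparr>)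
       (d (Suc i) ` carrier (C (Suc i)))"

definition relative_homology ::
  "(nat \<Rightarrow> ('r, 'm) module) \<Rightarrow> (nat \<Rightarrow> 'm set) \<Rightarrow> (nat \<Rightarrow> 'm \<Rightarrow> 'm) \<Rightarrow> nat \<Rightarrow> ('r, 'm set set) module"
  where
  "relative_homology C D d i =
     homology (\<lambda>j. quotient_module (C j) (D j))
              (\<lambda>j X. \<Union>x\<in>X. a_r_coset (C (j - 1)) (D (j - 1)) (d j x)) i"

subsection \<open>Global dimension\<close>

definition projective_module :: "'r ring \<Rightarrow> ('r, 'w) module \<Rightarrow> bool" where
  "projective_module R P \<longleftrightarrow> left_module R P \<and>
     (\<forall>(B :: ('r, 'w) module) (C :: ('r, 'w) module).
        left_module R B \<longrightarrow> left_module R C \<longrightarrow>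
        (\<forall>e\<in>linear_maps R B C. \<forall>f\<in>linear_maps R P C.
           e ` carrier B = carrier C \<longrightarrow>
           (\<exists>g\<in>linear_maps R P B. \<forall>x\<in>carrier P. e (g x) = f x)))"

definition projective_dimension_le :: "'r ring \<Rightarrow> ('r, 'w) module \<Rightarrow> nat \<Rightarrow> bool" where
  "projective_dimension_le R M n \<longleftrightarrow>
     (\<exists>(P :: nat \<Rightarrow> ('r, 'w) module) d e.
        (\<forall>k. projective_module R (P k)) \<and>
        (\<forall>k>n. carrier (P k) = {\<zero>\<^bsub>P k\<^esub>}) \<and>
        e \<in> linear_maps R (P 0) M \<and> (\<forall>k. d k \<in> linear_maps R (P (Suc k)) (P k)) \<and>
        e ` carrier (P 0) = carrier M \<and>
        d 0 ` carrier (P 1) = {x \<in> carrier (P 0). e x = \<zero>\<^bsub>M\<^esub>} \<and>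
        (\<forall>k. d (Suc k) ` carrier (P (Suc (Suc k))) = {x \<in> carrier (P (Suc k)). d k x = \<zero>\<^bsub>P k\<^esub>}))"

text \<open>A ring of finite cohomological dimension: \<open>Ext\<close> vanishes uniformly in high degrees, that is, the
  projective dimensions of the left modules are bounded.  HOL cannot quantify over all types, so
  modules range over subsets of \<open>'r list\<close>.  This type is large enough: it has cardinality
  \<open>max |'r| \<aleph>\<^sub>0\<close>, so that every cyclic module and a free resolution of every module of at most
  this cardinality occur in it, and cyclic modules determine the global dimension.\<close>

definition finite_cohomological_dimension_ring :: "'r ring \<Rightarrow> bool" where
  "finite_cohomological_dimension_ring R \<longleftrightarrow>
     (\<exists>n. \<forall>M :: ('r, 'r list) module. left_module R M \<longrightarrow> projective_dimension_le R M n)"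

section \<open>Sheaves of modules\<close>

text \<open>Sheaves are given by their etale spaces: local homeomorphisms to the base
  whose fibres (the stalks) are modules with continuous operations.\<close>

record ('r, 'a, 'g) sheaf =
  base :: "'a topology"
  total :: "'g topology"
  proj :: "'g \<Rightarrow> 'a"
  stalk :: "'a \<Rightarrow> ('r, 'g) module"

definition sheaf_of_modules :: "'r ring \<Rightarrow> ('r, 'a, 'g) sheaf \<Rightarrow> bool" where
  "sheaf_of_modules R F \<longleftrightarrow>
     continuous_map (total F) (base F) (proj F) \<and>
     (\<forall>g\<in>topspace (total F). \<exists>V. openin (total F) V \<and> g \<in> V \<and> openin (base F) (proj F ` V) \<and>
        homeomorphic_map (subtopology (total F) V) (subtopology (base F) (proj F ` V)) (proj F)) \<and>
     (\<forall>x\<in>topspace (base F). left_module R (stalk F x) \<and>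
        carrier (stalk F x) = {g \<in> topspace (total F). proj F g = x}) \<and>
     continuous_map
       (subtopology (prod_topology (total F) (total F)) {(g, h). proj F g = proj F h}) (total F)
       (\<lambda>(g, h). g \<oplus>\<^bsub>stalk F (proj F g)\<^esub> h) \<and>
     (\<forall>a\<in>carrier R. continuous_map (total F) (total F) (\<lambda>g. a \<odot>\<^bsub>stalk F (proj F g)\<^esub> g))"

definition trivial_over :: "'r ring \<Rightarrow> ('r, 'a, 'g) sheaf \<Rightarrow> 'a set \<Rightarrow> bool" where
  "trivial_over R F U \<longleftrightarrow>
     (\<exists>(M :: ('r, 'g) module) h. left_module R M \<and>
        homeomorphic_map
          (prod_topology (subtopology (base F) U) (discrete_topology (carrier M)))
          (subtopology (total F) {g. proj F g \<in> U}) h \<and>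
        (\<forall>u \<in> topspace (base F) \<inter> U. (\<forall>m\<in>carrier M. proj F (h (u, m)) = u) \<and>
           (\<lambda>m. h (u, m)) \<in> linear_maps R M (stalk F u)))"

definition constant_system :: "'r ring \<Rightarrow> ('r, 'a, 'g) sheaf \<Rightarrow> bool" where
  "constant_system R F \<longleftrightarrow> sheaf_of_modules R F \<and> trivial_over R F (topspace (base F))"

definition local_system :: "'r ring \<Rightarrow> ('r, 'a, 'g) sheaf \<Rightarrow> bool" where
  "local_system R F \<longleftrightarrow> sheaf_of_modules R F \<and>
     (\<forall>x\<in>topspace (base F). \<exists>U. openin (base F) U \<and> x \<in> U \<and> trivial_over R F U)"

subsection \<open>Sheaf cohomology and cohomological dimension\<close>

definition sheaf_maps ::
  "'r ring \<Rightarrow> ('r, 'a, 'g) sheaf \<Rightarrow> ('r, 'a, 'h) sheaf \<Rightarrow> ('g \<Rightarrow> 'h) set" where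
  "sheaf_maps R F H = {f. continuous_map (total F) (total H) f \<and>
     (\<forall>g\<in>topspace (total F). proj H (f g) = proj F g) \<and>
     (\<forall>x\<in>topspace (base F). f \<in> linear_maps R (stalk F x) (stalk H x))}"

definition sheaf_kernel :: "('r, 'a, 'g) sheaf \<Rightarrow> ('r, 'a, 'h) sheaf \<Rightarrow> ('g \<Rightarrow> 'h) \<Rightarrow> 'g set" where
  "sheaf_kernel F H f = {g \<in> topspace (total F). f g = \<zero>\<^bsub>stalk H (proj F g)\<^esub>}"

definition global_sections :: "('r, 'a, 'g) sheaf \<Rightarrow> ('a \<Rightarrow> 'g) set" where
  "global_sections F = {s. continuous_map (base F) (total F) s \<and>
     (\<forall>x\<in>topspace (base F). proj F (s x) = x)}"

definition injective_sheaf :: "'r ring \<Rightarrow> ('r, 'a, 'w) sheaf \<Rightarrow> bool" where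
  "injective_sheaf R J \<longleftrightarrow> sheaf_of_modules R J \<and>
     (\<forall>(B :: ('r, 'a, 'w) sheaf) (C :: ('r, 'a, 'w) sheaf).
        sheaf_of_modules R B \<longrightarrow> sheaf_of_modules R C \<longrightarrow> base B = base J \<longrightarrow> base C = base J \<longrightarrow>
        (\<forall>i\<in>sheaf_maps R B C. \<forall>f\<in>sheaf_maps R B J.
           inj_on i (topspace (total B)) \<longrightarrow>
           (\<exists>g\<in>sheaf_maps R C J. \<forall>b\<in>topspace (total B). g (i b) = f b)))"

definition injective_resolution ::
  "'r ring \<Rightarrow> ('r, 'a, 'w) sheaf \<Rightarrow> ('w \<Rightarrow> 'w) \<Rightarrow> (nat \<Rightarrow> ('r, 'a, 'w) sheaf) \<Rightarrow> (nat \<Rightarrow> 'w \<Rightarrow> 'w) \<Rightarrow> bool"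
  where
  "injective_resolution R F e J d \<longleftrightarrow>
     (\<forall>k. injective_sheaf R (J k) \<and> base (J k) = base F) \<and>
     e \<in> sheaf_maps R F (J 0) \<and> (\<forall>k. d k \<in> sheaf_maps R (J k) (J (Suc k))) \<and>
     inj_on e (topspace (total F)) \<and>
     e ` topspace (total F) = sheaf_kernel (J 0) (J 1) (d 0) \<and>
     (\<forall>k. d k ` topspace (total (J k)) = sheaf_kernel (J (Suc k)) (J (Suc (Suc k))) (d (Suc k)))"

text \<open>Vanishing of \<open>H\<^sup>k(X; F)\<close> for \<open>k = Suc l > 0\<close>, where \<open>H\<^sup>*\<close> is the derived functor of global
  sections.\<close>

definition cohomology_vanishes :: "'r ring \<Rightarrow> ('r, 'a, 'w) sheaf \<Rightarrow> nat \<Rightarrow> bool" where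
  "cohomology_vanishes R F l \<longleftrightarrow>
     (\<exists>e J d. injective_resolution R F e J d \<and>
        (\<forall>s\<in>global_sections (J (Suc l)).
           (\<forall>x\<in>topspace (base F). d (Suc l) (s x) = \<zero>\<^bsub>stalk (J (Suc (Suc l))) x\<^esub>) \<longrightarrow>
           (\<exists>t\<in>global_sections (J l). \<forall>x\<in>topspace (base F). s x = d l (t x))))"

text \<open>The cohomological dimension of \<open>X\<close> over \<open>R\<close> is at most \<open>n\<close> if \<open>H\<^sup>k(X; F) = 0\<close> for all \<open>k > n\<close> and
  all sheaves \<open>F\<close> of \<open>R\<close>-modules.  As HOL cannot quantify over types, the total spaces of sheaves
  are subsets of the type \<open>('r + 'a) list set\<close>, whose cardinality is \<open>\<lambda> = 2 ^ \<kappa>\<close> for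
  \<open>\<kappa> = max |'r| |'a| \<aleph>\<^sub>0\<close>.  Since \<open>\<lambda> ^ \<kappa> = \<lambda>\<close>, every sheaf with at most \<open>\<lambda>\<close> germs has an injective
  resolution of the same kind, and injectivity can be tested against such sheaves (Baer's criterion
  for the subsheaves of the extensions by zero of the constant sheaf \<open>R\<close> from open sets).  On a
  paracompact space every class of positive degree with coefficients in an arbitrary sheaf comes
  from a subsheaf with at most \<open>\<lambda>\<close> germs (use a Cech cocycle), so larger sheaves do not
  change the notion.\<close>

definition finite_cohomological_dimension :: "'r ring \<Rightarrow> 'a topology \<Rightarrow> bool" where
  "finite_cohomological_dimension R X \<longleftrightarrow>
     (\<exists>n. \<forall>F :: ('r, 'a, ('r + 'a) list set) sheaf.
        sheaf_of_modules R F \<longrightarrow> base F = X \<longrightarrow> (\<forall>l. Suc l > n \<longrightarrow> cohomology_vanishes R F l))"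

text \<open>Paracompact spaces are Hausdorff by convention.\<close>

definition paracompact_space :: "'a topology \<Rightarrow> bool" where
  "paracompact_space X \<longleftrightarrow> Hausdorff_space X \<and>
     (\<forall>\<U>. (\<forall>U\<in>\<U>. openin X U) \<and> \<Union>\<U> = topspace X \<longrightarrow>
        (\<exists>\<V>. (\<forall>V\<in>\<V>. openin X V \<and> (\<exists>U\<in>\<U>. V \<subseteq> U)) \<and> \<Union>\<V> = topspace X \<and> locally_finite_in X \<V>))"

section \<open>Filtered spaces and stratified fibration pairs\<close>

record 'a filtered =
  space_of :: "'a topology"
  fdim :: nat
  skel :: "int \<Rightarrow> 'a set"

text \<open>Only the labels \<open>i \<le> fdim X\<close> matter; those below \<open>0\<close> are all empty, so that
  \<open>X\<^sup>n\<^sup>-\<^sup>k\<close> makes sense for every \<open>k \<ge> 1\<close>.\<close>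

definition filtered_space :: "'a filtered \<Rightarrow> bool" where
  "filtered_space X \<longleftrightarrow>
     skel X (int (fdim X)) = topspace (space_of X) \<and>
     (\<forall>i < int (fdim X). skel X i \<subseteq> skel X (i + 1)) \<and>
     (\<forall>i<0. skel X i = {})"

definition stratum :: "'a filtered \<Rightarrow> int \<Rightarrow> 'a set" where
  "stratum X i = skel X i - skel X (i - 1)"

definition restrict_filtered :: "'a filtered \<Rightarrow> 'a set \<Rightarrow> 'a filtered" where
  "restrict_filtered X A =
     \<lparr>space_of = subtopology (space_of X) A, fdim = fdim X, skel = (\<lambda>i. skel X i \<inter> A)\<rparr>"

definition stratum_preserving_homotopy ::
  "'z topology \<Rightarrow> 'a filtered \<Rightarrow> ('z \<times> real \<Rightarrow> 'a) \<Rightarrow> bool" where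
  "stratum_preserving_homotopy Z X F \<longleftrightarrow>
     continuous_map (prod_topology Z (top_of_set {0..1})) (space_of X) F \<and>
     (\<forall>z\<in>topspace Z. \<exists>i\<in>{0..int (fdim X)}. F ` ({z} \<times> {0..1}) \<subseteq> stratum X i)"

definition stratified_lifting ::
  "'z itself \<Rightarrow> 'e filtered \<Rightarrow> 'e set \<Rightarrow> 'y filtered \<Rightarrow> ('e \<Rightarrow> 'y) \<Rightarrow> bool" where
  "stratified_lifting _ E A Y p \<longleftrightarrow>
     (\<forall>(Z :: 'z topology) W f F.
        W \<subseteq> topspace Z \<longrightarrow> continuous_map Z (space_of E) f \<longrightarrow> f ` W \<subseteq> A \<longrightarrow>
        stratum_preserving_homotopy Z Y F \<longrightarrow> (\<forall>z\<in>topspace Z. F (z, 0) = p (f z)) \<longrightarrow>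
        (\<exists>F'. stratum_preserving_homotopy Z E F' \<and> F' ` (W \<times> {0..1}) \<subseteq> A \<and>
           (\<forall>z\<in>topspace Z. \<forall>t\<in>{0..1}. p (F' (z, t)) = F (z, t)) \<and>
           (\<forall>z\<in>topspace Z. F' (z, 0) = f z)))"

text \<open>HOL cannot quantify over types, so test spaces live on \<open>'e \<times> (real \<Rightarrow> 'y)\<close>.  This type contains
  a universal test space, consisting of points of \<open>E\<close> with paths in \<open>Y\<close>, and lemma
  \<open>stratified_fibration_pair_lifting\<close> shows that the lifting property follows for test
  spaces on every other type.\<close>

definition stratified_fibration_pair ::
  "'e filtered \<Rightarrow> 'e set \<Rightarrow> 'y filtered \<Rightarrow> ('e \<Rightarrow> 'y) \<Rightarrow> bool" where
  "stratified_fibration_pair E A Y p \<longleftrightarrow>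
     A \<subseteq> topspace (space_of E) \<and> continuous_map (space_of E) (space_of Y) p \<and>
     stratified_lifting TYPE('e \<times> (real \<Rightarrow> 'y)) E A Y p"

lemma quotient_on_image:
  fixes Z :: "'z topology" and \<phi> :: "'z \<Rightarrow> 'w"
  obtains Z' where "quotient_map Z Z' \<phi>"
proof -
  define P where "P = (\<lambda>U. U \<subseteq> \<phi> ` topspace Z \<and> openin Z {z \<in> topspace Z. \<phi> z \<in> U})"
  have "istopology P"
    unfolding istopology_def
  proof (intro conjI allI impI)
    fix S T assume "P S" "P T"
    moreover have "{z \<in> topspace Z. \<phi> z \<in> S \<inter> T}
        = {z \<in> topspace Z. \<phi> z \<in> S} \<inter> {z \<in> topspace Z. \<phi> z \<in> T}" by auto
    ultimately show "P (S \<inter> T)" unfolding P_def by auto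
  next
    fix K assume *: "\<forall>S\<in>K. P S"
    have "{z \<in> topspace Z. \<phi> z \<in> \<Union>K} = (\<Union>S\<in>K. {z \<in> topspace Z. \<phi> z \<in> S})" by auto
    moreover have "openin Z (\<Union>S\<in>K. {z \<in> topspace Z. \<phi> z \<in> S})"
      using * unfolding P_def by (intro openin_Union) auto
    ultimately show "P (\<Union>K)" using * unfolding P_def by auto
  qed
  then have op: "openin (topology P) U \<longleftrightarrow> P U" for U
    by (simp add: topology_inverse')
  have "{z \<in> topspace Z. \<phi> z \<in> \<phi> ` topspace Z} = topspace Z" by auto
  then have "P (\<phi> ` topspace Z)"
    unfolding P_def by simp
  then have ts: "topspace (topology P) = \<phi> ` topspace Z"
    unfolding topspace_def op unfolding P_def by blast
  have "quotient_map Z (topology P) \<phi>"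
    unfolding quotient_map_def ts op unfolding P_def by auto
  then show thesis by (rule that)
qed

lemma stratified_fibration_pair_lifting:
  assumes "stratified_fibration_pair E A Y p"
  shows "stratified_lifting TYPE('z) E A Y p"
  unfolding stratified_lifting_def
proof (intro allI impI)
  fix Z :: "'z topology" and W f F
  assume W: "W \<subseteq> topspace Z" and f: "continuous_map Z (space_of E) f" and fW: "f ` W \<subseteq> A"
    and F: "stratum_preserving_homotopy Z Y F" and F0: "\<forall>z\<in>topspace Z. F (z, 0) = p (f z)"
  have "stratified_lifting TYPE('a \<times> (real \<Rightarrow> 'b)) E A Y p"
    using assms by (simp add: stratified_fibration_pair_def)
  note lift = this[unfolded stratified_lifting_def]
  let ?I = "top_of_set {0..1::real}"
  define \<phi> where "\<phi> z = (f z, \<lambda>t. F (z, t))" for z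
  obtain Z' where q: "quotient_map Z Z' \<phi>" by (rule quotient_on_image)
  then have ts: "topspace Z' = \<phi> ` topspace Z" by (simp add: quotient_map_def)
  define G where "G = (\<lambda>(w :: 'a \<times> (real \<Rightarrow> 'b), t). snd w t)"
  have "locally_compact_space ?I"
    by (simp add: compact_imp_locally_compact_space compact_space_subtopology)
  then have q2: "quotient_map (prod_topology Z ?I) (prod_topology Z' ?I) (\<lambda>(x, y). (\<phi> x, y))"
    by (intro quotient_map_prod_left q)
       (simp_all add: Hausdorff_space_subtopology)
  have "fst \<circ> \<phi> = f" by (auto simp: \<phi>_def)
  then have f': "continuous_map Z' (space_of E) fst"
    using continuous_compose_quotient_map[OF q, of "space_of E" fst] f by simp
  have "G \<circ> (\<lambda>(x, y). (\<phi> x, y)) = F" by (auto simp: \<phi>_def G_def)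
  then have "continuous_map (prod_topology Z' ?I) (space_of Y) G"
    using continuous_compose_quotient_map[OF q2, of "space_of Y" G] F
    by (simp add: stratum_preserving_homotopy_def)
  moreover have "G ` ({\<phi> z} \<times> {0..1}) = F ` ({z} \<times> {0..1})" for z
    unfolding \<phi>_def G_def by (auto simp: image_iff intro!: bexI)
  ultimately have G: "stratum_preserving_homotopy Z' Y G"
    using F by (simp add: stratum_preserving_homotopy_def ts)
  have G0: "\<forall>w\<in>topspace Z'. G (w, 0) = p (fst w)"
    using F0 by (auto simp: ts \<phi>_def G_def)
  have "\<exists>F'. stratum_preserving_homotopy Z' E F' \<and>
      F' ` ({w \<in> topspace Z'. fst w \<in> A} \<times> {0..1}) \<subseteq> A \<and>
      (\<forall>z\<in>topspace Z'. \<forall>t\<in>{0..1}. p (F' (z, t)) = G (z, t)) \<and>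
      (\<forall>z\<in>topspace Z'. F' (z, 0) = fst z)"
    using lift[rule_format, of "{w \<in> topspace Z'. fst w \<in> A}" Z' fst G] f' G G0 by blast
  then obtain F' where F': "stratum_preserving_homotopy Z' E F'"
    "F' ` ({w \<in> topspace Z'. fst w \<in> A} \<times> {0..1}) \<subseteq> A"
    "\<forall>z\<in>topspace Z'. \<forall>t\<in>{0..1}. p (F' (z, t)) = G (z, t)"
    "\<forall>z\<in>topspace Z'. F' (z, 0) = fst z"
    by blast
  define H where "H = F' \<circ> (\<lambda>(x, y). (\<phi> x, y))"
  have "continuous_map (prod_topology Z ?I) (space_of E) H"
    unfolding H_def using F'(1) quotient_imp_continuous_map[OF q2]
    by (intro continuous_map_compose) (auto simp: stratum_preserving_homotopy_def)
  moreover have "H ` ({z} \<times> {0..1}) = F' ` ({\<phi> z} \<times> {0..1})" for z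
    unfolding H_def by (auto simp: image_iff intro!: bexI)
  ultimately have "stratum_preserving_homotopy Z E H"
    using F'(1) by (simp add: stratum_preserving_homotopy_def ts)
  moreover have "H ` (W \<times> {0..1}) \<subseteq> A"
  proof clarify
    fix z and t :: real assume z: "z \<in> W" "t \<in> {0..1}"
    then have "\<phi> z \<in> {w \<in> topspace Z'. fst w \<in> A}"
      using W fW by (simp add: ts \<phi>_def) blast
    then show "H (z, t) \<in> A"
      using F'(2) z unfolding H_def by force
  qed
  moreover have "\<forall>z\<in>topspace Z. \<forall>t\<in>{0..1}. p (H (z, t)) = F (z, t)"
    using F'(3) by (auto simp: H_def ts G_def \<phi>_def)
  moreover have "\<forall>z\<in>topspace Z. H (z, 0) = f z"
    using F'(4) by (auto simp: H_def ts \<phi>_def)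
  ultimately show "\<exists>F'. stratum_preserving_homotopy Z E F' \<and> F' ` (W \<times> {0..1}) \<subseteq> A \<and>
           (\<forall>z\<in>topspace Z. \<forall>t\<in>{0..1}. p (F' (z, t)) = F (z, t)) \<and>
           (\<forall>z\<in>topspace Z. F' (z, 0) = f z)"
    by blast
qed

section \<open>Intersection chains\<close>

definition perversity :: "(nat \<Rightarrow> int) \<Rightarrow> bool" where
  "perversity q \<longleftrightarrow> (\<forall>k\<ge>1. q k \<le> q (Suc k) \<and> q (Suc k) \<le> q k + 1)"

text \<open>Coefficients are either constant on all of \<open>X\<close>, or a local system on \<open>X - X\<^sup>n\<^sup>-\<^sup>1\<close>.  A stratified
  system is also given by its local system on \<open>X - X\<^sup>n\<^sup>-\<^sup>1\<close>; being \<open>0\<close> on \<open>X\<^sup>n\<^sup>-\<^sup>1\<close> is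
  implemented by \<open>coefficients\<close> below, where nothing is lifted over \<open>X\<^sup>n\<^sup>-\<^sup>1\<close>.\<close>

definition coefficient_system :: "'r ring \<Rightarrow> 'a filtered \<Rightarrow> ('r, 'a, 'g) sheaf \<Rightarrow> bool" where
  "coefficient_system R X G \<longleftrightarrow>
     (base G = space_of X \<and> constant_system R G) \<or>
     (base G = subtopology (space_of X) (topspace (space_of X) - skel X (int (fdim X) - 1)) \<and>
      local_system R G)"

text \<open>The part of the model simplex that is mapped to the set on which the coefficients live.\<close>

definition lift_domain :: "('r, 'a, 'g) sheaf \<Rightarrow> nat \<Rightarrow> ((nat \<Rightarrow> real) \<Rightarrow> 'a) \<Rightarrow> (nat \<Rightarrow> real) set" where
  "lift_domain G i \<sigma> = {t \<in> standard_simplex i. \<sigma> t \<in> topspace (base G)}"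

text \<open>The coefficient of a singular simplex is a lift of it to the coefficient system.  For constant
  coefficients this is an element of the constant module, as the simplex is connected.\<close>

definition coefficients ::
  "('r, 'a, 'g) sheaf \<Rightarrow> nat \<Rightarrow> ((nat \<Rightarrow> real) \<Rightarrow> 'a) \<Rightarrow> ((nat \<Rightarrow> real) \<Rightarrow> 'g) set" where
  "coefficients G i \<sigma> = {s. s \<in> extensional (lift_domain G i \<sigma>) \<and>
     continuous_map (subtopology (powertop_real UNIV) (lift_domain G i \<sigma>)) (total G) s \<and>
     (\<forall>t\<in>lift_domain G i \<sigma>. proj G (s t) = \<sigma> t)}"

definition zero_coefficient ::
  "('r, 'a, 'g) sheaf \<Rightarrow> nat \<Rightarrow> ((nat \<Rightarrow> real) \<Rightarrow> 'a) \<Rightarrow> (nat \<Rightarrow> real) \<Rightarrow> 'g" where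
  "zero_coefficient G i \<sigma> = (\<lambda>t\<in>lift_domain G i \<sigma>. \<zero>\<^bsub>stalk G (\<sigma> t)\<^esub>)"

type_synonym ('a, 'g) lf_chain = "((nat \<Rightarrow> real) \<Rightarrow> 'a) \<Rightarrow> (nat \<Rightarrow> real) \<Rightarrow> 'g"

definition chain_simplices ::
  "('r, 'a, 'g) sheaf \<Rightarrow> nat \<Rightarrow> ('a, 'g) lf_chain \<Rightarrow> ((nat \<Rightarrow> real) \<Rightarrow> 'a) set" where
  "chain_simplices G i \<xi> = {\<sigma>. \<xi> \<sigma> \<noteq> zero_coefficient G i \<sigma>}"

definition chain_support :: "('r, 'a, 'g) sheaf \<Rightarrow> nat \<Rightarrow> ('a, 'g) lf_chain \<Rightarrow> 'a set" where
  "chain_support G i \<xi> = (\<Union>\<sigma>\<in>chain_simplices G i \<xi>. \<sigma> ` standard_simplex i)"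

text \<open>Chains on a subspace are, literally, chains on the whole space: simplices outside the subspace
  have coefficient zero.\<close>

definition lf_chains :: "('r, 'a, 'g) sheaf \<Rightarrow> 'a topology \<Rightarrow> nat \<Rightarrow> ('a, 'g) lf_chain set" where
  "lf_chains G X i = {\<xi>.
     (\<forall>\<sigma>\<in>chain_simplices G i \<xi>. singular_simplex i X \<sigma> \<and> \<xi> \<sigma> \<in> coefficients G i \<sigma>) \<and>
     (\<forall>x\<in>topspace X. \<exists>U. openin X U \<and> x \<in> U \<and>
        finite {\<sigma> \<in> chain_simplices G i \<xi>. \<sigma> ` standard_simplex i \<inter> U \<noteq> {}})}"

text \<open>The value of \<open>\<partial>\<xi>\<close> on \<open>\<tau>\<close> is the sum, with signs \<open>(-1)\<^sup>j\<close>, of the restrictions of \<open>\<xi> \<sigma>\<close> to all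
  \<open>j\<close>th faces that are equal to \<open>\<tau>\<close>; this sum is finite by local finiteness.\<close>

definition lf_boundary ::
  "('r, 'a, 'g) sheaf \<Rightarrow> nat \<Rightarrow> ('a, 'g) lf_chain \<Rightarrow> ('a, 'g) lf_chain" where
  "lf_boundary G i \<xi> =
     (if i = 0 then zero_coefficient G 0
      else (\<lambda>\<tau>. \<lambda>t\<in>lift_domain G (i - 1) \<tau>.
        finsum (stalk G (\<tau> t))
          (\<lambda>(\<sigma>, j). if even j then \<xi> \<sigma> (simplical_face j t)
                     else \<ominus>\<^bsub>stalk G (\<tau> t)\<^esub> \<xi> \<sigma> (simplical_face j t))
          {(\<sigma>, j). \<sigma> \<in> chain_simplices G i \<xi> \<and> j \<le> i \<and> singular_face i j \<sigma> = \<tau>}))"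

definition chain_module ::
  "('r, 'a, 'g) sheaf \<Rightarrow> nat \<Rightarrow> ('a, 'g) lf_chain set \<Rightarrow> ('r, ('a, 'g) lf_chain) module" where
  "chain_module G i C =
     \<lparr>carrier = C, mult = undefined, one = undefined,
      zero = zero_coefficient G i,
      add = (\<lambda>\<xi> \<eta> \<sigma>. \<lambda>t\<in>lift_domain G i \<sigma>. \<xi> \<sigma> t \<oplus>\<^bsub>stalk G (\<sigma> t)\<^esub> \<eta> \<sigma> t),
      smult = (\<lambda>a \<xi> \<sigma>. \<lambda>t\<in>lift_domain G i \<sigma>. a \<odot>\<^bsub>stalk G (\<sigma> t)\<^esub> \<xi> \<sigma> t)\<rparr>"

definition simplex_skeleton :: "nat \<Rightarrow> int \<Rightarrow> (nat \<Rightarrow> real) set" where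
  "simplex_skeleton i j = {t \<in> standard_simplex i. int (card {l. t l \<noteq> 0}) \<le> j + 1}"

definition allowable_simplex ::
  "(nat \<Rightarrow> int) \<Rightarrow> 'a filtered \<Rightarrow> nat \<Rightarrow> ((nat \<Rightarrow> real) \<Rightarrow> 'a) \<Rightarrow> bool" where
  "allowable_simplex q X i \<sigma> \<longleftrightarrow>
     (\<forall>k\<ge>1. {t \<in> standard_simplex i. \<sigma> t \<in> stratum X (int (fdim X) - int k)}
        \<subseteq> simplex_skeleton i (int i - int k + q k))"

text \<open>\<open>IC_inf\<close> is \<open>IC\<^sup>\<infinity>\<^sub>*(X)\<close>, \<open>IC_inf_in\<close> is \<open>IC\<^sup>\<infinity>\<^sub>*(A\<^sub>X)\<close>, and \<open>IC_fc\<close> is \<open>IC\<^sup>f\<^sup>c\<^sub>*(E)\<close>.\<close>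

definition IC_inf ::
  "(nat \<Rightarrow> int) \<Rightarrow> ('r, 'a, 'g) sheaf \<Rightarrow> 'a filtered \<Rightarrow> nat \<Rightarrow> ('a, 'g) lf_chain set" where
  "IC_inf q G X i = {\<xi> \<in> lf_chains G (space_of X) i.
     (\<forall>\<sigma>\<in>chain_simplices G i \<xi>. allowable_simplex q X i \<sigma>) \<and>
     (\<forall>\<tau>\<in>chain_simplices G (i - 1) (lf_boundary G i \<xi>). allowable_simplex q X (i - 1) \<tau>)}"

definition IC_inf_in ::
  "(nat \<Rightarrow> int) \<Rightarrow> ('r, 'a, 'g) sheaf \<Rightarrow> 'a filtered \<Rightarrow> 'a set \<Rightarrow> nat \<Rightarrow> ('a, 'g) lf_chain set" where
  "IC_inf_in q G X A i = {\<xi> \<in> IC_inf q G X i. chain_support G i \<xi> \<subseteq> A}"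

definition IC_fc ::
  "(nat \<Rightarrow> int) \<Rightarrow> ('r, 'e, 'g) sheaf \<Rightarrow> 'e filtered \<Rightarrow> 'y topology \<Rightarrow> ('e \<Rightarrow> 'y) \<Rightarrow> nat
     \<Rightarrow> ('e, 'g) lf_chain set" where
  "IC_fc q G E Y p i = {\<xi> \<in> IC_inf q G E i.
     \<forall>y\<in>topspace Y. \<exists>N. openin Y N \<and> y \<in> N \<and>
       (\<exists>K. compactin (space_of E) K \<and>
          chain_support G i \<xi> \<inter> {x \<in> topspace (space_of E). p x \<in> N}
            = K \<inter> {x \<in> topspace (space_of E). p x \<in> N})}"

definition IH_inf ::
  "(nat \<Rightarrow> int) \<Rightarrow> ('r, 'a, 'g) sheaf \<Rightarrow> 'a filtered \<Rightarrow> 'a set \<Rightarrow> nat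
     \<Rightarrow> ('r, ('a, 'g) lf_chain set set) module" where
  "IH_inf q G X A i =
     relative_homology (\<lambda>j. chain_module G j (IC_inf q G X j)) (IC_inf_in q G X A) (lf_boundary G) i"

definition IH_fc ::
  "(nat \<Rightarrow> int) \<Rightarrow> ('r, 'e, 'g) sheaf \<Rightarrow> 'e filtered \<Rightarrow> 'e set \<Rightarrow> 'y topology \<Rightarrow> ('e \<Rightarrow> 'y) \<Rightarrow> nat
     \<Rightarrow> ('r, ('e, 'g) lf_chain set set) module" where
  "IH_fc q G E A Y p i =
     relative_homology (\<lambda>j. chain_module G j (IC_fc q G E Y p j))
       (IC_fc q G (restrict_filtered E A) Y p) (lf_boundary G) i"

end

theory Submission
  imports Defs "HOL-Algebra.Free_Abelian_Groups"
begin

text \<open>Let \<open>F\<close> be the complex of intersection chains of \<open>E\<close>, \<open>F\<^sub>A\<close> the subcomplex of the chains supported in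
  \<open>A\<close>, and \<open>P\<close> the subcomplex of the chains with fibrewise compact support.  A chain of \<open>P\<close> has only finitely
  many simplices over a small open subset of \<open>Y\<close>, so that for such chains it does not matter whether local
  finiteness is required in \<open>A\<close> or in \<open>E\<close>.  Hence the fibrewise compact chains of \<open>A\<close> form the complex
  \<open>P \<inter> F\<^sub>A\<close> (\<open>IC_fc_restrict\<close>), and the inclusion of \<open>P\<close> into \<open>F\<close> induces an injective map
  \<open>P / (P \<inter> F\<^sub>A) \<rightarrow> F / F\<^sub>A\<close> with cokernel \<open>F / (P + F\<^sub>A)\<close>.  So it suffices that this cokernel is
  acyclic: an intersection chain with boundary in \<open>P + F\<^sub>A\<close> can be moved into \<open>P + F\<^sub>A\<close> by adding a boundary
  (\<open>decomposable_up_to_boundary\<close>).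

  Assume first that every simplex of \<open>\<xi>\<close> lies over a member of a locally finite cover of \<open>Y\<close> by open sets that
  are contained in compact sets.  The simplices of \<open>\<xi>\<close> that lie over such a set and are not contained in \<open>A\<close> all meet
  \<open>p\<^sup>-\<^sup>1(K) - A\<close> for one compact \<open>K\<close>.  This set is compact, so there are finitely many of them.  Thus \<open>\<xi>\<close> is the
  sum of a fibrewise compact part and a part in \<open>A\<close>.  Two problems remain.  The parts of an intersection
  chain need not be intersection chains, since non-allowable faces that cancel in \<open>\<partial>\<xi>\<close> may survive in the
  boundary of a part.  And to make the simplices of \<open>\<xi>\<close> small, the number of subdivisions has to vary over
  \<open>\<xi>\<close>, which disturbs the cancellation in the same way.

  Both problems are solved by last vertices.  Order the vertices of the barycentric subdivision such that the last
  vertex of every piece is a vertex of the subdivided simplex.  The opposite face of the piece is then spanned by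
  barycentres of faces of positive dimension.  It meets every face of the subdivided simplex in a smaller dimension
  (\<open>vertex_transverse_simplicial_subdivision\<close>) and is therefore allowable (\<open>subdivide_last_face\<close>).  All other
  faces of the piece contain its last vertex.  So an operation on simplices that depends only on the position of
  the last vertex treats a non-allowable face in the same way in all pieces that have it, and
  cancellation persists: after one subdivision such operations preserve intersection chains (\<open>vertexwise_IC\<close>).

  It remains to choose operations of this kind.  The fibrewise compact part is defined to consist of the simplices
  whose last vertex is the last vertex of some simplex not contained in \<open>A\<close>; it is still finite over small sets because only
  finitely many simplices pass through a given point (\<open>small_chain_decomposable\<close>).  The number \<open>M\<close> of subdivisions of a
  simplex is a function of its last vertex.  Where this number jumps, the homotopy on the common face is left
  over, and it consists of small simplices if \<open>M\<close> is large enough (\<open>homotopy_formula\<close>, \<open>small_family_small\<close>).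

  Boundaries, subdivisions, homotopies and restrictions all replace every simplex \<open>\<sigma>\<close> of a chain by the image under
  \<open>\<sigma>\<close> of a chain \<open>c \<sigma>\<close> in the standard simplex (\<open>substitute\<close>).  Such substitutions can be composed
  (\<open>substitute_substitute\<close>), so all identities between them follow from identities in standard simplices.\<close>

section \<open>Left modules, quotients and homology\<close>

lemma left_moduleD:
  assumes "left_module R M"
  shows "ring R" "abelian_group M"
    "\<And>a x. a \<in> carrier R \<Longrightarrow> x \<in> carrier M \<Longrightarrow> a \<odot>\<^bsub>M\<^esub> x \<in> carrier M"
    "\<And>a b x. a \<in> carrier R \<Longrightarrow> b \<in> carrier R \<Longrightarrow> x \<in> carrier M \<Longrightarrow>
        (a \<oplus>\<^bsub>R\<^esub> b) \<odot>\<^bsub>M\<^esub> x = a \<odot>\<^bsub>M\<^esub> x \<oplus>\<^bsub>M\<^esub> b \<odot>\<^bsub>M\<^esub> x"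
    "\<And>a x y. a \<in> carrier R \<Longrightarrow> x \<in> carrier M \<Longrightarrow> y \<in> carrier M \<Longrightarrow>
        a \<odot>\<^bsub>M\<^esub> (x \<oplus>\<^bsub>M\<^esub> y) = a \<odot>\<^bsub>M\<^esub> x \<oplus>\<^bsub>M\<^esub> a \<odot>\<^bsub>M\<^esub> y"
    "\<And>a b x. a \<in> carrier R \<Longrightarrow> b \<in> carrier R \<Longrightarrow> x \<in> carrier M \<Longrightarrow>
        (a \<otimes>\<^bsub>R\<^esub> b) \<odot>\<^bsub>M\<^esub> x = a \<odot>\<^bsub>M\<^esub> (b \<odot>\<^bsub>M\<^esub> x)"
    "\<And>x. x \<in> carrier M \<Longrightarrow> \<one>\<^bsub>R\<^esub> \<odot>\<^bsub>M\<^esub> x = x"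
  using assms by (auto simp: left_module_def)

lemma left_module_smult_minus_one:
  assumes M: "left_module R M" and x: "x \<in> carrier M"
  shows "(\<ominus>\<^bsub>R\<^esub> \<one>\<^bsub>R\<^esub>) \<odot>\<^bsub>M\<^esub> x = \<ominus>\<^bsub>M\<^esub> x" "\<zero>\<^bsub>R\<^esub> \<odot>\<^bsub>M\<^esub> x = \<zero>\<^bsub>M\<^esub>"
proof -
  note lm = left_moduleD[OF M]
  interpret R: ring R by (rule lm)
  interpret M: abelian_group M by (rule lm)
  have "\<zero>\<^bsub>R\<^esub> \<odot>\<^bsub>M\<^esub> x \<oplus>\<^bsub>M\<^esub> \<zero>\<^bsub>R\<^esub> \<odot>\<^bsub>M\<^esub> x = \<zero>\<^bsub>R\<^esub> \<odot>\<^bsub>M\<^esub> x"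
    using lm(4)[of "\<zero>\<^bsub>R\<^esub>" "\<zero>\<^bsub>R\<^esub>" x] x by simp
  then show 0: "\<zero>\<^bsub>R\<^esub> \<odot>\<^bsub>M\<^esub> x = \<zero>\<^bsub>M\<^esub>"
    using lm(3)[of "\<zero>\<^bsub>R\<^esub>" x] x M.add.l_cancel_one[of "\<zero>\<^bsub>R\<^esub> \<odot>\<^bsub>M\<^esub> x" "\<zero>\<^bsub>R\<^esub> \<odot>\<^bsub>M\<^esub> x"] by simp
  have "(\<ominus>\<^bsub>R\<^esub> \<one>\<^bsub>R\<^esub>) \<odot>\<^bsub>M\<^esub> x \<oplus>\<^bsub>M\<^esub> x = \<zero>\<^bsub>M\<^esub>"
    using lm(4)[of "\<ominus>\<^bsub>R\<^esub> \<one>\<^bsub>R\<^esub>" "\<one>\<^bsub>R\<^esub>" x] x lm(7)[of x] 0 by (simp add: R.l_neg)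
  then show "(\<ominus>\<^bsub>R\<^esub> \<one>\<^bsub>R\<^esub>) \<odot>\<^bsub>M\<^esub> x = \<ominus>\<^bsub>M\<^esub> x"
    using M.minus_equality[of "(\<ominus>\<^bsub>R\<^esub> \<one>\<^bsub>R\<^esub>) \<odot>\<^bsub>M\<^esub> x" x] lm(3) x by simp
qed

definition submodule_of :: "'r ring \<Rightarrow> ('r, 'm) module \<Rightarrow> 'm set \<Rightarrow> bool" where
  "submodule_of R M N \<longleftrightarrow> N \<subseteq> carrier M \<and> \<zero>\<^bsub>M\<^esub> \<in> N \<and>
     (\<forall>x\<in>N. \<forall>y\<in>N. x \<oplus>\<^bsub>M\<^esub> y \<in> N) \<and> (\<forall>a\<in>carrier R. \<forall>x\<in>N. a \<odot>\<^bsub>M\<^esub> x \<in> N)"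

lemma submodule_ofD:
  assumes "submodule_of R M N"
  shows "\<And>x. x \<in> N \<Longrightarrow> x \<in> carrier M" "\<zero>\<^bsub>M\<^esub> \<in> N"
    "\<And>x y. x \<in> N \<Longrightarrow> y \<in> N \<Longrightarrow> x \<oplus>\<^bsub>M\<^esub> y \<in> N"
    "\<And>a x. a \<in> carrier R \<Longrightarrow> x \<in> N \<Longrightarrow> a \<odot>\<^bsub>M\<^esub> x \<in> N"
  using assms by (auto simp: submodule_of_def)

lemma submodule_of_minus:
  assumes M: "left_module R M" and N: "submodule_of R M N" and x: "x \<in> N"
  shows "\<ominus>\<^bsub>M\<^esub> x \<in> N"
proof -
  interpret R: ring R using left_moduleD[OF M] by blast
  show ?thesis
    using left_module_smult_minus_one(1)[OF M] submodule_ofD[OF N] x by (simp flip: left_module_smult_minus_one(1)[OF M])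
qed

lemma left_module_submodule:
  assumes M: "left_module R M" and N: "submodule_of R M N"
  shows "left_module R (M\<lparr>carrier := N\<rparr>)"
proof -
  note lm = left_moduleD[OF M]
  note sm = submodule_ofD[OF N]
  interpret M: abelian_group M by (rule lm)
  have "abelian_group (M\<lparr>carrier := N\<rparr>)"
  proof (rule abelian_groupI)
    fix x assume "x \<in> carrier (M\<lparr>carrier := N\<rparr>)"
    then show "\<exists>y\<in>carrier (M\<lparr>carrier := N\<rparr>). y \<oplus>\<^bsub>M\<lparr>carrier := N\<rparr>\<^esub> x = \<zero>\<^bsub>M\<lparr>carrier := N\<rparr>\<^esub>"
      using submodule_of_minus[OF M N] sm by (auto intro!: bexI[of _ "\<ominus>\<^bsub>M\<^esub> x"] M.l_neg)
  qed (auto simp: sm M.a_ac)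
  then show ?thesis
    using lm sm unfolding left_module_def by simp
qed

lemma submodule_of_sum:
  assumes M: "left_module R M" and K: "submodule_of R M K" and L: "submodule_of R M L"
  shows "submodule_of R M {k \<oplus>\<^bsub>M\<^esub> l | k l. k \<in> K \<and> l \<in> L}"
proof -
  interpret M: abelian_group M using left_moduleD[OF M] by blast
  note k = submodule_ofD[OF K] and l = submodule_ofD[OF L]
  have "\<zero>\<^bsub>M\<^esub> \<oplus>\<^bsub>M\<^esub> \<zero>\<^bsub>M\<^esub> = \<zero>\<^bsub>M\<^esub>" by simp
  moreover have "(x \<oplus>\<^bsub>M\<^esub> y) \<oplus>\<^bsub>M\<^esub> (u \<oplus>\<^bsub>M\<^esub> v) = (x \<oplus>\<^bsub>M\<^esub> u) \<oplus>\<^bsub>M\<^esub> (y \<oplus>\<^bsub>M\<^esub> v)"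
    if "x \<in> K" "y \<in> L" "u \<in> K" "v \<in> L" for x y u v
    using that k(1) l(1) by (simp add: M.a_ac)
  moreover have "a \<odot>\<^bsub>M\<^esub> (x \<oplus>\<^bsub>M\<^esub> y) = a \<odot>\<^bsub>M\<^esub> x \<oplus>\<^bsub>M\<^esub> a \<odot>\<^bsub>M\<^esub> y" if "a \<in> carrier R" "x \<in> K" "y \<in> L" for a x y
    using that k(1) l(1) left_moduleD(5)[OF M] by simp
  ultimately show ?thesis
    using k l unfolding submodule_of_def by (auto; metis)
qed

lemma submodule_of_cancel:
  assumes M: "left_module R M" and N: "submodule_of R M N" and x: "x \<in> carrier M" and "x \<oplus>\<^bsub>M\<^esub> s \<in> N" and s: "s \<in> N"
  shows "x \<in> N"
proof -
  interpret M: abelian_group M using left_moduleD[OF M] by blast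
  have "(x \<oplus>\<^bsub>M\<^esub> s) \<oplus>\<^bsub>M\<^esub> \<ominus>\<^bsub>M\<^esub> s = x" using x submodule_ofD(1)[OF N s] by (simp add: M.a_assoc M.r_neg)
  moreover have "(x \<oplus>\<^bsub>M\<^esub> s) \<oplus>\<^bsub>M\<^esub> \<ominus>\<^bsub>M\<^esub> s \<in> N"
    using submodule_ofD(3)[OF N] assms submodule_of_minus[OF M N s] by blast
  ultimately show ?thesis by simp
qed

lemma additive_subgroup_submodule:
  assumes M: "left_module R M" and N: "submodule_of R M N"
  shows "abelian_subgroup N M"
proof -
  interpret M: abelian_group M using left_moduleD[OF M] by blast
  have "subgroup N (add_monoid M)"
    using submodule_ofD[OF N] submodule_of_minus[OF M N]
    by (intro subgroup.intro) (auto simp: a_inv_def[symmetric] simp del: a_inv_def)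
  then show ?thesis
    by (intro abelian_subgroupI3 additive_subgroup.intro M.abelian_group_axioms)
qed

lemma coset_eq_iff:
  assumes M: "left_module R M" and N: "submodule_of R M N"
    and x: "x \<in> carrier M" and y: "y \<in> carrier M"
  shows "a_r_coset M N x = a_r_coset M N y \<longleftrightarrow> x \<ominus>\<^bsub>M\<^esub> y \<in> N"
proof -
  interpret abelian_subgroup N M by (rule additive_subgroup_submodule[OF M N])
  have "x \<ominus>\<^bsub>M\<^esub> y \<in> N \<longleftrightarrow> x \<in> a_r_coset M N y"
    using a_rcos_module[OF y x] by (simp add: a_minus_def)
  also have "\<dots> \<longleftrightarrow> a_r_coset M N x = a_r_coset M N y"
    using a_repr_independence'[of x y] a_rcos_self[OF x] y by auto
  finally show ?thesis by blast
qed

lemma quotient_module_simps [simp]: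
  "carrier (quotient_module M N) = a_r_coset M N ` carrier M" "zero (quotient_module M N) = N"
  by (auto simp: quotient_module_def A_RCOSETS_def')

lemma quotient_module_coset:
  assumes M: "left_module R M" and N: "submodule_of R M N"
  shows "\<And>x y. x \<in> carrier M \<Longrightarrow> y \<in> carrier M \<Longrightarrow>
      a_r_coset M N x \<oplus>\<^bsub>quotient_module M N\<^esub> a_r_coset M N y = a_r_coset M N (x \<oplus>\<^bsub>M\<^esub> y)"
    and "\<And>a x. a \<in> carrier R \<Longrightarrow> x \<in> carrier M \<Longrightarrow>
      a \<odot>\<^bsub>quotient_module M N\<^esub> a_r_coset M N x = a_r_coset M N (a \<odot>\<^bsub>M\<^esub> x)"
    and "a_r_coset M N \<zero>\<^bsub>M\<^esub> = N"
proof -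
  note lm = left_moduleD[OF M]
  note sm = submodule_ofD[OF N]
  interpret abelian_subgroup N M by (rule additive_subgroup_submodule[OF M N])
  show "a_r_coset M N x \<oplus>\<^bsub>quotient_module M N\<^esub> a_r_coset M N y = a_r_coset M N (x \<oplus>\<^bsub>M\<^esub> y)"
    if "x \<in> carrier M" "y \<in> carrier M" for x y
    using that by (simp add: quotient_module_def a_rcos_sum)
  show "a_r_coset M N \<zero>\<^bsub>M\<^esub> = N"
    by (simp add: sm(2) a_coset_join2 a_subgroup)
  show "a \<odot>\<^bsub>quotient_module M N\<^esub> a_r_coset M N x = a_r_coset M N (a \<odot>\<^bsub>M\<^esub> x)"
    if a: "a \<in> carrier R" and x: "x \<in> carrier M" for a x
  proof -
    have eq: "a_r_coset M N (a \<odot>\<^bsub>M\<^esub> y) = a_r_coset M N (a \<odot>\<^bsub>M\<^esub> x)" if y: "y \<in> a_r_coset M N x" for y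
    proof -
      obtain n where n: "n \<in> N" "y = n \<oplus>\<^bsub>M\<^esub> x" using y by (auto simp: a_r_coset_def')
      have "a \<odot>\<^bsub>M\<^esub> y \<ominus>\<^bsub>M\<^esub> a \<odot>\<^bsub>M\<^esub> x = a \<odot>\<^bsub>M\<^esub> n"
        using n a x lm sm by (simp add: a_minus_def a_assoc r_neg)
      then show ?thesis
        using coset_eq_iff[OF M N] n a x lm sm by simp
    qed
    have "(\<Union>y\<in>a_r_coset M N x. a_r_coset M N (a \<odot>\<^bsub>M\<^esub> y)) = a_r_coset M N (a \<odot>\<^bsub>M\<^esub> x)"
      by (rule UN_constant_eq[OF a_rcos_self[OF x]]) (intro ballI eq)
    then show ?thesis by (simp add: quotient_module_def)
  qed
qed

lemma left_module_quotient:
  assumes M: "left_module R M" and N: "submodule_of R M N"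
  shows "left_module R (quotient_module M N)"
proof -
  note lm = left_moduleD[OF M]
  interpret M: abelian_group M by (rule lm)
  define Q where "Q = quotient_module M N"
  define c where "c = a_r_coset M N"
  have q: "\<And>x y. x \<in> carrier M \<Longrightarrow> y \<in> carrier M \<Longrightarrow> c x \<oplus>\<^bsub>Q\<^esub> c y = c (x \<oplus>\<^bsub>M\<^esub> y)"
    "\<And>a x. a \<in> carrier R \<Longrightarrow> x \<in> carrier M \<Longrightarrow> a \<odot>\<^bsub>Q\<^esub> c x = c (a \<odot>\<^bsub>M\<^esub> x)"
    using quotient_module_coset[OF M N] by (simp_all add: Q_def c_def)
  have car: "carrier Q = c ` carrier M" by (simp add: Q_def c_def)
  have z: "\<zero>\<^bsub>Q\<^esub> = c \<zero>\<^bsub>M\<^esub>" using quotient_module_coset(3)[OF M N] by (simp add: Q_def c_def)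
  have "abelian_group Q"
  proof (rule abelian_groupI)
    show "\<exists>y\<in>carrier Q. y \<oplus>\<^bsub>Q\<^esub> x = \<zero>\<^bsub>Q\<^esub>" if x: "x \<in> carrier Q" for x
    proof -
      obtain u where u: "u \<in> carrier M" "x = c u" using x car by auto
      then have "c (\<ominus>\<^bsub>M\<^esub> u) \<oplus>\<^bsub>Q\<^esub> x = \<zero>\<^bsub>Q\<^esub>" unfolding z by (simp add: q M.l_neg)
      then show ?thesis using u car by auto
    qed
  qed (auto simp: car z q M.a_ac)
  interpret R: ring R by (rule lm)
  have "left_module R Q"
    using \<open>abelian_group Q\<close> unfolding left_module_def car by (auto simp: q lm R.ring_axioms)
  then show ?thesis by (simp add: Q_def)
qed

text \<open>On \<open>Y\<close> both maps are surjective and have the same kernel, so \<open>M\<close> and \<open>N\<close> are the same quotient of \<open>Y\<close>.  The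
  larger domain of \<open>\<kappa>\<close> serves to compare a complex with a subcomplex: \<open>Z\<close> and \<open>Y\<close> are their modules of cycles.\<close>

lemma module_isomorphicI_representatives:
  assumes M: "left_module R M" and N: "left_module R N"
    and C: "left_module R C" and Z: "submodule_of R C Z" and Y: "submodule_of R C Y" and YZ: "Y \<subseteq> Z"
    and \<kappa>: "\<kappa> \<in> linear_maps R (C\<lparr>carrier := Z\<rparr>) M" and \<mu>: "\<mu> \<in> linear_maps R (C\<lparr>carrier := Y\<rparr>) N"
    and surj\<kappa>: "carrier M \<subseteq> \<kappa> ` Y" and surj\<mu>: "carrier N \<subseteq> \<mu> ` Y"
    and ker: "\<And>y. y \<in> Y \<Longrightarrow> \<kappa> y = \<zero>\<^bsub>M\<^esub> \<longleftrightarrow> \<mu> y = \<zero>\<^bsub>N\<^esub>"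
  shows "module_isomorphic R M N"
proof -
  note sY = submodule_ofD[OF Y]
  interpret C: abelian_group C using left_moduleD[OF C] by blast
  interpret M: abelian_group M using left_moduleD[OF M] by blast
  interpret N: abelian_group N using left_moduleD[OF N] by blast
  have k: "\<kappa> y \<in> carrier M" "\<mu> y \<in> carrier N" if "y \<in> Y" for y
    using that YZ \<kappa> \<mu> by (auto simp: linear_maps_def)
  have kadd: "\<kappa> (x \<oplus>\<^bsub>C\<^esub> y) = \<kappa> x \<oplus>\<^bsub>M\<^esub> \<kappa> y" "\<mu> (x \<oplus>\<^bsub>C\<^esub> y) = \<mu> x \<oplus>\<^bsub>N\<^esub> \<mu> y" if "x \<in> Y" "y \<in> Y" for x y
    using that YZ \<kappa> \<mu> by (auto simp: linear_maps_def subset_iff)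
  have ksm: "\<kappa> (a \<odot>\<^bsub>C\<^esub> y) = a \<odot>\<^bsub>M\<^esub> \<kappa> y" "\<mu> (a \<odot>\<^bsub>C\<^esub> y) = a \<odot>\<^bsub>N\<^esub> \<mu> y" if "a \<in> carrier R" "y \<in> Y" for a y
    using that YZ \<kappa> \<mu> by (auto simp: linear_maps_def subset_iff)
  have eq: "\<kappa> x = \<kappa> y \<longleftrightarrow> \<mu> x = \<mu> y" if xy: "x \<in> Y" "y \<in> Y" for x y
  proof -
    let ?d = "x \<oplus>\<^bsub>C\<^esub> \<ominus>\<^bsub>C\<^esub> y"
    have my: "\<ominus>\<^bsub>C\<^esub> y \<in> Y" by (rule submodule_of_minus[OF C Y xy(2)])
    then have d: "?d \<in> Y" using sY xy by blast
    have "?d \<oplus>\<^bsub>C\<^esub> y = x" using xy my sY by (simp add: C.a_assoc C.l_neg)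
    then have "\<kappa> x = \<kappa> ?d \<oplus>\<^bsub>M\<^esub> \<kappa> y" "\<mu> x = \<mu> ?d \<oplus>\<^bsub>N\<^esub> \<mu> y"
      using kadd[OF d xy(2)] by simp_all
    then have "\<kappa> x = \<kappa> y \<longleftrightarrow> \<kappa> ?d = \<zero>\<^bsub>M\<^esub>" "\<mu> x = \<mu> y \<longleftrightarrow> \<mu> ?d = \<zero>\<^bsub>N\<^esub>"
      using k d xy by (simp_all add: M.add.l_cancel_one N.add.l_cancel_one)
    then show ?thesis using ker[OF d] by simp
  qed
  define h where "h X = \<mu> (SOME y. y \<in> Y \<and> \<kappa> y = X)" for X
  have h: "h (\<kappa> y) = \<mu> y" if "y \<in> Y" for y
  proof -
    have "(SOME z. z \<in> Y \<and> \<kappa> z = \<kappa> y) \<in> Y \<and> \<kappa> (SOME z. z \<in> Y \<and> \<kappa> z = \<kappa> y) = \<kappa> y"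
      by (rule someI[of _ y]) (use that in simp)
    then show ?thesis unfolding h_def using eq that by blast
  qed
  have car: "carrier M = \<kappa> ` Y" "carrier N = \<mu> ` Y" using surj\<kappa> surj\<mu> k by auto
  have "h \<in> linear_maps R M N"
    unfolding linear_maps_def car
    using h k sY kadd[symmetric] ksm[symmetric] by auto
  moreover have "bij_betw h (carrier M) (carrier N)"
    unfolding bij_betw_def inj_on_def car using h eq by (auto simp: image_iff)
  ultimately show ?thesis unfolding module_isomorphic_def by blast
qed

lemma coset_eq_subgroup_iff:
  assumes M: "left_module R M" and N: "submodule_of R M N" and x: "x \<in> carrier M"
  shows "a_r_coset M N x = N \<longleftrightarrow> x \<in> N"
proof -
  interpret M: abelian_group M using left_moduleD[OF M] by blast
  show ?thesis
    using coset_eq_iff[OF M N x M.zero_closed] quotient_module_coset(3)[OF M N] x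
      M.minus_equality[of "\<zero>\<^bsub>M\<^esub>" "\<zero>\<^bsub>M\<^esub>"]
    by (simp add: a_minus_def)
qed

lemma coset_linear:
  assumes M: "left_module R M" and N: "submodule_of R M N"
  shows "a_r_coset M N \<in> linear_maps R M (quotient_module M N)"
  unfolding linear_maps_def
proof (intro CollectI conjI ballI funcsetI)
qed (simp_all add: quotient_module_coset(1,2)[OF M N])

lemma linear_maps_zero:
  assumes f: "f \<in> linear_maps R M N" and M: "left_module R M" and N: "left_module R N"
  shows "f \<zero>\<^bsub>M\<^esub> = \<zero>\<^bsub>N\<^esub>"
proof -
  interpret M: abelian_group M using left_moduleD[OF M] by blast
  interpret N: abelian_group N using left_moduleD[OF N] by blast
  have c: "f \<zero>\<^bsub>M\<^esub> \<in> carrier N" using f by (auto simp: linear_maps_def)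
  have "f (\<zero>\<^bsub>M\<^esub> \<oplus>\<^bsub>M\<^esub> \<zero>\<^bsub>M\<^esub>) = f \<zero>\<^bsub>M\<^esub> \<oplus>\<^bsub>N\<^esub> f \<zero>\<^bsub>M\<^esub>"
    using f M.zero_closed unfolding linear_maps_def by blast
  then show ?thesis using N.add.l_cancel_one[OF c c] by simp
qed

lemma submodule_of_image:
  assumes f: "f \<in> linear_maps R M N" and M: "left_module R M" and N: "left_module R N" and K: "submodule_of R M K"
  shows "submodule_of R N (f ` K)"
proof -
  interpret R: ring R using left_moduleD[OF M] by blast
  note sk = submodule_ofD[OF K]
  have add: "f x \<oplus>\<^bsub>N\<^esub> f y = f (x \<oplus>\<^bsub>M\<^esub> y)" if "x \<in> K" "y \<in> K" for x y
    using that f sk by (auto simp: linear_maps_def)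
  have smult: "a \<odot>\<^bsub>N\<^esub> f x = f (a \<odot>\<^bsub>M\<^esub> x)" if "x \<in> K" "a \<in> carrier R" for x a
    using that f sk by (auto simp: linear_maps_def)
  have "\<zero>\<^bsub>N\<^esub> \<in> f ` K" using image_eqI[OF _ sk(2), of _ f] linear_maps_zero[OF f M N] by simp
  moreover have "f ` K \<subseteq> carrier N" using f sk(1) by (auto simp: linear_maps_def)
  ultimately show ?thesis using sk by (auto simp: submodule_of_def add smult)
qed

lemma submodule_of_vimage:
  assumes f: "f \<in> linear_maps R M N" and M: "left_module R M" and N: "left_module R N" and K: "submodule_of R N K"
  shows "submodule_of R M {x \<in> carrier M. f x \<in> K}"
proof -
  interpret M: abelian_group M using left_moduleD[OF M] by blast
  show ?thesis
    using f linear_maps_zero[OF f M N] submodule_ofD[OF K] left_moduleD(3)[OF M] 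
    unfolding submodule_of_def linear_maps_def by auto
qed

lemma submodule_of_submodule [simp]:
  "submodule_of R (M\<lparr>carrier := C\<rparr>) D \<longleftrightarrow>
     D \<subseteq> C \<and> \<zero>\<^bsub>M\<^esub> \<in> D \<and> (\<forall>x\<in>D. \<forall>y\<in>D. x \<oplus>\<^bsub>M\<^esub> y \<in> D) \<and> (\<forall>a\<in>carrier R. \<forall>x\<in>D. a \<odot>\<^bsub>M\<^esub> x \<in> D)"
  by (simp add: submodule_of_def)

lemma linear_maps_compose:
  "f \<in> linear_maps R M N \<Longrightarrow> g \<in> linear_maps R N P \<Longrightarrow> (\<lambda>x. g (f x)) \<in> linear_maps R M P"
  by (auto simp: linear_maps_def Pi_iff)

text \<open>Relative homology is a quotient of a submodule of a quotient.  It is easier to compare as a quotient of the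
  relative cycles \<open>Z\<close> themselves; \<open>\<kappa>\<close> maps a cycle to its class.\<close>

lemma relative_homology_representatives:
  fixes R :: "'r ring" and M :: "nat \<Rightarrow> ('r, 'm) module"
  assumes M: "\<And>j. left_module R (M j)"
    and C: "\<And>j. submodule_of R (M j) (C j)" and D: "\<And>j. submodule_of R (M j) (D j)"
    and DC: "\<And>j. D j \<subseteq> C j"
    and d: "\<And>j. d j \<in> linear_maps R (M j\<lparr>carrier := C j\<rparr>) (M (j - 1)\<lparr>carrier := C (j - 1)\<rparr>)"
    and dD: "\<And>j x. x \<in> D j \<Longrightarrow> d j x \<in> D (j - 1)"
    and dd: "\<And>j x. x \<in> C j \<Longrightarrow> d (j - 1) (d j x) = \<zero>\<^bsub>M (j - 1 - 1)\<^esub>"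
    and d0: "\<And>x. x \<in> C 0 \<Longrightarrow> d 0 x = \<zero>\<^bsub>M 0\<^esub>"
  defines "H \<equiv> \<lambda>i. relative_homology (\<lambda>j. M j\<lparr>carrier := C j\<rparr>) D d i"
    and "Z \<equiv> \<lambda>i. {z \<in> C i. d i z \<in> D (i - 1)}"
  obtains \<kappa> where "left_module R (H i)" "submodule_of R (M i) (Z i)"
    "\<kappa> \<in> linear_maps R (M i\<lparr>carrier := Z i\<rparr>) (H i)" "carrier (H i) = \<kappa> ` Z i"
    "\<forall>z\<in>Z i. \<kappa> z = \<zero>\<^bsub>H i\<^esub> \<longleftrightarrow> (\<exists>w\<in>C (Suc i). \<exists>b\<in>D i. z = d (Suc i) w \<oplus>\<^bsub>M i\<^esub> b)"
proof -
  define C' where "C' j = M j\<lparr>carrier := C j\<rparr>" for j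
  have C': "left_module R (C' j)" for j
    unfolding C'_def by (rule left_module_submodule[OF M C])
  have D': "submodule_of R (C' j) (D j)" for j
    using DC submodule_ofD[OF D] unfolding C'_def by auto
  define Q where "Q j = quotient_module (C' j) (D j)" for j
  have Q: "left_module R (Q j)" for j
    unfolding Q_def by (rule left_module_quotient[OF C' D'])
  define c where "c j = a_r_coset (C' j) (D j)" for j
  have c: "c j \<in> linear_maps R (C' j) (Q j)" for j
    unfolding Q_def c_def by (rule coset_linear[OF C' D'])
  have carQ: "carrier (Q j) = c j ` C j" and zQ: "\<zero>\<^bsub>Q j\<^esub> = D j" for j
    by (simp_all add: Q_def c_def C'_def)
  have c0: "c j x = D j \<longleftrightarrow> x \<in> D j" if "x \<in> C j" for j x
    unfolding c_def using coset_eq_subgroup_iff[OF C' D'] that by (simp add: C'_def)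
  have d': "d j \<in> linear_maps R (C' j) (C' (j - 1))" for j
    unfolding C'_def by (rule d)
  have dC: "d j x \<in> C (j - 1)" if "x \<in> C j" for j x
    using d'[of j] that by (auto simp: linear_maps_def C'_def)
  define dq where "dq j X = (\<Union>x\<in>X. c (j - 1) (d j x))" for j X
  have dq: "dq j (c j x) = c (j - 1) (d j x)" if x: "x \<in> C j" for j x
  proof -
    interpret sub: abelian_subgroup "D j" "C' j" by (rule additive_subgroup_submodule[OF C' D'])
    have eq: "c (j - 1) (d j y) = c (j - 1) (d j x)" if y: "y \<in> c j x" for y
    proof -
      obtain n where n: "n \<in> D j" "y = n \<oplus>\<^bsub>C' j\<^esub> x" using y by (auto simp: c_def a_r_coset_def')
      have nC: "n \<in> C j" using n DC by blast
      have "d j y = d j n \<oplus>\<^bsub>C' (j - 1)\<^esub> d j x"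
        using d'[of j] x nC n(2) by (simp add: linear_maps_def C'_def)
      then have "c (j - 1) (d j y) = c (j - 1) (d j n) \<oplus>\<^bsub>Q (j - 1)\<^esub> c (j - 1) (d j x)"
        using c[of "j - 1"] dC[OF nC] dC[OF x] by (simp add: linear_maps_def C'_def)
      moreover have "c (j - 1) (d j n) = \<zero>\<^bsub>Q (j - 1)\<^esub>"
        using c0[OF dC[OF nC]] dD[OF n(1)] by (simp add: zQ)
      moreover have "c (j - 1) (d j x) \<in> carrier (Q (j - 1))"
        using dC[OF x] carQ by blast
      ultimately show ?thesis
        using abelian_group.axioms(1)[OF left_moduleD(2)[OF Q]] by (metis abelian_monoid.l_zero)
    qed
    have "x \<in> c j x" unfolding c_def using sub.a_rcos_self x by (simp add: C'_def)
    then show ?thesis unfolding dq_def by (rule UN_constant_eq) (intro ballI eq)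
  qed
  have dv: "Z i = {x \<in> carrier (C' i). d i x \<in> D (i - 1)}" by (simp add: Z_def C'_def)
  have Z: "submodule_of R (C' i) (Z i)"
    unfolding dv by (rule submodule_of_vimage[OF d' C' C' D'])
  \<comment> \<open>In degree \<open>0\<close> all chains are cycles.  As \<open>d 0\<close> vanishes and \<open>0 \<in> D\<close>, this case needs no special treatment in \<open>Z\<close>.\<close>
  have Zq: "{z \<in> carrier (Q i). i = 0 \<or> dq i z = \<zero>\<^bsub>Q (i - 1)\<^esub>} = c i ` Z i"
  proof -
    have "(i = 0 \<or> dq i (c i z) = \<zero>\<^bsub>Q (i - 1)\<^esub>) \<longleftrightarrow> d i z \<in> D (i - 1)" if z: "z \<in> C i" for z
      using dq[OF z] c0[OF dC[OF z]] d0 z submodule_ofD(2)[OF D] by (cases "i = 0") (auto simp: zQ)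
    then show ?thesis unfolding carQ Z_def by auto
  qed
  define B where "B = d (Suc i) ` C (Suc i)"
  have B: "submodule_of R (C' i) B"
    unfolding B_def using submodule_of_image[OF d' C' C', of "Suc i" "C (Suc i)"] C[of "Suc i"]
    by (simp add: C'_def submodule_of_def)
  have BZ: "B \<subseteq> Z i"
    using dd[of _ "Suc i"] dC[of _ "Suc i"] submodule_ofD(2)[OF D] by (auto simp: B_def Z_def)
  have Bq: "dq (Suc i) ` carrier (Q (Suc i)) = c i ` B"
    unfolding carQ B_def using dq[of _ "Suc i"] by (force simp: image_iff)
  define Y where "Y = Q i\<lparr>carrier := c i ` Z i\<rparr>"
  have sZ: "submodule_of R (Q i) (c i ` Z i)" by (rule submodule_of_image[OF c C' Q Z])
  have sB: "submodule_of R (Q i) (c i ` B)" by (rule submodule_of_image[OF c C' Q B])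
  have Y: "left_module R Y" unfolding Y_def by (rule left_module_submodule[OF Q sZ])
  have BY: "submodule_of R Y (c i ` B)"
    using submodule_ofD[OF sB] BZ unfolding Y_def by auto
  have H: "H i = quotient_module Y (c i ` B)"
    unfolding H_def relative_homology_def homology_def
    unfolding C'_def[symmetric] Q_def[symmetric] c_def[symmetric] dq_def[symmetric] Zq Bq Y_def ..
  define \<kappa> where "\<kappa> z = a_r_coset Y (c i ` B) (c i z)" for z
  have cY: "c i \<in> linear_maps R (M i\<lparr>carrier := Z i\<rparr>) Y"
    using c[of i] submodule_ofD(1)[OF Z] by (auto simp: linear_maps_def Y_def C'_def)
  show thesis
  proof
    show "left_module R (H i)" unfolding H by (rule left_module_quotient[OF Y BY])
    show "submodule_of R (M i) (Z i)"
      using Z submodule_ofD(1)[OF C] by (auto simp: C'_def submodule_of_def)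
    show "\<kappa> \<in> linear_maps R (M i\<lparr>carrier := Z i\<rparr>) (H i)"
      unfolding \<kappa>_def H by (rule linear_maps_compose[OF cY coset_linear[OF Y BY]])
    show "carrier (H i) = \<kappa> ` Z i" unfolding H \<kappa>_def by (auto simp: Y_def)
    show "\<forall>z\<in>Z i. \<kappa> z = \<zero>\<^bsub>H i\<^esub> \<longleftrightarrow> (\<exists>w\<in>C (Suc i). \<exists>b\<in>D i. z = d (Suc i) w \<oplus>\<^bsub>M i\<^esub> b)"
    proof
      fix z assume z: "z \<in> Z i"
      interpret C': abelian_group "C' i" using left_moduleD[OF C'] by blast
      have zC: "z \<in> C i" using z by (simp add: Z_def)
      have "\<kappa> z = \<zero>\<^bsub>H i\<^esub> \<longleftrightarrow> c i z \<in> c i ` B"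
        unfolding \<kappa>_def H using coset_eq_subgroup_iff[OF Y BY, of "c i z"] z by (simp add: Y_def)
      also have "\<dots> \<longleftrightarrow> (\<exists>w\<in>C (Suc i). z \<ominus>\<^bsub>C' i\<^esub> d (Suc i) w \<in> D i)"
        using coset_eq_iff[OF C' D', of z i] zC dC[of _ "Suc i"]
        by (auto simp: B_def c_def C'_def image_iff)
      also have "\<dots> \<longleftrightarrow> (\<exists>w\<in>C (Suc i). \<exists>b\<in>D i. z = d (Suc i) w \<oplus>\<^bsub>M i\<^esub> b)"
      proof (rule bex_cong[OF refl])
        fix w assume "w \<in> C (Suc i)"
        then have w: "d (Suc i) w \<in> carrier (C' i)" and z': "z \<in> carrier (C' i)" and o: "add (M i) = add (C' i)"
          using dC[of w "Suc i"] zC by (simp_all add: C'_def)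
        have b: "b \<in> carrier (C' i)" if "b \<in> D i" for b using that DC by (auto simp: C'_def)
        show "z \<ominus>\<^bsub>C' i\<^esub> d (Suc i) w \<in> D i \<longleftrightarrow> (\<exists>b\<in>D i. z = d (Suc i) w \<oplus>\<^bsub>M i\<^esub> b)"
        proof
          assume "z \<ominus>\<^bsub>C' i\<^esub> d (Suc i) w \<in> D i"
          moreover have "z = d (Suc i) w \<oplus>\<^bsub>C' i\<^esub> (z \<ominus>\<^bsub>C' i\<^esub> d (Suc i) w)"
            using w z' by (simp add: a_minus_def C'.a_lcomm C'.r_neg)
          ultimately show "\<exists>b\<in>D i. z = d (Suc i) w \<oplus>\<^bsub>M i\<^esub> b" unfolding o by blast
        next
          assume "\<exists>b\<in>D i. z = d (Suc i) w \<oplus>\<^bsub>M i\<^esub> b"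
          then obtain v where v: "v \<in> D i" "z = d (Suc i) w \<oplus>\<^bsub>C' i\<^esub> v" unfolding o by blast
          then have "z \<ominus>\<^bsub>C' i\<^esub> d (Suc i) w = v"
            using w b[OF v(1)] by (simp add: a_minus_def C'.a_assoc C'.a_comm C'.r_neg C'.a_lcomm)
          then show "z \<ominus>\<^bsub>C' i\<^esub> d (Suc i) w \<in> D i" using v by simp
        qed
      qed
      finally show "\<kappa> z = \<zero>\<^bsub>H i\<^esub> \<longleftrightarrow> (\<exists>w\<in>C (Suc i). \<exists>b\<in>D i. z = d (Suc i) w \<oplus>\<^bsub>M i\<^esub> b)" .
    qed
  qed
qed

section \<open>Integer combinations of elements of a module\<close>

abbreviation "keys \<equiv> Poly_Mapping.keys"

text \<open>The value of a chain at a point of a simplex is a sum over the pieces of many simplices.  Such sums are formed in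
  the free abelian group, where \<open>frag_extend\<close> is available, and evaluated in the module only at the end.  All
  elements of the type are generators, which avoids side conditions; the values of those outside of the
  module are left open.\<close>

definition combination :: "('r, 'g) module \<Rightarrow> ('g \<Rightarrow>\<^sub>0 int) \<Rightarrow> 'g" where
  "combination M = (SOME h. h \<in> hom (free_Abelian_group UNIV) (add_monoid M) \<and>
     (\<forall>g\<in>carrier M. h (frag_of g) = g))"

context
  fixes R :: "'r ring" and M :: "('r, 'g) module"
  assumes M: "left_module R M"
begin

lemma combination_hom: "combination M \<in> hom (free_Abelian_group UNIV) (add_monoid M)"
  and combination_of: "g \<in> carrier M \<Longrightarrow> combination M (frag_of g) = g"
proof -
  interpret M: abelian_group M using left_moduleD[OF M] by blast
  obtain h where "h \<in> hom (free_Abelian_group UNIV) (add_monoid M)"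
    "\<And>x. x \<in> UNIV \<Longrightarrow> h (frag_of x) = (if x \<in> carrier M then x else \<zero>\<^bsub>M\<^esub>)"
    by (rule comm_group.free_Abelian_group_universal[OF M.a_comm_group, of "\<lambda>g. if g \<in> carrier M then g else \<zero>\<^bsub>M\<^esub>" UNIV]) auto
  then have "h \<in> hom (free_Abelian_group UNIV) (add_monoid M) \<and> (\<forall>g\<in>carrier M. h (frag_of g) = g)" by auto
  then have "combination M \<in> hom (free_Abelian_group UNIV) (add_monoid M) \<and>
      (\<forall>g\<in>carrier M. combination M (frag_of g) = g)"
    unfolding combination_def
    by (rule someI[of "\<lambda>h. h \<in> hom (free_Abelian_group UNIV) (add_monoid M) \<and> (\<forall>g\<in>carrier M. h (frag_of g) = g)"])
  then show "combination M \<in> hom (free_Abelian_group UNIV) (add_monoid M)"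
    "g \<in> carrier M \<Longrightarrow> combination M (frag_of g) = g" by auto
qed

lemma combination_closed [simp]: "combination M c \<in> carrier M"
  using combination_hom by (auto simp: hom_def carrier_free_Abelian_group_iff)

lemma combination_add: "combination M (a + b) = combination M a \<oplus>\<^bsub>M\<^esub> combination M b"
  using combination_hom by (auto simp: hom_def carrier_free_Abelian_group_iff)

lemma combination_0 [simp]: "combination M 0 = \<zero>\<^bsub>M\<^esub>"
proof -
  interpret M: abelian_group M using left_moduleD[OF M] by blast
  show ?thesis using combination_add[of 0 0] M.add.l_cancel_one[of "combination M 0" "combination M 0"] by simp
qed

lemma combination_minus: "combination M (- a) = \<ominus>\<^bsub>M\<^esub> combination M a"
proof -
  interpret M: abelian_group M using left_moduleD[OF M] by blast
  show ?thesis using combination_add[of "- a" a] M.minus_equality[of "combination M (- a)" "combination M a"] by simp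
qed

lemma combination_diff: "combination M (a - b) = combination M a \<ominus>\<^bsub>M\<^esub> combination M b"
  using combination_add[of a "- b"] by (simp add: combination_minus a_minus_def)

lemma combination_sum:
  "finite S \<Longrightarrow> combination M (sum f S) = finsum M (\<lambda>x. combination M (f x)) S"
proof (induction S rule: finite_induct)
  case empty
  interpret M: abelian_group M using left_moduleD[OF M] by blast
  show ?case by simp
next
  case (insert x S)
  interpret M: abelian_group M using left_moduleD[OF M] by blast
  show ?case using insert by (simp add: combination_add M.finsum_insert)
qed

end

definition additive_map :: "('r, 'm) module \<Rightarrow> ('r, 'n) module \<Rightarrow> ('m \<Rightarrow> 'n) \<Rightarrow> bool" where
  "additive_map M N h \<longleftrightarrow> h \<in> carrier M \<rightarrow> carrier N \<and>
     (\<forall>x\<in>carrier M. \<forall>y\<in>carrier M. h (x \<oplus>\<^bsub>M\<^esub> y) = h x \<oplus>\<^bsub>N\<^esub> h y)"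

lemma additive_map_zero_diff:
  assumes h: "additive_map M N h" and M: "left_module R M" and N: "left_module R N"
  shows "h \<zero>\<^bsub>M\<^esub> = \<zero>\<^bsub>N\<^esub>"
    and "x \<in> carrier M \<Longrightarrow> y \<in> carrier M \<Longrightarrow> h (x \<ominus>\<^bsub>M\<^esub> y) = h x \<ominus>\<^bsub>N\<^esub> h y"
proof -
  interpret M: abelian_group M using left_moduleD[OF M] by blast
  interpret N: abelian_group N using left_moduleD[OF N] by blast
  have c: "h x \<in> carrier N" if "x \<in> carrier M" for x using h that by (auto simp: additive_map_def)
  have a: "h (x \<oplus>\<^bsub>M\<^esub> y) = h x \<oplus>\<^bsub>N\<^esub> h y" if "x \<in> carrier M" "y \<in> carrier M" for x y
    using h that by (auto simp: additive_map_def)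
  show z: "h \<zero>\<^bsub>M\<^esub> = \<zero>\<^bsub>N\<^esub>"
    using a[OF M.zero_closed M.zero_closed] N.add.l_cancel_one[OF c[OF M.zero_closed] c[OF M.zero_closed]] by simp
  have "h (\<ominus>\<^bsub>M\<^esub> y) = \<ominus>\<^bsub>N\<^esub> h y" if y: "y \<in> carrier M" for y
    using a[OF M.a_inv_closed[OF y] y] N.minus_equality[OF _ c[OF y] c[OF M.a_inv_closed[OF y]]] z y
    by (simp add: M.l_neg)
  then show "x \<in> carrier M \<Longrightarrow> y \<in> carrier M \<Longrightarrow> h (x \<ominus>\<^bsub>M\<^esub> y) = h x \<ominus>\<^bsub>N\<^esub> h y"
    by (simp add: a_minus_def a)
qed

text \<open>For \<open>h = id\<close> this is a congruence rule up to evaluation: generators outside of the module, whose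
  evaluation is unknown, may be replaced as long as the evaluations agree.  For a scalar \<open>h\<close> it gives the
  linearity of operations on chains.\<close>

lemma combination_frag_extend_additive:
  assumes M: "left_module R M" and N: "left_module R N" and h: "additive_map M N h"
    and fg: "\<And>a. a \<in> keys c \<Longrightarrow> combination N (g a) = h (combination M (f a))"
  shows "combination N (frag_extend g c) = h (combination M (frag_extend f c))"
  using subset_refl[of "keys c"]
proof (induction c rule: frag_induction)
  case zero
  show ?case by (simp add: combination_0[OF M] combination_0[OF N] additive_map_zero_diff[OF h M N])
next
  case (one x)
  then show ?case by (simp add: fg)
next
  case (diff a b)
  then show ?case
    by (simp add: frag_extend_diff combination_diff[OF M] combination_diff[OF N] combination_closed[OF M]
        additive_map_zero_diff[OF h M N])
qed

lemma combination_sum_additive: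
  assumes M: "left_module R M" and N: "left_module R N" and h: "additive_map M N h"
    and fg: "\<And>a. a \<in> S \<Longrightarrow> combination N (g a) = h (combination M (f a))"
  shows "combination N (sum g S) = h (combination M (sum f S))"
  using fg
proof (induction S rule: infinite_finite_induct)
  case (insert x S)
  have "h (u \<oplus>\<^bsub>M\<^esub> v) = h u \<oplus>\<^bsub>N\<^esub> h v" if "u \<in> carrier M" "v \<in> carrier M" for u v
    using h that unfolding additive_map_def by blast
  then show ?case using insert by (simp add: combination_add[OF M] combination_add[OF N] combination_closed[OF M])
qed (simp_all add: combination_0[OF M] combination_0[OF N] additive_map_zero_diff[OF h M N])

lemma additive_map_ident: "additive_map M M (\<lambda>x. x)"
  by (auto simp: additive_map_def)

lemma additive_map_smult: "left_module R M \<Longrightarrow> a \<in> carrier R \<Longrightarrow> additive_map M M (\<lambda>x. a \<odot>\<^bsub>M\<^esub> x)"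
  by (auto simp: additive_map_def left_moduleD)

lemmas combination_frag_extend_cong = combination_frag_extend_additive[OF _ _ additive_map_ident]
lemmas combination_sum_cong = combination_sum_additive[OF _ _ additive_map_ident]

lemma frag_extend_add_fun: "frag_extend (\<lambda>a. f a + g a) c = frag_extend f c + frag_extend g c"
  by (simp add: frag_extend_def frag_cmul_distrib2 sum.distrib)

lemma frag_extend_sum_fun: "finite S \<Longrightarrow> frag_extend (\<lambda>a. \<Sum>s\<in>S. f s a) c = (\<Sum>s\<in>S. frag_extend (f s) c)"
  by (induction S rule: finite_induct) (simp_all add: frag_extend_add_fun frag_extend_eq_0)

lemma frag_extend_frag_extend: "frag_extend f (frag_extend g c) = frag_extend (\<lambda>a. frag_extend f (g a)) c"
  using subset_UNIV by (induction c rule: frag_induction) (auto simp: frag_extend_diff)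

lemma frag_extend_diff_fun: "frag_extend (\<lambda>a. f a - g a) c = frag_extend f c - frag_extend g c"
  using frag_extend_add_fun[of "\<lambda>a. f a - g a" g c] by (simp add: algebra_simps)

lemma frag_extend_swap:
  "frag_extend (\<lambda>a. frag_extend (\<lambda>b. f a b) d) c = frag_extend (\<lambda>b. frag_extend (\<lambda>a. f a b) c) d"
  using subset_UNIV[of "keys c"]
  by (induction c rule: frag_induction) (auto simp: frag_extend_diff frag_extend_eq_0 frag_extend_diff_fun)

section \<open>Chains with coefficients in a sheaf\<close>

type_synonym 'a sing = "(nat \<Rightarrow> real) \<Rightarrow> 'a"

abbreviation simplex_space :: "nat \<Rightarrow> (nat \<Rightarrow> real) topology" where
  "simplex_space i \<equiv> subtopology (powertop_real UNIV) (standard_simplex i)"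

text \<open>Chain modules of one degree differ only in their carriers.  Raw chains, which are neither continuous nor locally
  finite, form a module that contains all of them, so that they can be treated as submodules.\<close>

definition raw_chains :: "('r, 'a, 'g) sheaf \<Rightarrow> nat \<Rightarrow> ('a, 'g) lf_chain set" where
  "raw_chains G i = {\<xi>. \<forall>\<sigma>. \<xi> \<sigma> \<in> extensional (lift_domain G i \<sigma>) \<and>
     (\<forall>t\<in>lift_domain G i \<sigma>. \<xi> \<sigma> t \<in> carrier (stalk G (\<sigma> t)))}"

abbreviation raw_module :: "('r, 'a, 'g) sheaf \<Rightarrow> nat \<Rightarrow> ('r, ('a, 'g) lf_chain) module" where
  "raw_module G i \<equiv> chain_module G i (raw_chains G i)"

lemma chain_module_simps:
  "carrier (chain_module G i C) = C" "zero (chain_module G i C) = zero_coefficient G i"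
  "(\<xi> \<oplus>\<^bsub>chain_module G i C\<^esub> \<eta>) = (\<lambda>\<sigma>. \<lambda>t\<in>lift_domain G i \<sigma>. \<xi> \<sigma> t \<oplus>\<^bsub>stalk G (\<sigma> t)\<^esub> \<eta> \<sigma> t)"
  "(a \<odot>\<^bsub>chain_module G i C\<^esub> \<xi>) = (\<lambda>\<sigma>. \<lambda>t\<in>lift_domain G i \<sigma>. a \<odot>\<^bsub>stalk G (\<sigma> t)\<^esub> \<xi> \<sigma> t)"
  "chain_module G i C\<lparr>carrier := D\<rparr> = chain_module G i D"
  by (simp_all add: chain_module_def)

lemma raw_chains_eqI:
  assumes "\<xi> \<in> raw_chains G i" "\<eta> \<in> raw_chains G i"
    "\<And>\<sigma> t. t \<in> lift_domain G i \<sigma> \<Longrightarrow> \<xi> \<sigma> t = \<eta> \<sigma> t"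
  shows "\<xi> = \<eta>"
proof
  fix \<sigma> show "\<xi> \<sigma> = \<eta> \<sigma>"
    using assms by (intro extensionalityI[of _ "lift_domain G i \<sigma>"]) (simp_all add: raw_chains_def)
qed

text \<open>A family prescribes for every simplex \<open>\<sigma>\<close> of dimension \<open>i\<close> a chain \<open>c \<sigma>\<close> in the standard simplex, to be moved
  along \<open>\<sigma>\<close>.  As \<open>c\<close> may depend on \<open>\<sigma>\<close> arbitrarily, simplices can be treated according to their position.\<close>

definition family :: "nat \<Rightarrow> nat \<Rightarrow> ('a sing \<Rightarrow> (nat \<Rightarrow> real) chain) \<Rightarrow> bool" where
  "family i j c \<longleftrightarrow> (\<forall>\<sigma>. singular_chain j (simplex_space i) (c \<sigma>))"

text \<open>The part of the coefficient of \<open>\<tau>\<close>, at the point \<open>t\<close>, that comes from the pieces \<open>a\<close> of \<open>\<sigma>\<close> which are equal to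
  \<open>\<tau>\<close>: coefficients are lifts, and the lift for a piece is the restriction of that for \<open>\<sigma>\<close>.\<close>

definition contribution ::
  "nat \<Rightarrow> ('a, 'g) lf_chain \<Rightarrow> 'a sing \<Rightarrow> (nat \<Rightarrow> real) \<Rightarrow> 'a sing \<Rightarrow>
     (nat \<Rightarrow> real) chain \<Rightarrow> 'g \<Rightarrow>\<^sub>0 int" where
  "contribution j \<xi> \<tau> t \<sigma> = frag_extend (\<lambda>a. if simplex_map j \<sigma> a = \<tau> then frag_of (\<xi> \<sigma> (a t)) else 0)"

definition sources ::
  "('r, 'a, 'g) sheaf \<Rightarrow> nat \<Rightarrow> nat \<Rightarrow> ('a sing \<Rightarrow> (nat \<Rightarrow> real) chain) \<Rightarrow> ('a, 'g) lf_chain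
     \<Rightarrow> 'a sing \<Rightarrow> 'a sing set" where
  "sources G i j c \<xi> \<tau> = {\<sigma> \<in> chain_simplices G i \<xi>. \<exists>a\<in>keys (c \<sigma>). simplex_map j \<sigma> a = \<tau>}"

text \<open>Boundaries, subdivisions, homotopies and restrictions to a set of simplices are of this form for suitable \<open>c\<close>.\<close>

definition substitute ::
  "('r, 'a, 'g) sheaf \<Rightarrow> nat \<Rightarrow> nat \<Rightarrow> ('a sing \<Rightarrow> (nat \<Rightarrow> real) chain) \<Rightarrow> ('a, 'g) lf_chain
     \<Rightarrow> ('a, 'g) lf_chain" where
  "substitute G i j c \<xi> = (\<lambda>\<tau>. \<lambda>t\<in>lift_domain G j \<tau>.
     combination (stalk G (\<tau> t)) (\<Sum>\<sigma>\<in>sources G i j c \<xi> \<tau>. contribution j \<xi> \<tau> t \<sigma> (c \<sigma>)))"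

lemma familyD: "family i j c \<Longrightarrow> a \<in> keys (c \<sigma>) \<Longrightarrow> singular_simplex j (simplex_space i) a"
  by (auto simp: family_def singular_chain_def)

lemma familyD_in: "family i j c \<Longrightarrow> a \<in> keys (c \<sigma>) \<Longrightarrow> t \<in> standard_simplex j \<Longrightarrow> a t \<in> standard_simplex i"
  using familyD[of i j c a \<sigma>] by (auto simp: singular_simplex_subtopology)

lemma lift_domain_subset: "t \<in> lift_domain G i \<sigma> \<Longrightarrow> t \<in> standard_simplex i \<and> \<sigma> t \<in> topspace (base G)"
  by (simp add: lift_domain_def)

lemma lift_domain_simplex_map:
  assumes "a ` standard_simplex j \<subseteq> standard_simplex i" "t \<in> lift_domain G j (simplex_map j \<sigma> a)"
  shows "a t \<in> lift_domain G i \<sigma>"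
  using assms by (auto simp: lift_domain_def simplex_map_def)

locale coefficient_sheaf =
  fixes R :: "'r ring" and G :: "('r, 'a, 'g) sheaf"
  assumes R: "ring R" and sheaf: "sheaf_of_modules R G"
begin

lemma stalk_module: "x \<in> topspace (base G) \<Longrightarrow> left_module R (stalk G x)"
  and stalk_carrier: "x \<in> topspace (base G) \<Longrightarrow> carrier (stalk G x) = {g \<in> topspace (total G). proj G g = x}"
  using sheaf by (auto simp: sheaf_of_modules_def)

lemma lift_stalk: "t \<in> lift_domain G i \<sigma> \<Longrightarrow> left_module R (stalk G (\<sigma> t))"
  by (simp add: lift_domain_def stalk_module)

lemma raw_module: "left_module R (raw_module G i)"
proof -
  let ?M = "raw_module G i"
  interpret R: ring R by (rule R)
  have v: "\<xi> \<sigma> t \<in> carrier (stalk G (\<sigma> t))" if "\<xi> \<in> raw_chains G i" "t \<in> lift_domain G i \<sigma>" for \<xi> \<sigma> t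
    using that by (auto simp: raw_chains_def)
  have ag: "abelian_group (stalk G (\<sigma> t))" if "t \<in> lift_domain G i \<sigma>" for \<sigma> t
    using lift_stalk[OF that] left_moduleD by blast
  have add: "\<xi> \<oplus>\<^bsub>?M\<^esub> \<eta> \<in> raw_chains G i" if "\<xi> \<in> raw_chains G i" "\<eta> \<in> raw_chains G i" for \<xi> \<eta>
    using that abelian_monoid.a_closed[OF abelian_group.axioms(1)[OF ag]]
    by (auto simp: chain_module_simps raw_chains_def)
  have smult: "a \<odot>\<^bsub>?M\<^esub> \<xi> \<in> raw_chains G i" if "a \<in> carrier R" "\<xi> \<in> raw_chains G i" for a \<xi>
    using that left_moduleD(3)[OF lift_stalk] by (auto simp: chain_module_simps raw_chains_def)
  have zero: "zero_coefficient G i \<in> raw_chains G i"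
    using abelian_monoid.zero_closed[OF abelian_group.axioms(1)[OF ag]]
    by (auto simp: raw_chains_def zero_coefficient_def)
  have "abelian_group ?M"
  proof (rule abelian_groupI)
    show "\<And>x y. x \<in> carrier ?M \<Longrightarrow> y \<in> carrier ?M \<Longrightarrow> x \<oplus>\<^bsub>?M\<^esub> y \<in> carrier ?M"
      using add by (simp add: chain_module_simps(1))
    show "\<zero>\<^bsub>?M\<^esub> \<in> carrier ?M" using zero by (simp add: chain_module_simps(1,2))
    fix x y z assume xyz: "x \<in> carrier ?M" "y \<in> carrier ?M" "z \<in> carrier ?M"
    note xyz = xyz[unfolded chain_module_simps]
    show "x \<oplus>\<^bsub>?M\<^esub> y \<oplus>\<^bsub>?M\<^esub> z = x \<oplus>\<^bsub>?M\<^esub> (y \<oplus>\<^bsub>?M\<^esub> z)"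
    proof (rule raw_chains_eqI)
      fix \<sigma> t assume t: "t \<in> lift_domain G i \<sigma>"
      interpret S: abelian_group "stalk G (\<sigma> t)" by (rule ag[OF t])
      show "(x \<oplus>\<^bsub>?M\<^esub> y \<oplus>\<^bsub>?M\<^esub> z) \<sigma> t = (x \<oplus>\<^bsub>?M\<^esub> (y \<oplus>\<^bsub>?M\<^esub> z)) \<sigma> t"
        using xyz t v by (simp add: chain_module_simps S.a_assoc)
    qed (intro add xyz)+
  next
    fix x y assume xy: "x \<in> carrier ?M" "y \<in> carrier ?M"
    note xy = xy[unfolded chain_module_simps]
    show "x \<oplus>\<^bsub>?M\<^esub> y = y \<oplus>\<^bsub>?M\<^esub> x"
    proof (rule raw_chains_eqI)
      fix \<sigma> t assume t: "t \<in> lift_domain G i \<sigma>"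
      interpret S: abelian_group "stalk G (\<sigma> t)" by (rule ag[OF t])
      show "(x \<oplus>\<^bsub>?M\<^esub> y) \<sigma> t = (y \<oplus>\<^bsub>?M\<^esub> x) \<sigma> t"
        using xy t v by (simp add: chain_module_simps S.a_comm)
    qed (intro add xy)+
  next
    fix x assume "x \<in> carrier ?M"
    then have x: "x \<in> raw_chains G i" by (simp add: chain_module_simps)
    show "\<zero>\<^bsub>?M\<^esub> \<oplus>\<^bsub>?M\<^esub> x = x"
    proof (rule raw_chains_eqI[OF _ x])
      show "\<zero>\<^bsub>?M\<^esub> \<oplus>\<^bsub>?M\<^esub> x \<in> raw_chains G i"
        using add[OF zero x] by (simp add: chain_module_simps(2))
      fix \<sigma> t assume t: "t \<in> lift_domain G i \<sigma>"
      interpret S: abelian_group "stalk G (\<sigma> t)" by (rule ag[OF t])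
      show "(\<zero>\<^bsub>?M\<^esub> \<oplus>\<^bsub>?M\<^esub> x) \<sigma> t = x \<sigma> t"
        using x t v by (simp add: chain_module_simps zero_coefficient_def)
    qed
    show "\<exists>y\<in>carrier ?M. y \<oplus>\<^bsub>?M\<^esub> x = \<zero>\<^bsub>?M\<^esub>"
    proof (intro bexI raw_chains_eqI)
      let ?y = "(\<ominus>\<^bsub>R\<^esub> \<one>\<^bsub>R\<^esub>) \<odot>\<^bsub>?M\<^esub> x"
      show y: "?y \<in> carrier ?M" using smult x by (simp add: chain_module_simps(1))
      then show "?y \<oplus>\<^bsub>?M\<^esub> x \<in> raw_chains G i" using add x by (simp add: chain_module_simps(1))
      show "\<zero>\<^bsub>?M\<^esub> \<in> raw_chains G i" using zero by (simp add: chain_module_simps(2))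
      fix \<sigma> t assume t: "t \<in> lift_domain G i \<sigma>"
      interpret S: abelian_group "stalk G (\<sigma> t)" by (rule ag[OF t])
      show "(?y \<oplus>\<^bsub>?M\<^esub> x) \<sigma> t = \<zero>\<^bsub>?M\<^esub> \<sigma> t"
        using x t v left_module_smult_minus_one(1)[OF lift_stalk[OF t]]
        by (simp add: chain_module_simps zero_coefficient_def S.l_neg)
    qed
  qed
  then show ?thesis
    unfolding left_module_def
  proof (intro conjI ballI)
    show "a \<odot>\<^bsub>?M\<^esub> \<xi> \<in> carrier ?M" if "a \<in> carrier R" "\<xi> \<in> carrier ?M" for a \<xi>
      using that smult by (simp add: chain_module_simps(1))
  next
    fix a b \<xi> assume h: "a \<in> carrier R" "b \<in> carrier R" "\<xi> \<in> carrier ?M"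
    then have \<xi>: "\<xi> \<in> raw_chains G i" by (simp add: chain_module_simps)
    note l = left_moduleD[OF lift_stalk]
    show "(a \<oplus>\<^bsub>R\<^esub> b) \<odot>\<^bsub>?M\<^esub> \<xi> = a \<odot>\<^bsub>?M\<^esub> \<xi> \<oplus>\<^bsub>?M\<^esub> b \<odot>\<^bsub>?M\<^esub> \<xi>"
      by (rule raw_chains_eqI[OF smult[OF _ \<xi>] add[OF smult[OF _ \<xi>] smult[OF _ \<xi>]]])
        (use h R.add.m_closed in \<open>simp_all add: chain_module_simps l(4) v[OF \<xi>]\<close>)
    show "(a \<otimes>\<^bsub>R\<^esub> b) \<odot>\<^bsub>?M\<^esub> \<xi> = a \<odot>\<^bsub>?M\<^esub> (b \<odot>\<^bsub>?M\<^esub> \<xi>)"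
      by (rule raw_chains_eqI[OF smult[OF _ \<xi>] smult[OF _ smult[OF _ \<xi>]]])
        (use h in \<open>simp_all add: chain_module_simps l(6) v[OF \<xi>]\<close>)
  next
    fix a \<xi> \<eta> assume h: "a \<in> carrier R" "\<xi> \<in> carrier ?M" "\<eta> \<in> carrier ?M"
    then have \<xi>: "\<xi> \<in> raw_chains G i" "\<eta> \<in> raw_chains G i" by (simp_all add: chain_module_simps)
    note l = left_moduleD[OF lift_stalk]
    show "a \<odot>\<^bsub>?M\<^esub> (\<xi> \<oplus>\<^bsub>?M\<^esub> \<eta>) = a \<odot>\<^bsub>?M\<^esub> \<xi> \<oplus>\<^bsub>?M\<^esub> a \<odot>\<^bsub>?M\<^esub> \<eta>"
      by (rule raw_chains_eqI[OF smult[OF _ add[OF \<xi>]] add[OF smult[OF _ \<xi>(1)] smult[OF _ \<xi>(2)]]])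
        (use h in \<open>simp_all add: chain_module_simps l(5) v[OF \<xi>(1)] v[OF \<xi>(2)]\<close>)
  next
    fix \<xi> assume h: "\<xi> \<in> carrier ?M"
    then have \<xi>: "\<xi> \<in> raw_chains G i" by (simp add: chain_module_simps)
    show "\<one>\<^bsub>R\<^esub> \<odot>\<^bsub>?M\<^esub> \<xi> = \<xi>"
      by (rule raw_chains_eqI[OF smult[OF R.one_closed \<xi>] \<xi>])
        (simp add: chain_module_simps left_moduleD(7)[OF lift_stalk] v[OF \<xi>])
  qed (rule R, assumption)
qed

lemma coefficients_iff:
  assumes "s \<in> extensional (lift_domain G i \<sigma>)"
  shows "s \<in> coefficients G i \<sigma> \<longleftrightarrow>
    continuous_map (subtopology (powertop_real UNIV) (lift_domain G i \<sigma>)) (total G) s \<and>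
    (\<forall>t\<in>lift_domain G i \<sigma>. s t \<in> carrier (stalk G (\<sigma> t)))"
proof -
  let ?T = "subtopology (powertop_real UNIV) (lift_domain G i \<sigma>)"
  have eq: "s t \<in> carrier (stalk G (\<sigma> t)) \<longleftrightarrow> s t \<in> topspace (total G) \<and> proj G (s t) = \<sigma> t"
    if "t \<in> lift_domain G i \<sigma>" for t
    using stalk_carrier lift_domain_subset[OF that] by simp
  have "s t \<in> topspace (total G)" if "continuous_map ?T (total G) s" "t \<in> lift_domain G i \<sigma>" for t
    using continuous_map_image_subset_topspace[OF that(1)] that(2) by (simp add: image_subset_iff)
  then show ?thesis
    using assms by (auto simp: coefficients_def eq)
qed

lemma coefficients_stalk: "s \<in> coefficients G i \<sigma> \<Longrightarrow> t \<in> lift_domain G i \<sigma> \<Longrightarrow> s t \<in> carrier (stalk G (\<sigma> t))"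
  using coefficients_iff[of s i \<sigma>] by (auto simp: coefficients_def)

lemma coefficients_add:
  assumes s: "s \<in> coefficients G i \<sigma>" and u: "u \<in> coefficients G i \<sigma>"
  shows "(\<lambda>t\<in>lift_domain G i \<sigma>. s t \<oplus>\<^bsub>stalk G (\<sigma> t)\<^esub> u t) \<in> coefficients G i \<sigma>"
proof -
  let ?T = "subtopology (powertop_real UNIV) (lift_domain G i \<sigma>)"
  have "continuous_map ?T (prod_topology (total G) (total G)) (\<lambda>t. (s t, u t))"
    using s u by (simp add: coefficients_def continuous_map_pairedI)
  then have "continuous_map ?T (subtopology (prod_topology (total G) (total G)) {(g, h). proj G g = proj G h})
      (\<lambda>t. (s t, u t))"
    using s u by (auto simp: continuous_map_in_subtopology coefficients_def)
  moreover have "continuous_map (subtopology (prod_topology (total G) (total G)) {(g, h). proj G g = proj G h})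
      (total G) (\<lambda>(g, h). g \<oplus>\<^bsub>stalk G (proj G g)\<^esub> h)"
    using sheaf by (simp add: sheaf_of_modules_def)
  ultimately have "continuous_map ?T (total G) ((\<lambda>(g, h). g \<oplus>\<^bsub>stalk G (proj G g)\<^esub> h) \<circ> (\<lambda>t. (s t, u t)))"
    by (rule continuous_map_compose)
  then have "continuous_map ?T (total G) (\<lambda>t\<in>lift_domain G i \<sigma>. s t \<oplus>\<^bsub>stalk G (\<sigma> t)\<^esub> u t)"
    by (rule continuous_map_eq) (use s in \<open>auto simp: coefficients_def\<close>)
  then show ?thesis
    using s u abelian_monoid.a_closed[OF abelian_group.axioms(1)[OF left_moduleD(2)[OF lift_stalk]]]
    by (subst coefficients_iff) (auto simp: coefficients_stalk)
qed

lemma coefficients_smult: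
  assumes s: "s \<in> coefficients G i \<sigma>" and a: "a \<in> carrier R"
  shows "(\<lambda>t\<in>lift_domain G i \<sigma>. a \<odot>\<^bsub>stalk G (\<sigma> t)\<^esub> s t) \<in> coefficients G i \<sigma>"
proof -
  let ?T = "subtopology (powertop_real UNIV) (lift_domain G i \<sigma>)"
  have "continuous_map (total G) (total G) (\<lambda>g. a \<odot>\<^bsub>stalk G (proj G g)\<^esub> g)"
    using sheaf a by (simp add: sheaf_of_modules_def)
  then have "continuous_map ?T (total G) ((\<lambda>g. a \<odot>\<^bsub>stalk G (proj G g)\<^esub> g) \<circ> s)"
    using s by (auto simp: coefficients_def intro: continuous_map_compose)
  then have "continuous_map ?T (total G) (\<lambda>t\<in>lift_domain G i \<sigma>. a \<odot>\<^bsub>stalk G (\<sigma> t)\<^esub> s t)"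
    by (rule continuous_map_eq) (use s in \<open>auto simp: coefficients_def\<close>)
  then show ?thesis
    using s a left_moduleD(3)[OF lift_stalk]
    by (subst coefficients_iff) (auto simp: coefficients_stalk)
qed

text \<open>Continuity of the zero section over the simplex follows from that of any other section, as it is a multiple.\<close>

lemma coefficients_zero:
  assumes s: "s \<in> coefficients G i \<sigma>"
  shows "zero_coefficient G i \<sigma> \<in> coefficients G i \<sigma>"
proof -
  interpret ring R by (rule R)
  have "(\<lambda>t\<in>lift_domain G i \<sigma>. \<zero>\<^bsub>R\<^esub> \<odot>\<^bsub>stalk G (\<sigma> t)\<^esub> s t) = zero_coefficient G i \<sigma>"
    unfolding zero_coefficient_def
    by (intro restrict_ext left_module_smult_minus_one(2)[OF lift_stalk coefficients_stalk[OF s]])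
  then show ?thesis using coefficients_smult[OF s zero_closed] by simp
qed

lemma coefficients_compose:
  assumes s: "s \<in> coefficients G i \<sigma>" and a: "singular_simplex j (simplex_space i) a"
  shows "(\<lambda>t\<in>lift_domain G j (simplex_map j \<sigma> a). s (a t)) \<in> coefficients G j (simplex_map j \<sigma> a)"
proof -
  let ?T = "subtopology (powertop_real UNIV) (lift_domain G j (simplex_map j \<sigma> a))"
  have aj: "a ` standard_simplex j \<subseteq> standard_simplex i"
    using a by (simp add: singular_simplex_subtopology)
  note ld = lift_domain_simplex_map[OF aj, of _ G \<sigma>]
  have "continuous_map (simplex_space j) (powertop_real UNIV) a"
    using a by (simp add: singular_simplex_def continuous_map_in_subtopology)
  then have "continuous_map ?T (powertop_real UNIV) a"
    by (rule continuous_map_from_subtopology_mono) (auto simp: lift_domain_def)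
  then have "continuous_map ?T (subtopology (powertop_real UNIV) (lift_domain G i \<sigma>)) a"
    using ld by (auto simp: continuous_map_in_subtopology)
  then have "continuous_map ?T (total G) (s \<circ> a)"
    by (rule continuous_map_compose) (use s in \<open>simp add: coefficients_def\<close>)
  then have "continuous_map ?T (total G) (\<lambda>t\<in>lift_domain G j (simplex_map j \<sigma> a). s (a t))"
    by (rule continuous_map_eq) auto
  moreover have "simplex_map j \<sigma> a t = \<sigma> (a t)" if "t \<in> lift_domain G j (simplex_map j \<sigma> a)" for t
    using that by (simp add: lift_domain_def simplex_map_def)
  ultimately show ?thesis
    using coefficients_stalk[OF s ld] by (subst coefficients_iff) auto
qed

lemma zero_coefficient_stalk: "t \<in> lift_domain G i \<sigma> \<Longrightarrow> zero_coefficient G i \<sigma> t = \<zero>\<^bsub>stalk G (\<sigma> t)\<^esub>"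
  by (simp add: zero_coefficient_def)

lemma lf_chains_raw: "lf_chains G X i \<subseteq> raw_chains G i"
proof
  fix \<xi> assume \<xi>: "\<xi> \<in> lf_chains G X i"
  show "\<xi> \<in> raw_chains G i"
    unfolding raw_chains_def
  proof (intro CollectI allI)
    fix \<sigma>
    show "\<xi> \<sigma> \<in> extensional (lift_domain G i \<sigma>) \<and> (\<forall>t\<in>lift_domain G i \<sigma>. \<xi> \<sigma> t \<in> carrier (stalk G (\<sigma> t)))"
    proof (cases "\<sigma> \<in> chain_simplices G i \<xi>")
      case True
      then have "\<xi> \<sigma> \<in> coefficients G i \<sigma>" using \<xi> by (simp add: lf_chains_def)
      then show ?thesis using coefficients_stalk by (auto simp: coefficients_def)
    next
      case False
      then show ?thesis
        using abelian_monoid.zero_closed[OF abelian_group.axioms(1)[OF left_moduleD(2)[OF lift_stalk]]]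
        by (auto simp: chain_simplices_def zero_coefficient_def)
    qed
  qed
qed

lemma chain_simplices_add:
  "chain_simplices G i (\<xi> \<oplus>\<^bsub>chain_module G i C\<^esub> \<eta>) \<subseteq> chain_simplices G i \<xi> \<union> chain_simplices G i \<eta>"
proof
  fix \<sigma> assume *: "\<sigma> \<in> chain_simplices G i (\<xi> \<oplus>\<^bsub>chain_module G i C\<^esub> \<eta>)"
  have "(\<lambda>t\<in>lift_domain G i \<sigma>. zero_coefficient G i \<sigma> t \<oplus>\<^bsub>stalk G (\<sigma> t)\<^esub> zero_coefficient G i \<sigma> t)
      = zero_coefficient G i \<sigma>"
    using abelian_monoid.l_zero[OF abelian_group.axioms(1)[OF left_moduleD(2)[OF lift_stalk]]]
      abelian_monoid.zero_closed[OF abelian_group.axioms(1)[OF left_moduleD(2)[OF lift_stalk]]]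
    by (auto simp: zero_coefficient_def)
  then show "\<sigma> \<in> chain_simplices G i \<xi> \<union> chain_simplices G i \<eta>"
    using * by (auto simp: chain_simplices_def chain_module_simps)
qed

lemma chain_simplices_smult:
  assumes "a \<in> carrier R"
  shows "chain_simplices G i (a \<odot>\<^bsub>chain_module G i C\<^esub> \<xi>) \<subseteq> chain_simplices G i \<xi>"
proof
  fix \<sigma> assume *: "\<sigma> \<in> chain_simplices G i (a \<odot>\<^bsub>chain_module G i C\<^esub> \<xi>)"
  have smult_zero: "a \<odot>\<^bsub>M\<^esub> \<zero>\<^bsub>M\<^esub> = \<zero>\<^bsub>M\<^esub>" if M: "left_module R M" for M :: "('r, 'g) module"
  proof -
    interpret M: abelian_group M using left_moduleD[OF M] by blast
    have "a \<odot>\<^bsub>M\<^esub> \<zero>\<^bsub>M\<^esub> \<oplus>\<^bsub>M\<^esub> a \<odot>\<^bsub>M\<^esub> \<zero>\<^bsub>M\<^esub> = a \<odot>\<^bsub>M\<^esub> \<zero>\<^bsub>M\<^esub>"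
      using left_moduleD(5)[OF M assms M.zero_closed M.zero_closed] by simp
    then show ?thesis
      using left_moduleD(3)[OF M assms M.zero_closed] M.add.l_cancel_one by simp
  qed
  have "(\<lambda>t\<in>lift_domain G i \<sigma>. a \<odot>\<^bsub>stalk G (\<sigma> t)\<^esub> zero_coefficient G i \<sigma> t) = zero_coefficient G i \<sigma>"
    using smult_zero[OF lift_stalk] by (auto simp: zero_coefficient_def)
  then show "\<sigma> \<in> chain_simplices G i \<xi>"
    using * by (auto simp: chain_simplices_def chain_module_simps)
qed

lemma chain_simplices_zero [simp]: "chain_simplices G i (zero_coefficient G i) = {}"
  by (simp add: chain_simplices_def)

lemma submodule_lf_chains: "submodule_of R (raw_module G i) (lf_chains G X i)"
  unfolding submodule_of_def
proof (intro conjI ballI)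
  show "lf_chains G X i \<subseteq> carrier (raw_module G i)" using lf_chains_raw by (simp add: chain_module_simps)
  show "\<zero>\<^bsub>raw_module G i\<^esub> \<in> lf_chains G X i"
    by (auto simp: lf_chains_def chain_module_simps)
next
  fix \<xi> \<eta> assume x: "\<xi> \<in> lf_chains G X i" "\<eta> \<in> lf_chains G X i"
  let ?z = "\<xi> \<oplus>\<^bsub>raw_module G i\<^esub> \<eta>"
  note sub = chain_simplices_add[of i "raw_chains G i" \<xi> \<eta>]
  have "?z \<sigma> \<in> coefficients G i \<sigma>" if \<sigma>: "\<sigma> \<in> chain_simplices G i ?z" for \<sigma>
  proof -
    obtain s where s: "s \<in> coefficients G i \<sigma>" using subsetD[OF sub \<sigma>] x by (auto simp: lf_chains_def)
    have "\<zeta> \<sigma> \<in> coefficients G i \<sigma>" if "\<zeta> \<in> lf_chains G X i" for \<zeta>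
      using that coefficients_zero[OF s] by (cases "\<sigma> \<in> chain_simplices G i \<zeta>") (auto simp: lf_chains_def chain_simplices_def)
    then show ?thesis using x coefficients_add by (simp add: chain_module_simps)
  qed
  moreover have "singular_simplex i X \<sigma>" if "\<sigma> \<in> chain_simplices G i ?z" for \<sigma>
    using that sub x by (auto simp: lf_chains_def)
  moreover have "\<exists>U. openin X U \<and> p \<in> U \<and> finite {\<sigma> \<in> chain_simplices G i ?z. \<sigma> ` standard_simplex i \<inter> U \<noteq> {}}"
    if p: "p \<in> topspace X" for p
  proof -
    obtain U where U: "openin X U" "p \<in> U" "finite {\<sigma> \<in> chain_simplices G i \<xi>. \<sigma> ` standard_simplex i \<inter> U \<noteq> {}}"
      using x(1) p unfolding lf_chains_def by blast
    obtain V where V: "openin X V" "p \<in> V" "finite {\<sigma> \<in> chain_simplices G i \<eta>. \<sigma> ` standard_simplex i \<inter> V \<noteq> {}}"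
      using x(2) p unfolding lf_chains_def by blast
    have "finite {\<sigma> \<in> chain_simplices G i ?z. \<sigma> ` standard_simplex i \<inter> (U \<inter> V) \<noteq> {}}"
      by (rule finite_subset[OF _ finite_UnI[OF U(3) V(3)]]) (use sub in auto)
    then show ?thesis using U V by (intro exI[of _ "U \<inter> V"]) (auto simp: openin_Int)
  qed
  ultimately show "?z \<in> lf_chains G X i" by (simp add: lf_chains_def)
next
  fix a \<xi> assume a: "a \<in> carrier R" and x: "\<xi> \<in> lf_chains G X i"
  let ?z = "a \<odot>\<^bsub>raw_module G i\<^esub> \<xi>"
  note sub = chain_simplices_smult[OF a, of i "raw_chains G i" \<xi>]
  have "?z \<sigma> \<in> coefficients G i \<sigma>" if \<sigma>: "\<sigma> \<in> chain_simplices G i ?z" for \<sigma>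
    using coefficients_smult[OF _ a, of "\<xi> \<sigma>" i \<sigma>] \<sigma> sub x by (auto simp: lf_chains_def chain_module_simps)
  moreover have "\<exists>U. openin X U \<and> p \<in> U \<and> finite {\<sigma> \<in> chain_simplices G i ?z. \<sigma> ` standard_simplex i \<inter> U \<noteq> {}}"
    if p: "p \<in> topspace X" for p
  proof -
    obtain U where U: "openin X U" "p \<in> U" "finite {\<sigma> \<in> chain_simplices G i \<xi>. \<sigma> ` standard_simplex i \<inter> U \<noteq> {}}"
      using x p unfolding lf_chains_def by blast
    have "finite {\<sigma> \<in> chain_simplices G i ?z. \<sigma> ` standard_simplex i \<inter> U \<noteq> {}}"
      by (rule finite_subset[OF _ U(3)]) (use sub in auto)
    then show ?thesis using U by blast
  qed
  ultimately show "?z \<in> lf_chains G X i" using sub x by (auto simp: lf_chains_def)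
qed

end

section \<open>Substituting chains for simplices\<close>

definition family_compose ::
  "nat \<Rightarrow> nat \<Rightarrow> ('a sing \<Rightarrow> (nat \<Rightarrow> real) chain) \<Rightarrow> ('a sing \<Rightarrow> (nat \<Rightarrow> real) chain)
     \<Rightarrow> 'a sing \<Rightarrow> (nat \<Rightarrow> real) chain" where
  "family_compose j k c c' \<sigma> = frag_extend (\<lambda>a. chain_map k a (c' (simplex_map j \<sigma> a))) (c \<sigma>)"

lemma keys_family_compose:
  assumes "e \<in> keys (family_compose j k c c' \<sigma>)"
  obtains a b where "e = simplex_map k a b" "a \<in> keys (c \<sigma>)"
    "b \<in> keys (c' (simplex_map j \<sigma> a))"
proof -
  obtain a where a: "a \<in> keys (c \<sigma>)" "e \<in> keys (chain_map k a (c' (simplex_map j \<sigma> a)))"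
    using assms keys_frag_extend[of "\<lambda>a. chain_map k a (c' (simplex_map j \<sigma> a))" "c \<sigma>"]
    unfolding family_compose_def by blast
  obtain b where "b \<in> keys (c' (simplex_map j \<sigma> a))" "e = simplex_map k a b"
    using subsetD[OF keys_frag_extend a(2)[unfolded chain_map_def]] by auto
  then show thesis using that a(1) by blast
qed

lemma family_family_compose:
  assumes c: "family i j c" and c': "family j k c'"
  shows "family i k (family_compose j k c c')"
  unfolding family_def singular_chain_def
proof (intro allI subsetI CollectI)
  fix \<sigma> e assume e: "e \<in> keys (family_compose j k c c' \<sigma>)"
  show "singular_simplex k (simplex_space i) e"
  proof (rule keys_family_compose[OF e])
    fix a b assume ab: "e = simplex_map k a b" "a \<in> keys (c \<sigma>)" "b \<in> keys (c' (simplex_map j \<sigma> a))"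
    have "continuous_map (simplex_space j) (simplex_space i) a"
      using familyD[OF c, OF ab(2)] by (simp add: singular_simplex_def)
    then show "singular_simplex k (simplex_space i) e"
      unfolding ab(1) by (rule singular_simplex_simplex_map[OF familyD[OF c', OF ab(3)]])
  qed
qed

lemma simplex_map_simplex_map:
  assumes "b ` standard_simplex k \<subseteq> standard_simplex j"
  shows "simplex_map k (simplex_map j \<sigma> a) b = simplex_map k \<sigma> (simplex_map k a b)"
  using assms by (intro ext) (simp add: simplex_map_def image_subset_iff)

lemma contribution_add: "contribution j \<xi> \<tau> t \<sigma> (c + d) = contribution j \<xi> \<tau> t \<sigma> c + contribution j \<xi> \<tau> t \<sigma> d"
  by (simp add: contribution_def frag_extend_add)

definition first_vertex :: "nat \<Rightarrow> real" where "first_vertex = (\<lambda>i. if i = 0 then 1 else 0)"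

lemma first_vertex_in [simp]: "first_vertex \<in> standard_simplex i"
  unfolding first_vertex_def using basis_in_standard_simplex[of 0 i] by simp

context coefficient_sheaf
begin

lemma lf_chains_simplex:
  "\<xi> \<in> lf_chains G X i \<Longrightarrow> \<sigma> \<in> chain_simplices G i \<xi> \<Longrightarrow> singular_simplex i X \<sigma>"
  by (simp add: lf_chains_def)

lemma singular_simplex_in: "singular_simplex i X \<sigma> \<Longrightarrow> t \<in> standard_simplex i \<Longrightarrow> \<sigma> t \<in> topspace X"
  unfolding singular_simplex_def using continuous_map_image_subset_topspace by fastforce

lemma finite_simplices_through:
  assumes \<xi>: "\<xi> \<in> lf_chains G X i"
  shows "finite {\<sigma> \<in> chain_simplices G i \<xi>. x \<in> \<sigma> ` standard_simplex i}"
proof (cases "x \<in> topspace X")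
  case False
  then have "{\<sigma> \<in> chain_simplices G i \<xi>. x \<in> \<sigma> ` standard_simplex i} = {}"
    using lf_chains_simplex[OF \<xi>] singular_simplex_in by blast
  then show ?thesis by (simp only: finite.emptyI)
next
  case True
  obtain U where U: "x \<in> U" "finite {\<sigma> \<in> chain_simplices G i \<xi>. \<sigma> ` standard_simplex i \<inter> U \<noteq> {}}"
    using \<xi> True unfolding lf_chains_def by blast
  show ?thesis by (rule finite_subset[OF _ U(2)]) (use U(1) in auto)
qed

text \<open>A piece of \<open>\<sigma>\<close> that is equal to \<open>\<tau>\<close> shows that \<open>\<sigma>\<close> passes through the image of a vertex of \<open>\<tau>\<close>.  In a locally
  finite chain there are finitely many such \<open>\<sigma>\<close>.\<close>

lemma sources_through:
  assumes c: "family i j c"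
  shows "sources G i j c \<xi> \<tau> \<subseteq> {\<sigma> \<in> chain_simplices G i \<xi>. \<tau> first_vertex \<in> \<sigma> ` standard_simplex i}"
proof
  fix \<sigma> assume \<sigma>: "\<sigma> \<in> sources G i j c \<xi> \<tau>"
  then obtain a where a: "a \<in> keys (c \<sigma>)" "\<tau> = simplex_map j \<sigma> a" by (auto simp: sources_def)
  then show "\<sigma> \<in> {\<sigma> \<in> chain_simplices G i \<xi>. \<tau> first_vertex \<in> \<sigma> ` standard_simplex i}"
    using familyD_in[OF c, OF a(1) first_vertex_in] \<sigma> by (simp add: simplex_map_def sources_def)
qed

lemma finite_sources:
  assumes \<xi>: "\<xi> \<in> lf_chains G X i" and c: "family i j c"
  shows "finite (sources G i j c \<xi> \<tau>)"
proof (rule finite_subset[OF _ finite_simplices_through[OF \<xi>, of "\<tau> first_vertex"]])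
  show "sources G i j c \<xi> \<tau> \<subseteq> {\<sigma> \<in> chain_simplices G i \<xi>. \<tau> first_vertex \<in> \<sigma> ` standard_simplex i}"
    by (rule sources_through[OF c])
qed

text \<open>The index set \<open>sources\<close> depends on the chain and on the family.  To compare different chains or
  families, their sums are extended to a common finite set.\<close>

lemma substitute_eq:
  assumes \<xi>: "\<xi> \<in> raw_chains G i" and c: "family i j c" and t: "t \<in> lift_domain G j \<tau>"
    and S: "finite S" "sources G i j c \<xi> \<tau> \<subseteq> S"
  shows "substitute G i j c \<xi> \<tau> t = combination (stalk G (\<tau> t)) (\<Sum>\<sigma>\<in>S. contribution j \<xi> \<tau> t \<sigma> (c \<sigma>))"
proof -
  note M = lift_stalk[OF t]
  have "combination (stalk G (\<tau> t)) (contribution j \<xi> \<tau> t \<sigma> (c \<sigma>)) = \<zero>\<^bsub>stalk G (\<tau> t)\<^esub>"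
    if \<sigma>: "\<sigma> \<notin> sources G i j c \<xi> \<tau>" for \<sigma>
  proof -
    have "combination (stalk G (\<tau> t)) (frag_extend (\<lambda>a. if simplex_map j \<sigma> a = \<tau> then frag_of (\<xi> \<sigma> (a t)) else 0) (c \<sigma>))
        = combination (stalk G (\<tau> t)) (frag_extend (\<lambda>a. 0 :: 'g \<Rightarrow>\<^sub>0 int) (c \<sigma>))"
    proof (rule combination_frag_extend_cong[OF M M])
      fix a assume a: "a \<in> keys (c \<sigma>)"
      show "combination (stalk G (\<tau> t)) (if simplex_map j \<sigma> a = \<tau> then frag_of (\<xi> \<sigma> (a t)) else 0)
          = combination (stalk G (\<tau> t)) 0"
      proof (cases "simplex_map j \<sigma> a = \<tau>")
        case True
        have "a t \<in> lift_domain G i \<sigma>"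
          using lift_domain_simplex_map[of a j i t G \<sigma>] familyD_in[OF c, OF a] t True by blast
        moreover have "\<xi> \<sigma> = zero_coefficient G i \<sigma>"
          using \<sigma> a True by (auto simp: sources_def chain_simplices_def)
        moreover have "\<tau> t = \<sigma> (a t)" using True t by (auto simp: simplex_map_def lift_domain_def)
        ultimately show ?thesis
          using combination_of[OF M] combination_0[OF M] True combination_closed[OF M, of 0]
          by (simp add: zero_coefficient_stalk)
      qed simp
    qed
    then show ?thesis by (simp add: contribution_def frag_extend_eq_0 combination_0[OF M])
  qed
  then have "combination (stalk G (\<tau> t)) (\<Sum>\<sigma>\<in>S. contribution j \<xi> \<tau> t \<sigma> (c \<sigma>)) =
      combination (stalk G (\<tau> t)) (\<Sum>\<sigma>\<in>S. if \<sigma> \<in> sources G i j c \<xi> \<tau> then contribution j \<xi> \<tau> t \<sigma> (c \<sigma>) else 0)"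
    by (intro combination_sum_cong[OF M M]) (simp add: combination_0[OF M])
  also have "(\<Sum>\<sigma>\<in>S. if \<sigma> \<in> sources G i j c \<xi> \<tau> then contribution j \<xi> \<tau> t \<sigma> (c \<sigma>) else 0)
      = (\<Sum>\<sigma>\<in>sources G i j c \<xi> \<tau>. contribution j \<xi> \<tau> t \<sigma> (c \<sigma>))"
    using S by (simp add: sum.inter_restrict[symmetric] Int_absorb1)
  finally show ?thesis using t by (simp add: substitute_def)
qed

lemma chain_simplices_substitute:
  assumes \<tau>: "\<tau> \<in> chain_simplices G j (substitute G i j c \<xi>)"
  obtains \<sigma> a where "\<sigma> \<in> chain_simplices G i \<xi>" "a \<in> keys (c \<sigma>)" "\<tau> = simplex_map j \<sigma> a"
proof -
  have "sources G i j c \<xi> \<tau> \<noteq> {}"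
  proof
    assume "sources G i j c \<xi> \<tau> = {}"
    then have "substitute G i j c \<xi> \<tau> = zero_coefficient G j \<tau>"
      unfolding substitute_def zero_coefficient_def
      by (intro restrict_ext) (simp add: combination_0[OF lift_stalk])
    then show False using \<tau> by (simp add: chain_simplices_def)
  qed
  then show thesis using that by (auto simp: sources_def)
qed

text \<open>Lifts of \<open>\<tau>\<close> to the sheaf are closed under differences, and restrictions of lifts to pieces are lifts.\<close>

lemma substitute_coefficients:
  assumes \<xi>: "\<xi> \<in> lf_chains G X i" and c: "family i j c"
    and \<tau>: "\<tau> \<in> chain_simplices G j (substitute G i j c \<xi>)"
  shows "substitute G i j c \<xi> \<tau> \<in> coefficients G j \<tau>"
proof -
  define P where "P f \<longleftrightarrow> (\<lambda>t\<in>lift_domain G j \<tau>. combination (stalk G (\<tau> t)) (f t)) \<in> coefficients G j \<tau>" for f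
  interpret R: ring R by (rule R)
  have comb: "P (\<lambda>t. frag_of (\<xi> \<sigma> (a t)))"
    if \<sigma>: "\<sigma> \<in> chain_simplices G i \<xi>" and a: "singular_simplex j (simplex_space i) a" and eq: "simplex_map j \<sigma> a = \<tau>" for \<sigma> a
  proof -
    have s: "\<xi> \<sigma> \<in> coefficients G i \<sigma>" using \<xi> \<sigma> by (simp add: lf_chains_def)
    have ai: "a ` standard_simplex j \<subseteq> standard_simplex i" using a by (simp add: singular_simplex_subtopology)
    have "(\<lambda>t\<in>lift_domain G j \<tau>. \<xi> \<sigma> (a t)) = (\<lambda>t\<in>lift_domain G j \<tau>. combination (stalk G (\<tau> t)) (frag_of (\<xi> \<sigma> (a t))))"
    proof (rule restrict_ext)
      fix t assume t: "t \<in> lift_domain G j \<tau>"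
      have "a t \<in> lift_domain G i \<sigma>" using lift_domain_simplex_map[OF ai] t eq by blast
      moreover have "\<tau> t = \<sigma> (a t)" using eq t by (auto simp: simplex_map_def lift_domain_def)
      ultimately have "\<xi> \<sigma> (a t) \<in> carrier (stalk G (\<tau> t))" using coefficients_stalk[OF s] by simp
      then show "\<xi> \<sigma> (a t) = combination (stalk G (\<tau> t)) (frag_of (\<xi> \<sigma> (a t)))"
        by (simp add: combination_of[OF lift_stalk[OF t]])
    qed
    then show ?thesis unfolding P_def using coefficients_compose[OF s a] eq by simp
  qed
  obtain \<sigma>0 a0 where "\<sigma>0 \<in> chain_simplices G i \<xi>" "a0 \<in> keys (c \<sigma>0)" "simplex_map j \<sigma>0 a0 = \<tau>"
    using chain_simplices_substitute[OF \<tau>] by metis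
  \<comment> \<open>Some lift of \<open>\<tau>\<close> is needed to see that the zero section over \<open>\<tau>\<close> is a lift.\<close>
  then have ex: "\<exists>s. s \<in> coefficients G j \<tau>" using comb familyD[OF c] unfolding P_def by blast
  have zero: "P (\<lambda>t. 0)"
  proof -
    have "(\<lambda>t\<in>lift_domain G j \<tau>. combination (stalk G (\<tau> t)) 0) = zero_coefficient G j \<tau>"
      unfolding zero_coefficient_def by (intro restrict_ext) (simp add: combination_0[OF lift_stalk])
    then show ?thesis using ex coefficients_zero unfolding P_def by auto
  qed
  have diff: "P (\<lambda>t. f t - g t)" if f: "P f" and g: "P g" for f g
  proof -
    have "(\<lambda>t\<in>lift_domain G j \<tau>. (\<ominus>\<^bsub>R\<^esub> \<one>\<^bsub>R\<^esub>) \<odot>\<^bsub>stalk G (\<tau> t)\<^esub> (\<lambda>t\<in>lift_domain G j \<tau>. combination (stalk G (\<tau> t)) (g t)) t)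
        \<in> coefficients G j \<tau>"
      using coefficients_smult[OF g[unfolded P_def], of "\<ominus>\<^bsub>R\<^esub> \<one>\<^bsub>R\<^esub>"] by simp
    from coefficients_add[OF f[unfolded P_def] this]
    have "(\<lambda>t\<in>lift_domain G j \<tau>. (\<lambda>t\<in>lift_domain G j \<tau>. combination (stalk G (\<tau> t)) (f t)) t \<oplus>\<^bsub>stalk G (\<tau> t)\<^esub>
        (\<lambda>t\<in>lift_domain G j \<tau>. (\<ominus>\<^bsub>R\<^esub> \<one>\<^bsub>R\<^esub>) \<odot>\<^bsub>stalk G (\<tau> t)\<^esub> (\<lambda>t\<in>lift_domain G j \<tau>. combination (stalk G (\<tau> t)) (g t)) t) t)
        \<in> coefficients G j \<tau>" .
    also have "(\<lambda>t\<in>lift_domain G j \<tau>. (\<lambda>t\<in>lift_domain G j \<tau>. combination (stalk G (\<tau> t)) (f t)) t \<oplus>\<^bsub>stalk G (\<tau> t)\<^esub>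
        (\<lambda>t\<in>lift_domain G j \<tau>. (\<ominus>\<^bsub>R\<^esub> \<one>\<^bsub>R\<^esub>) \<odot>\<^bsub>stalk G (\<tau> t)\<^esub> (\<lambda>t\<in>lift_domain G j \<tau>. combination (stalk G (\<tau> t)) (g t)) t) t)
        = (\<lambda>t\<in>lift_domain G j \<tau>. combination (stalk G (\<tau> t)) (f t - g t))"
      by (intro restrict_ext)
         (simp add: combination_diff[OF lift_stalk] left_module_smult_minus_one(1)[OF lift_stalk] combination_closed[OF lift_stalk] a_minus_def)
    finally show ?thesis unfolding P_def .
  qed
  have add: "P (\<lambda>t. f t + g t)" if f: "P f" and g: "P g" for f g
    using diff[OF f diff[OF zero g]] by simp
  have contr: "P (\<lambda>t. contribution j \<xi> \<tau> t \<sigma> d)"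
    if \<sigma>: "\<sigma> \<in> chain_simplices G i \<xi>" and d: "keys d \<subseteq> {a. singular_simplex j (simplex_space i) a}" for \<sigma> d
    unfolding contribution_def using d
  proof (induction d rule: frag_induction)
    case zero
    show ?case using \<open>P (\<lambda>t. 0)\<close> by simp
  next
    case (one a)
    then show ?case using comb[OF \<sigma>, of a] zero by (cases "simplex_map j \<sigma> a = \<tau>") simp_all
  next
    case (diff a b)
    then show ?case using \<open>\<And>f g. P f \<Longrightarrow> P g \<Longrightarrow> P (\<lambda>t. f t - g t)\<close> by (simp add: frag_extend_diff)
  qed
  have "P (\<lambda>t. \<Sum>\<sigma>\<in>S. contribution j \<xi> \<tau> t \<sigma> (c \<sigma>))" if "finite S" "S \<subseteq> chain_simplices G i \<xi>" for S
    using that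
  proof (induction S rule: finite_induct)
    case (insert \<sigma> S)
    have "P (\<lambda>t. contribution j \<xi> \<tau> t \<sigma> (c \<sigma>))"
      by (rule contr) (use insert c in \<open>auto simp: family_def singular_chain_def\<close>)
    then show ?case using insert by (simp add: add)
  qed (simp add: zero)
  from this[OF finite_sources[OF \<xi> c]]
  have "P (\<lambda>t. \<Sum>\<sigma>\<in>sources G i j c \<xi> \<tau>. contribution j \<xi> \<tau> t \<sigma> (c \<sigma>))" by (auto simp: sources_def)
  then show ?thesis unfolding P_def substitute_def .
qed

text \<open>A simplex of the new chain lies in a simplex of \<open>\<xi>\<close>, and each simplex of \<open>\<xi>\<close> has finitely many pieces.\<close>

lemma substitute_lf_chains:
  assumes \<xi>: "\<xi> \<in> lf_chains G X i" and c: "family i j c"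
  shows "substitute G i j c \<xi> \<in> lf_chains G X j"
proof -
  let ?z = "substitute G i j c \<xi>"
  have "singular_simplex j X \<tau>" if \<tau>: "\<tau> \<in> chain_simplices G j ?z" for \<tau>
  proof -
    obtain \<sigma> a where sa: "\<sigma> \<in> chain_simplices G i \<xi>" "a \<in> keys (c \<sigma>)" "\<tau> = simplex_map j \<sigma> a"
      using chain_simplices_substitute[OF \<tau>] by metis
    have "continuous_map (simplex_space i) X \<sigma>"
      using lf_chains_simplex[OF \<xi> sa(1)] by (simp add: singular_simplex_def)
    then show ?thesis
      unfolding sa(3) by (rule singular_simplex_simplex_map[OF familyD[OF c, OF sa(2)]])
  qed
  moreover have "\<exists>U. openin X U \<and> x \<in> U \<and> finite {\<tau> \<in> chain_simplices G j ?z. \<tau> ` standard_simplex j \<inter> U \<noteq> {}}"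
    if x: "x \<in> topspace X" for x
  proof -
    obtain U where U: "openin X U" "x \<in> U" "finite {\<sigma> \<in> chain_simplices G i \<xi>. \<sigma> ` standard_simplex i \<inter> U \<noteq> {}}"
      using \<xi> x unfolding lf_chains_def by blast
    have "{\<tau> \<in> chain_simplices G j ?z. \<tau> ` standard_simplex j \<inter> U \<noteq> {}} \<subseteq>
        (\<Union>\<sigma>\<in>{\<sigma> \<in> chain_simplices G i \<xi>. \<sigma> ` standard_simplex i \<inter> U \<noteq> {}}. simplex_map j \<sigma> ` keys (c \<sigma>))"
    proof
      fix \<tau> assume "\<tau> \<in> {\<tau> \<in> chain_simplices G j ?z. \<tau> ` standard_simplex j \<inter> U \<noteq> {}}"
      then obtain y where \<tau>: "\<tau> \<in> chain_simplices G j ?z" and y: "y \<in> standard_simplex j" "\<tau> y \<in> U" by auto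
      obtain \<sigma> a where sa: "\<sigma> \<in> chain_simplices G i \<xi>" "a \<in> keys (c \<sigma>)" "\<tau> = simplex_map j \<sigma> a"
        using chain_simplices_substitute[OF \<tau>] by metis
      then have "\<sigma> (a y) \<in> U" using y by (simp add: simplex_map_def)
      then have "\<sigma> ` standard_simplex i \<inter> U \<noteq> {}" using familyD_in[OF c, OF sa(2) y(1)] by blast
      then show "\<tau> \<in> (\<Union>\<sigma>\<in>{\<sigma> \<in> chain_simplices G i \<xi>. \<sigma> ` standard_simplex i \<inter> U \<noteq> {}}. simplex_map j \<sigma> ` keys (c \<sigma>))"
        using sa by blast
    qed
    then have "finite {\<tau> \<in> chain_simplices G j ?z. \<tau> ` standard_simplex j \<inter> U \<noteq> {}}"
      by (rule finite_subset) (use U(3) in auto)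
    then show ?thesis using U by blast
  qed
  ultimately show ?thesis using substitute_coefficients[OF \<xi> c] by (simp add: lf_chains_def)
qed

text \<open>Both sides are the sum over all pieces \<open>a\<close> of the simplices \<open>\<sigma>\<close> of \<open>\<xi>\<close> and all pieces \<open>b\<close> of the simplices
  \<open>\<sigma> \<circ> a\<close> for which \<open>\<sigma> \<circ> a \<circ> b = \<omega>\<close>.  On the left the sum is grouped by the intermediate simplices
  \<open>\<tau> = \<sigma> \<circ> a\<close>.  This law turns identities between chains in a standard simplex into
  identities between operations on locally finite chains.\<close>

lemma substitute_substitute:
  assumes \<xi>: "\<xi> \<in> lf_chains G X i" and c: "family i j c" and c': "family j k c'"
  shows "substitute G j k c' (substitute G i j c \<xi>) = substitute G i k (family_compose j k c c') \<xi>"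
proof (rule raw_chains_eqI)
  let ?\<eta> = "substitute G i j c \<xi>" and ?e = "family_compose j k c c'"
  note \<eta> = substitute_lf_chains[OF \<xi> c]
  have e: "family i k ?e" by (rule family_family_compose[OF c c'])
  have \<xi>r: "\<xi> \<in> raw_chains G i" and \<eta>r: "?\<eta> \<in> raw_chains G j" using \<xi> \<eta> lf_chains_raw by blast+
  show "substitute G j k c' ?\<eta> \<in> raw_chains G k" using substitute_lf_chains[OF \<eta> c'] lf_chains_raw by blast
  show "substitute G i k ?e \<xi> \<in> raw_chains G k" using substitute_lf_chains[OF \<xi> e] lf_chains_raw by blast
  fix \<omega> t assume t: "t \<in> lift_domain G k \<omega>"
  let ?M = "stalk G (\<omega> t)"
  note M = lift_stalk[OF t]
  define S where "S = {\<sigma> \<in> chain_simplices G i \<xi>. \<omega> first_vertex \<in> \<sigma> ` standard_simplex i}"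
  have S: "finite S" unfolding S_def by (rule finite_simplices_through[OF \<xi>])
  \<comment> \<open>All simplices of \<open>\<xi>\<close> and all intermediate simplices that can contribute to \<open>\<omega>\<close> are in \<open>S\<close> and \<open>T\<close>.\<close>
  define T where "T = (\<Union>\<sigma>\<in>S. simplex_map j \<sigma> ` keys (c \<sigma>))"
  have T: "finite T" unfolding T_def using S by simp
  have sub: "sources G i j c \<xi> \<tau> \<subseteq> S" if b: "b \<in> keys (c' \<tau>)" "simplex_map k \<tau> b = \<omega>" for \<tau> b
  proof
    fix \<sigma> assume \<sigma>: "\<sigma> \<in> sources G i j c \<xi> \<tau>"
    then obtain a where a: "a \<in> keys (c \<sigma>)" "\<tau> = simplex_map j \<sigma> a" by (auto simp: sources_def)
    have "b first_vertex \<in> standard_simplex j" by (rule familyD_in[OF c', OF b(1) first_vertex_in])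
    then have "a (b first_vertex) \<in> standard_simplex i" "\<omega> first_vertex = \<sigma> (a (b first_vertex))"
      using familyD_in[OF c, OF a(1)] a(2) b(2) by (auto simp: simplex_map_def)
    then show "\<sigma> \<in> S" using \<sigma> by (auto simp: S_def sources_def)
  qed
  have sT: "sources G j k c' ?\<eta> \<omega> \<subseteq> T"
  proof
    fix \<tau> assume \<tau>: "\<tau> \<in> sources G j k c' ?\<eta> \<omega>"
    then have \<tau>': "\<tau> \<in> chain_simplices G j ?\<eta>" by (simp add: sources_def)
    obtain b where b: "b \<in> keys (c' \<tau>)" "simplex_map k \<tau> b = \<omega>"
      using \<tau> by (auto simp: sources_def)
    obtain \<sigma> a where "\<sigma> \<in> chain_simplices G i \<xi>" "a \<in> keys (c \<sigma>)" "\<tau> = simplex_map j \<sigma> a"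
      using chain_simplices_substitute[OF \<tau>'] by metis
    note sab = this b
    then have "\<sigma> \<in> sources G i j c \<xi> \<tau>" by (auto simp: sources_def)
    then have "\<sigma> \<in> S" using sub[OF sab(4,5)] by blast
    then show "\<tau> \<in> T" using sab unfolding T_def by blast
  qed
  have se: "sources G i k ?e \<xi> \<omega> \<subseteq> S"
    unfolding S_def by (rule sources_through[OF e])
  let ?F = "\<lambda>\<tau> \<sigma> b a. if simplex_map k \<tau> b = \<omega> \<and> simplex_map j \<sigma> a = \<tau> then frag_of (\<xi> \<sigma> (a (b t))) else 0"
  have \<eta>b: "combination ?M (if simplex_map k \<tau> b = \<omega> then frag_of (?\<eta> \<tau> (b t)) else 0)
      = combination ?M (\<Sum>\<sigma>\<in>S. frag_extend (?F \<tau> \<sigma> b) (c \<sigma>))"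
    if b: "b \<in> keys (c' \<tau>)" for \<tau> b
  proof (cases "simplex_map k \<tau> b = \<omega>")
    case True
    have bt: "b t \<in> lift_domain G j \<tau>"
      using lift_domain_simplex_map[of b k j t G \<tau>] familyD_in[OF c', OF b] t True by blast
    have eq: "\<tau> (b t) = \<omega> t" using True t by (auto simp: simplex_map_def lift_domain_def)
    have "?\<eta> \<tau> (b t) = combination ?M (\<Sum>\<sigma>\<in>S. contribution j \<xi> \<tau> (b t) \<sigma> (c \<sigma>))"
      using substitute_eq[OF \<xi>r c bt S sub[OF b True]] eq by simp
    then show ?thesis
      using True combination_of[OF M] combination_closed[OF M] by (simp add: contribution_def)
  qed (simp add: frag_extend_eq_0)
  have "substitute G j k c' ?\<eta> \<omega> t = combination ?M (\<Sum>\<tau>\<in>T. contribution k ?\<eta> \<omega> t \<tau> (c' \<tau>))"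
    by (rule substitute_eq[OF \<eta>r c' t T sT])
  also have "\<dots> = combination ?M (\<Sum>\<tau>\<in>T. frag_extend (\<lambda>b. \<Sum>\<sigma>\<in>S. frag_extend (?F \<tau> \<sigma> b) (c \<sigma>)) (c' \<tau>))"
    unfolding contribution_def
    by (intro combination_sum_cong[OF M M] combination_frag_extend_cong[OF M M] \<eta>b)
  also have "(\<Sum>\<tau>\<in>T. frag_extend (\<lambda>b. \<Sum>\<sigma>\<in>S. frag_extend (?F \<tau> \<sigma> b) (c \<sigma>)) (c' \<tau>))
      = (\<Sum>\<tau>\<in>T. \<Sum>\<sigma>\<in>S. frag_extend (\<lambda>a. frag_extend (\<lambda>b. ?F \<tau> \<sigma> b a) (c' \<tau>)) (c \<sigma>))"
    by (simp add: frag_extend_sum_fun[OF S] frag_extend_swap[of _ "c _" "c' _"])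
  also have "\<dots> = (\<Sum>\<sigma>\<in>S. frag_extend (\<lambda>a. \<Sum>\<tau>\<in>T. frag_extend (\<lambda>b. ?F \<tau> \<sigma> b a) (c' \<tau>)) (c \<sigma>))"
    by (subst sum.swap) (simp add: frag_extend_sum_fun[OF T])
  also have "\<dots> = (\<Sum>\<sigma>\<in>S. contribution k \<xi> \<omega> t \<sigma> (?e \<sigma>))"
  proof (rule sum.cong[OF refl])
    fix \<sigma> assume \<sigma>: "\<sigma> \<in> S"
    have "(\<Sum>\<tau>\<in>T. frag_extend (\<lambda>b. ?F \<tau> \<sigma> b a) (c' \<tau>))
        = frag_extend (\<lambda>e. if simplex_map k \<sigma> e = \<omega> then frag_of (\<xi> \<sigma> (e t)) else 0) (chain_map k a (c' (simplex_map j \<sigma> a)))"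
      if a: "a \<in> keys (c \<sigma>)" for a
    proof -
      let ?\<tau> = "simplex_map j \<sigma> a"
      have "?\<tau> \<in> T" using \<sigma> a by (auto simp: T_def)
      have "(\<Sum>\<tau>\<in>T. frag_extend (\<lambda>b. ?F \<tau> \<sigma> b a) (c' \<tau>))
          = (\<Sum>\<tau>\<in>T. if ?\<tau> = \<tau> then frag_extend (\<lambda>b. ?F \<tau> \<sigma> b a) (c' \<tau>) else 0)"
        by (intro sum.cong refl) (simp add: frag_extend_eq_0)
      also have "\<dots> = frag_extend (\<lambda>b. ?F ?\<tau> \<sigma> b a) (c' ?\<tau>)"
        using \<open>?\<tau> \<in> T\<close> T by (simp add: sum.delta')
      also have "\<dots> = frag_extend ((\<lambda>e. if simplex_map k \<sigma> e = \<omega> then frag_of (\<xi> \<sigma> (e t)) else 0) \<circ> simplex_map k a) (c' ?\<tau>)"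
      proof (rule frag_extend_eq)
        fix b assume b: "b \<in> keys (c' ?\<tau>)"
        have "simplex_map k ?\<tau> b = simplex_map k \<sigma> (simplex_map k a b)"
          using familyD_in[OF c', OF b] by (intro simplex_map_simplex_map) blast
        moreover have "simplex_map k a b t = a (b t)" using t by (simp add: simplex_map_def lift_domain_def)
        ultimately show "?F ?\<tau> \<sigma> b a = ((\<lambda>e. if simplex_map k \<sigma> e = \<omega> then frag_of (\<xi> \<sigma> (e t)) else 0) \<circ> simplex_map k a) b"
          by simp
      qed
      finally show ?thesis by (simp add: chain_map_def frag_extend_compose)
    qed
    then have "frag_extend (\<lambda>a. \<Sum>\<tau>\<in>T. frag_extend (\<lambda>b. ?F \<tau> \<sigma> b a) (c' \<tau>)) (c \<sigma>)
        = frag_extend (\<lambda>a. frag_extend (\<lambda>e. if simplex_map k \<sigma> e = \<omega> then frag_of (\<xi> \<sigma> (e t)) else 0)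
             (chain_map k a (c' (simplex_map j \<sigma> a)))) (c \<sigma>)"
      by (rule frag_extend_eq)
    then show "frag_extend (\<lambda>a. \<Sum>\<tau>\<in>T. frag_extend (\<lambda>b. ?F \<tau> \<sigma> b a) (c' \<tau>)) (c \<sigma>) = contribution k \<xi> \<omega> t \<sigma> (?e \<sigma>)"
      by (simp add: contribution_def family_compose_def frag_extend_frag_extend)
  qed
  also have "combination ?M \<dots> = substitute G i k ?e \<xi> \<omega> t"
    by (rule substitute_eq[OF \<xi>r e t S se, symmetric])
  finally show "substitute G j k c' ?\<eta> \<omega> t = substitute G i k ?e \<xi> \<omega> t" .
qed

lemma lf_chains_add: "\<xi> \<in> lf_chains G X i \<Longrightarrow> \<eta> \<in> lf_chains G X i \<Longrightarrow> \<xi> \<oplus>\<^bsub>raw_module G i\<^esub> \<eta> \<in> lf_chains G X i"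
  and lf_chains_smult: "a \<in> carrier R \<Longrightarrow> \<xi> \<in> lf_chains G X i \<Longrightarrow> a \<odot>\<^bsub>raw_module G i\<^esub> \<xi> \<in> lf_chains G X i"
  using submodule_ofD[OF submodule_lf_chains] by blast+

lemma raw_module_add_apply:
  "t \<in> lift_domain G i \<sigma> \<Longrightarrow> (\<xi> \<oplus>\<^bsub>raw_module G i\<^esub> \<eta>) \<sigma> t = \<xi> \<sigma> t \<oplus>\<^bsub>stalk G (\<sigma> t)\<^esub> \<eta> \<sigma> t"
  and raw_module_smult_apply:
  "t \<in> lift_domain G i \<sigma> \<Longrightarrow> (a \<odot>\<^bsub>raw_module G i\<^esub> \<xi>) \<sigma> t = a \<odot>\<^bsub>stalk G (\<sigma> t)\<^esub> \<xi> \<sigma> t"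
  by (simp_all add: chain_module_simps)

lemma family_add: "family i j c \<Longrightarrow> family i j d \<Longrightarrow> family i j (\<lambda>\<sigma>. c \<sigma> + d \<sigma>)"
  by (simp add: family_def singular_chain_add)

lemma substitute_add_family:
  assumes \<xi>: "\<xi> \<in> lf_chains G X i" and c: "family i j c" and d: "family i j d"
  shows "substitute G i j (\<lambda>\<sigma>. c \<sigma> + d \<sigma>) \<xi> = substitute G i j c \<xi> \<oplus>\<^bsub>raw_module G j\<^esub> substitute G i j d \<xi>"
proof (rule raw_chains_eqI)
  note cd = family_add[OF c d]
  have r: "\<xi> \<in> raw_chains G i" using \<xi> lf_chains_raw by blast
  show "substitute G i j (\<lambda>\<sigma>. c \<sigma> + d \<sigma>) \<xi> \<in> raw_chains G j"
    using substitute_lf_chains[OF \<xi> cd] lf_chains_raw by blast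
  show "substitute G i j c \<xi> \<oplus>\<^bsub>raw_module G j\<^esub> substitute G i j d \<xi> \<in> raw_chains G j"
    using lf_chains_add[OF substitute_lf_chains[OF \<xi> c] substitute_lf_chains[OF \<xi> d]] lf_chains_raw by blast
  fix \<tau> t assume t: "t \<in> lift_domain G j \<tau>"
  define S where "S = sources G i j c \<xi> \<tau> \<union> sources G i j d \<xi> \<tau> \<union> sources G i j (\<lambda>\<sigma>. c \<sigma> + d \<sigma>) \<xi> \<tau>"
  have S: "finite S" unfolding S_def using finite_sources[OF \<xi>] c d cd by blast
  have sub: "sources G i j c \<xi> \<tau> \<subseteq> S" "sources G i j d \<xi> \<tau> \<subseteq> S" "sources G i j (\<lambda>\<sigma>. c \<sigma> + d \<sigma>) \<xi> \<tau> \<subseteq> S"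
    unfolding S_def by auto
  show "substitute G i j (\<lambda>\<sigma>. c \<sigma> + d \<sigma>) \<xi> \<tau> t
      = (substitute G i j c \<xi> \<oplus>\<^bsub>raw_module G j\<^esub> substitute G i j d \<xi>) \<tau> t"
    unfolding raw_module_add_apply[OF t] substitute_eq[OF r c t S sub(1)] substitute_eq[OF r d t S sub(2)]
      substitute_eq[OF r cd t S sub(3)]
    by (simp add: combination_add[OF lift_stalk[OF t], symmetric] sum.distrib contribution_add)
qed

lemma substitute_add_chain:
  assumes \<xi>: "\<xi> \<in> lf_chains G X i" and \<eta>: "\<eta> \<in> lf_chains G X i" and c: "family i j c"
  shows "substitute G i j c (\<xi> \<oplus>\<^bsub>raw_module G i\<^esub> \<eta>) = substitute G i j c \<xi> \<oplus>\<^bsub>raw_module G j\<^esub> substitute G i j c \<eta>"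
proof (rule raw_chains_eqI)
  let ?z = "\<xi> \<oplus>\<^bsub>raw_module G i\<^esub> \<eta>"
  note z = lf_chains_add[OF \<xi> \<eta>]
  have r: "\<xi> \<in> raw_chains G i" "\<eta> \<in> raw_chains G i" "?z \<in> raw_chains G i" using \<xi> \<eta> z lf_chains_raw by blast+
  show "substitute G i j c ?z \<in> raw_chains G j"
    using substitute_lf_chains[OF z c] lf_chains_raw by blast
  show "substitute G i j c \<xi> \<oplus>\<^bsub>raw_module G j\<^esub> substitute G i j c \<eta> \<in> raw_chains G j"
    using lf_chains_add[OF substitute_lf_chains[OF \<xi> c] substitute_lf_chains[OF \<eta> c]] lf_chains_raw by blast
  fix \<tau> t assume t: "t \<in> lift_domain G j \<tau>"
  let ?M = "stalk G (\<tau> t)"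
  note M = lift_stalk[OF t]
  define S where "S = sources G i j c \<xi> \<tau> \<union> sources G i j c \<eta> \<tau> \<union> sources G i j c ?z \<tau>"
  have S: "finite S" unfolding S_def using finite_sources[OF _ c] \<xi> \<eta> z by blast
  have sub: "sources G i j c \<xi> \<tau> \<subseteq> S" "sources G i j c \<eta> \<tau> \<subseteq> S" "sources G i j c ?z \<tau> \<subseteq> S"
    unfolding S_def by auto
  have "combination ?M (contribution j ?z \<tau> t \<sigma> (c \<sigma>))
      = combination ?M (contribution j \<xi> \<tau> t \<sigma> (c \<sigma>) + contribution j \<eta> \<tau> t \<sigma> (c \<sigma>))" for \<sigma>
    unfolding contribution_def frag_extend_add_fun[symmetric]
  proof (rule combination_frag_extend_cong[OF M M])
    fix a assume a: "a \<in> keys (c \<sigma>)"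
    show "combination ?M (if simplex_map j \<sigma> a = \<tau> then frag_of (?z \<sigma> (a t)) else 0) =
      combination ?M ((if simplex_map j \<sigma> a = \<tau> then frag_of (\<xi> \<sigma> (a t)) else 0) +
         (if simplex_map j \<sigma> a = \<tau> then frag_of (\<eta> \<sigma> (a t)) else 0))"
    proof (cases "simplex_map j \<sigma> a = \<tau>")
      case True
      have at: "a t \<in> lift_domain G i \<sigma>"
        using lift_domain_simplex_map[of a j i t G \<sigma>] familyD_in[OF c, OF a] t True by blast
      have eq: "\<tau> t = \<sigma> (a t)" using True t by (auto simp: simplex_map_def lift_domain_def)
      have "\<xi> \<sigma> (a t) \<in> carrier ?M" "\<eta> \<sigma> (a t) \<in> carrier ?M" "?z \<sigma> (a t) \<in> carrier ?M"
        using r at eq by (simp_all add: raw_chains_def)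
      then show ?thesis
        using True eq raw_module_add_apply[OF at]
        by (simp add: combination_add[OF M[unfolded eq]] combination_of[OF M[unfolded eq]])
    qed simp
  qed
  then have "combination ?M (\<Sum>\<sigma>\<in>S. contribution j ?z \<tau> t \<sigma> (c \<sigma>))
      = combination ?M (\<Sum>\<sigma>\<in>S. contribution j \<xi> \<tau> t \<sigma> (c \<sigma>) + contribution j \<eta> \<tau> t \<sigma> (c \<sigma>))"
    by (intro combination_sum_cong[OF M M])
  then show "substitute G i j c ?z \<tau> t = (substitute G i j c \<xi> \<oplus>\<^bsub>raw_module G j\<^esub> substitute G i j c \<eta>) \<tau> t"
    unfolding raw_module_add_apply[OF t] substitute_eq[OF r(1) c t S sub(1)] substitute_eq[OF r(2) c t S sub(2)]
      substitute_eq[OF r(3) c t S sub(3)]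
    by (simp add: combination_add[OF M] sum.distrib)
qed

lemma substitute_smult:
  assumes \<xi>: "\<xi> \<in> lf_chains G X i" and c: "family i j c" and r: "r \<in> carrier R"
  shows "substitute G i j c (r \<odot>\<^bsub>raw_module G i\<^esub> \<xi>) = r \<odot>\<^bsub>raw_module G j\<^esub> substitute G i j c \<xi>"
proof (rule raw_chains_eqI)
  let ?z = "r \<odot>\<^bsub>raw_module G i\<^esub> \<xi>"
  note z = lf_chains_smult[OF r \<xi>]
  have ra: "\<xi> \<in> raw_chains G i" "?z \<in> raw_chains G i" using \<xi> z lf_chains_raw by blast+
  show "substitute G i j c ?z \<in> raw_chains G j"
    using substitute_lf_chains[OF z c] lf_chains_raw by blast
  show "r \<odot>\<^bsub>raw_module G j\<^esub> substitute G i j c \<xi> \<in> raw_chains G j"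
    using lf_chains_smult[OF r substitute_lf_chains[OF \<xi> c]] lf_chains_raw by blast
  fix \<tau> t assume t: "t \<in> lift_domain G j \<tau>"
  let ?M = "stalk G (\<tau> t)"
  note M = lift_stalk[OF t]
  note h = additive_map_smult[OF M r]
  define S where "S = sources G i j c \<xi> \<tau> \<union> sources G i j c ?z \<tau>"
  have S: "finite S" unfolding S_def using finite_sources[OF _ c] \<xi> z by blast
  have sub: "sources G i j c \<xi> \<tau> \<subseteq> S" "sources G i j c ?z \<tau> \<subseteq> S"
    unfolding S_def by auto
  have "combination ?M (contribution j ?z \<tau> t \<sigma> (c \<sigma>)) = r \<odot>\<^bsub>?M\<^esub> combination ?M (contribution j \<xi> \<tau> t \<sigma> (c \<sigma>))" for \<sigma>
    unfolding contribution_def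
  proof (rule combination_frag_extend_additive[OF M M h])
    fix a assume a: "a \<in> keys (c \<sigma>)"
    show "combination ?M (if simplex_map j \<sigma> a = \<tau> then frag_of (?z \<sigma> (a t)) else 0) =
      r \<odot>\<^bsub>?M\<^esub> combination ?M (if simplex_map j \<sigma> a = \<tau> then frag_of (\<xi> \<sigma> (a t)) else 0)"
    proof (cases "simplex_map j \<sigma> a = \<tau>")
      case True
      have at: "a t \<in> lift_domain G i \<sigma>"
        using lift_domain_simplex_map[of a j i t G \<sigma>] familyD_in[OF c, OF a] t True by blast
      have eq: "\<tau> t = \<sigma> (a t)" using True t by (auto simp: simplex_map_def lift_domain_def)
      have "\<xi> \<sigma> (a t) \<in> carrier ?M" "?z \<sigma> (a t) \<in> carrier ?M"
        using ra at eq by (simp_all add: raw_chains_def)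
      then show ?thesis
        using True eq raw_module_smult_apply[OF at] by (simp add: combination_of[OF M[unfolded eq]])
    qed (simp add: combination_0[OF M] additive_map_zero_diff(1)[OF h M M])
  qed
  then have "combination ?M (\<Sum>\<sigma>\<in>S. contribution j ?z \<tau> t \<sigma> (c \<sigma>))
      = r \<odot>\<^bsub>?M\<^esub> combination ?M (\<Sum>\<sigma>\<in>S. contribution j \<xi> \<tau> t \<sigma> (c \<sigma>))"
    by (intro combination_sum_additive[OF M M h])
  then show "substitute G i j c ?z \<tau> t = (r \<odot>\<^bsub>raw_module G j\<^esub> substitute G i j c \<xi>) \<tau> t"
    unfolding raw_module_smult_apply[OF t] substitute_eq[OF ra(1) c t S sub(1)] substitute_eq[OF ra(2) c t S sub(2)] .
qed

end

section \<open>The boundary as a substitution\<close>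

definition identity_chain :: "nat \<Rightarrow> (nat \<Rightarrow> real) chain" where
  "identity_chain i = frag_of (restrict id (standard_simplex i))"

lemma simplicial_chain_identity [simp]: "simplicial_chain i (standard_simplex i) (identity_chain i)"
  by (simp add: identity_chain_def)

lemma family_simplicial: "(\<And>\<sigma>. simplicial_chain j (standard_simplex i) (c \<sigma>)) \<Longrightarrow> family i j c"
  by (simp add: family_def simplicial_imp_singular_chain)

lemma simplex_map_identity:
  assumes "singular_simplex i X \<sigma>"
  shows "simplex_map i \<sigma> (restrict id (standard_simplex i)) = \<sigma>"
  using singular_simplex_chain_map_id[OF assms] by (simp add: frag_of_eq)

lemma family_boundary: "family i (i - 1) (\<lambda>\<sigma>. chain_boundary i (identity_chain i))"
  using simplicial_chain_boundary[OF simplicial_chain_identity] by (intro family_simplicial) simp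

lemma chain_boundary_identity:
  "chain_boundary i (identity_chain i) =
    (if i = 0 then 0 else (\<Sum>k\<le>i. frag_cmul ((-1) ^ k) (frag_of (singular_face i k id))))"
  by (auto simp: identity_chain_def chain_boundary_of)

lemma simplex_map_face: "1 \<le> i \<Longrightarrow> k \<le> i \<Longrightarrow> simplex_map (i - 1) \<sigma> (singular_face i k id) = singular_face i k \<sigma>"
  by (auto simp: simplex_map_def singular_face_def)

context coefficient_sheaf
begin

lemma substitute_identity:
  assumes \<xi>: "\<xi> \<in> lf_chains G X i"
  shows "substitute G i i (\<lambda>\<sigma>. identity_chain i) \<xi> = \<xi>"
proof (rule raw_chains_eqI)
  have f: "family i i (\<lambda>\<sigma>. identity_chain i)" by (intro family_simplicial) simp
  show \<xi>r: "\<xi> \<in> raw_chains G i" using \<xi> lf_chains_raw by blast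
  show "substitute G i i (\<lambda>\<sigma>. identity_chain i) \<xi> \<in> raw_chains G i"
    using substitute_lf_chains[OF \<xi> f] lf_chains_raw by blast
  fix \<tau> t assume t: "t \<in> lift_domain G i \<tau>"
  let ?M = "stalk G (\<tau> t)"
  note M = lift_stalk[OF t]
  have s: "sources G i i (\<lambda>\<sigma>. identity_chain i) \<xi> \<tau> \<subseteq> {\<tau>}"
    using simplex_map_identity[OF lf_chains_simplex[OF \<xi>]] by (auto simp: sources_def identity_chain_def)
  have "substitute G i i (\<lambda>\<sigma>. identity_chain i) \<xi> \<tau> t = combination ?M (contribution i \<xi> \<tau> t \<tau> (identity_chain i))"
    using substitute_eq[OF \<xi>r f t _ s] by simp
  also have "\<dots> = \<xi> \<tau> t"
  proof (cases "\<tau> \<in> chain_simplices G i \<xi>")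
    case True
    then show ?thesis
      using t \<xi>r simplex_map_identity[OF lf_chains_simplex[OF \<xi> True]]
      by (simp add: contribution_def identity_chain_def raw_chains_def combination_of[OF M] lift_domain_def)
  next
    case False
    then have "\<xi> \<tau> t = \<zero>\<^bsub>?M\<^esub>" using t by (simp add: chain_simplices_def zero_coefficient_stalk)
    moreover have "\<zero>\<^bsub>?M\<^esub> \<in> carrier ?M" using combination_closed[OF M, of 0] by (simp add: combination_0[OF M])
    ultimately show ?thesis
      using t by (simp add: contribution_def identity_chain_def combination_of[OF M] combination_0[OF M] lift_domain_def)
  qed
  finally show "substitute G i i (\<lambda>\<sigma>. identity_chain i) \<xi> \<tau> t = \<xi> \<tau> t" .
qed

text \<open>The pieces of the boundary of the identity simplex are the inclusions of its faces.\<close>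

lemma lf_boundary_substitute:
  assumes \<xi>: "\<xi> \<in> lf_chains G X i"
  shows "lf_boundary G i \<xi> = substitute G i (i - 1) (\<lambda>\<sigma>. chain_boundary i (identity_chain i)) \<xi>"
proof (cases "i = 0")
  case True
  have "substitute G 0 0 (\<lambda>\<sigma>. chain_boundary 0 (identity_chain 0)) \<xi> = zero_coefficient G 0"
    unfolding substitute_def sources_def zero_coefficient_def
    by (intro ext) (auto simp: chain_boundary_identity combination_0[OF lift_stalk])
  then show ?thesis using True by (simp add: lf_boundary_def)
next
  case False
  then have i: "1 \<le> i" by simp
  let ?c = "\<lambda>\<sigma> :: (nat \<Rightarrow> real) \<Rightarrow> 'a. chain_boundary i (identity_chain i)"
  have \<xi>r: "\<xi> \<in> raw_chains G i" using \<xi> lf_chains_raw by blast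
  have "lf_boundary G i \<xi> \<tau> = substitute G i (i - 1) ?c \<xi> \<tau>" for \<tau>
  proof -
    let ?P = "{(\<sigma>, k). \<sigma> \<in> chain_simplices G i \<xi> \<and> k \<le> i \<and> singular_face i k \<sigma> = \<tau>}"
    define S where "S = {\<sigma> \<in> chain_simplices G i \<xi>. \<tau> first_vertex \<in> \<sigma> ` standard_simplex i}"
    have S: "finite S" unfolding S_def by (rule finite_simplices_through[OF \<xi>])
    have PS: "?P \<subseteq> S \<times> {..i}"
    proof
      fix x assume "x \<in> ?P"
      then obtain \<sigma> k where x: "x = (\<sigma>, k)" "\<sigma> \<in> chain_simplices G i \<xi>" "k \<le> i" "singular_face i k \<sigma> = \<tau>" by auto
      have "\<tau> first_vertex = \<sigma> (simplical_face k first_vertex)"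
        using x(4) first_vertex_in[of "i - Suc 0"] by (auto simp: singular_face_def)
      moreover have "simplical_face k first_vertex \<in> standard_simplex i"
        using simplical_face_in_standard_simplex[OF i x(3)] by simp
      ultimately show "x \<in> S \<times> {..i}" using x by (auto simp: S_def)
    qed
    have "(\<lambda>t\<in>lift_domain G (i - 1) \<tau>. finsum (stalk G (\<tau> t))
          (\<lambda>(\<sigma>, k). if even k then \<xi> \<sigma> (simplical_face k t) else \<ominus>\<^bsub>stalk G (\<tau> t)\<^esub> \<xi> \<sigma> (simplical_face k t)) ?P)
        = substitute G i (i - 1) ?c \<xi> \<tau>"
      unfolding substitute_def
    proof (rule restrict_ext)
      fix t assume t: "t \<in> lift_domain G (i - 1) \<tau>"
      let ?M = "stalk G (\<tau> t)"
      note M = lift_stalk[OF t]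
      interpret M: abelian_group ?M using left_moduleD[OF M] by blast
      have ti: "t \<in> standard_simplex (i - Suc 0)" using t by (simp add: lift_domain_def)
      let ?f = "\<lambda>(\<sigma>, k). if singular_face i k \<sigma> = \<tau> then frag_cmul ((-1) ^ k) (frag_of (\<xi> \<sigma> (simplical_face k t))) else 0"
      have val: "combination ?M (?f (\<sigma>, k)) = (if even k then \<xi> \<sigma> (simplical_face k t) else \<ominus>\<^bsub>?M\<^esub> \<xi> \<sigma> (simplical_face k t))"
        "(if even k then \<xi> \<sigma> (simplical_face k t) else \<ominus>\<^bsub>?M\<^esub> \<xi> \<sigma> (simplical_face k t)) \<in> carrier ?M"
        if "(\<sigma>, k) \<in> ?P" for \<sigma> k
      proof -
        have k: "k \<le> i" "singular_face i k \<sigma> = \<tau>" using that by auto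
        then have eq: "\<tau> t = \<sigma> (simplical_face k t)" using ti by (auto simp: singular_face_def)
        have "simplical_face k t \<in> lift_domain G i \<sigma>"
          using t eq simplical_face_in_standard_simplex[OF i k(1) ti] by (simp add: lift_domain_def)
        then have c: "\<xi> \<sigma> (simplical_face k t) \<in> carrier ?M" using \<xi>r eq by (simp add: raw_chains_def)
        show "combination ?M (?f (\<sigma>, k)) = (if even k then \<xi> \<sigma> (simplical_face k t) else \<ominus>\<^bsub>?M\<^esub> \<xi> \<sigma> (simplical_face k t))"
          using c k(2) by (cases "even k") (simp_all add: combination_of[OF M] combination_minus[OF M])
        show "(if even k then \<xi> \<sigma> (simplical_face k t) else \<ominus>\<^bsub>?M\<^esub> \<xi> \<sigma> (simplical_face k t)) \<in> carrier ?M"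
          using c by simp
      qed
      have "combination ?M (\<Sum>\<sigma>\<in>sources G i (i - 1) ?c \<xi> \<tau>. contribution (i - 1) \<xi> \<tau> t \<sigma> (?c \<sigma>))
          = combination ?M (\<Sum>\<sigma>\<in>S. contribution (i - 1) \<xi> \<tau> t \<sigma> (?c \<sigma>))"
        using substitute_eq[OF \<xi>r family_boundary t S] substitute_eq[OF \<xi>r family_boundary t finite_sources[OF \<xi> family_boundary] subset_refl]
          sources_through[OF family_boundary, of i \<xi> \<tau>] by (simp add: S_def)
      also have "(\<Sum>\<sigma>\<in>S. contribution (i - 1) \<xi> \<tau> t \<sigma> (?c \<sigma>)) = (\<Sum>\<sigma>\<in>S. \<Sum>k\<le>i. ?f (\<sigma>, k))"
      proof (rule sum.cong[OF refl])
        fix \<sigma> assume "\<sigma> \<in> S"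
        have "contribution (i - 1) \<xi> \<tau> t \<sigma> (?c \<sigma>) = (\<Sum>k\<le>i. frag_cmul ((-1) ^ k)
            (if simplex_map (i - 1) \<sigma> (singular_face i k id) = \<tau> then frag_of (\<xi> \<sigma> (singular_face i k id t)) else 0))"
          using False by (simp add: contribution_def chain_boundary_identity frag_extend_sum frag_extend_cmul)
        also have "\<dots> = (\<Sum>k\<le>i. ?f (\<sigma>, k))"
        proof (rule sum.cong[OF refl])
          fix k assume "k \<in> {..i}"
          then have k: "k \<le> i" by simp
          have "singular_face i k id t = simplical_face k t" using ti by (simp add: singular_face_def)
          then show "frag_cmul ((-1) ^ k)
            (if simplex_map (i - 1) \<sigma> (singular_face i k id) = \<tau> then frag_of (\<xi> \<sigma> (singular_face i k id t)) else 0) = ?f (\<sigma>, k)"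
            unfolding simplex_map_face[OF i k] by simp
        qed
        finally show "contribution (i - 1) \<xi> \<tau> t \<sigma> (?c \<sigma>) = (\<Sum>k\<le>i. ?f (\<sigma>, k))" .
      qed
      also have "\<dots> = (\<Sum>x\<in>S \<times> {..i}. ?f x)" by (simp add: sum.cartesian_product)
      also have "\<dots> = (\<Sum>x\<in>?P. ?f x)"
        by (rule sum.mono_neutral_right) (use S PS in \<open>auto simp: S_def split: if_splits\<close>)
      also have "combination ?M \<dots> = finsum ?M (\<lambda>x. combination ?M (?f x)) ?P"
        by (rule combination_sum[OF M]) (rule finite_subset[OF PS], use S in simp)
      also have "\<dots> = finsum ?M (\<lambda>(\<sigma>, k). if even k then \<xi> \<sigma> (simplical_face k t) else \<ominus>\<^bsub>?M\<^esub> \<xi> \<sigma> (simplical_face k t)) ?P"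
        by (rule M.finsum_cong') (use val in auto)
      finally show "finsum ?M (\<lambda>(\<sigma>, k). if even k then \<xi> \<sigma> (simplical_face k t) else \<ominus>\<^bsub>?M\<^esub> \<xi> \<sigma> (simplical_face k t)) ?P
          = combination ?M (\<Sum>\<sigma>\<in>sources G i (i - 1) ?c \<xi> \<tau>. contribution (i - 1) \<xi> \<tau> t \<sigma> (?c \<sigma>))" by simp
    qed
    then show ?thesis using False by (simp add: lf_boundary_def)
  qed
  then show ?thesis by blast
qed

end

section \<open>Supports of points under subdivision\<close>

definition support :: "(nat \<Rightarrow> real) \<Rightarrow> nat set" where "support t = {l. t l \<noteq> 0}"

lemma support_standard_simplex: "t \<in> standard_simplex i \<Longrightarrow> support t \<subseteq> {..i}"
  unfolding support_def standard_simplex_def by (auto simp: not_le[symmetric])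

lemma finite_support: "t \<in> standard_simplex i \<Longrightarrow> finite (support t)"
  using support_standard_simplex finite_subset by blast

lemma card_support_le: "t \<in> standard_simplex i \<Longrightarrow> card (support t) \<le> Suc i"
  using card_mono[OF _ support_standard_simplex, of i t] by simp

text \<open>A point \<open>t\<close> lies in the interior of the face spanned by \<open>support t\<close>.  The condition says that the codimension of
  the face of \<open>a t\<close> is at most that of the face of \<open>t\<close>.  Allowability bounds codimensions from below, so
  it passes from \<open>\<sigma>\<close> to \<open>\<sigma> \<circ> a\<close>.\<close>

definition codimension_preserving :: "nat \<Rightarrow> nat \<Rightarrow> (nat \<Rightarrow> real) sing \<Rightarrow> bool" where
  "codimension_preserving i j a \<longleftrightarrow>
     (\<forall>t\<in>standard_simplex j. card (support t) + i \<le> card (support (a t)) + j)"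

text \<open>For points of the face opposite to the last vertex the dimension of the face is raised at least by one.\<close>

definition vertex_transverse :: "nat \<Rightarrow> (nat \<Rightarrow> real) sing \<Rightarrow> bool" where
  "vertex_transverse i a \<longleftrightarrow>
     (\<forall>t\<in>standard_simplex i. card (support t) + (if t i = 0 then 1 else 0) \<le> card (support (a t)))"

lemma codimension_preserving_compose:
  assumes "codimension_preserving i j a" "codimension_preserving j k b"
    and "b ` standard_simplex k \<subseteq> standard_simplex j"
  shows "codimension_preserving i k (simplex_map k a b)"
  unfolding codimension_preserving_def
proof
  fix t assume t: "t \<in> standard_simplex k"
  have "card (support t) + j \<le> card (support (b t)) + k"
    using assms(2) t by (simp add: codimension_preserving_def)
  moreover have "card (support (b t)) + i \<le> card (support (a (b t))) + j"
    using assms(1,3) t unfolding codimension_preserving_def by blast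
  ultimately show "card (support t) + i \<le> card (support (simplex_map k a b t)) + k"
    using t by (simp add: simplex_map_def)
qed

text \<open>Barycentric subdivision is a recursion over faces.  For this reason the properties of its pieces have to be proved
  for all faces of a standard simplex, which are the simplices spanned by distinct unit vectors.\<close>

definition coordinate_simplex :: "nat \<Rightarrow> (nat \<Rightarrow> real) sing \<Rightarrow> bool" where
  "coordinate_simplex p f \<longleftrightarrow> (\<exists>s. inj_on s {..p} \<and> f = oriented_simplex p (\<lambda>j i. if i = s j then 1 else 0))"

lemma coordinate_simplex_id: "coordinate_simplex p (restrict id (standard_simplex p))"
  unfolding coordinate_simplex_def
proof (intro exI conjI)
  show "restrict id (standard_simplex p) = oriented_simplex p (\<lambda>j i. if i = id j then 1 else 0)"
    by (force simp: oriented_simplex_def standard_simplex_def if_distrib [of "\<lambda>u. u * _"] cong: if_cong)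
qed simp

lemma coordinate_simplex_face:
  assumes "coordinate_simplex (Suc p) f" "k \<le> Suc p"
  shows "coordinate_simplex p (singular_face (Suc p) k f)"
proof -
  obtain s where s: "inj_on s {..Suc p}" "f = oriented_simplex (Suc p) (\<lambda>j i. if i = s j then 1 else 0)"
    using assms(1) by (auto simp: coordinate_simplex_def)
  let ?s = "\<lambda>j. s (if j < k then j else Suc j)"
  have "inj_on ?s {..p}"
  proof (rule inj_onI)
    fix x y assume xy: "x \<in> {..p}" "y \<in> {..p}" "?s x = ?s y"
    have "(if x < k then x else Suc x) = (if y < k then y else Suc y)"
      by (rule inj_onD[OF s(1) xy(3)]) (use xy(1,2) in auto)
    then show "x = y" by (auto split: if_splits)
  qed
  moreover have "singular_face (Suc p) k f = oriented_simplex p (\<lambda>j i. if i = ?s j then 1 else 0)"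
    using singular_face_oriented_simplex[of "Suc p" k "\<lambda>j i. if i = s j then 1 else 0"] assms(2)
    by (simp add: s(2) oriented_simplex_eq)
  ultimately show ?thesis unfolding coordinate_simplex_def by blast
qed

lemma nonzero_sum_image:
  assumes "(\<Sum>j\<le>p. if i = s j then u j else 0) \<noteq> (0 :: real)"
  shows "i \<in> s ` {..p}"
proof (rule ccontr)
  assume "i \<notin> s ` {..p}"
  then have "(\<Sum>j\<le>p. if i = s j then u j else 0) = 0" by (intro sum.neutral) auto
  then show False using assms by simp
qed

lemma coordinate_simplex_support:
  assumes "coordinate_simplex p f" and t: "t \<in> standard_simplex p"
  shows "card (support t) \<le> card (support (f t))"
proof -
  obtain s where s: "inj_on s {..p}" "f = oriented_simplex p (\<lambda>j i. if i = s j then 1 else 0)"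
    using assms(1) by (auto simp: coordinate_simplex_def)
  have f: "f t = (\<lambda>i. \<Sum>j\<le>p. if i = s j then t j else 0)"
    using t by (simp add: s(2) oriented_simplex_def if_distrib[of "\<lambda>u. u * _"] cong: if_cong)
  have fs: "f t (s k) = t k" if "k \<le> p" for k
  proof -
    have "f t (s k) = (\<Sum>j\<le>p. if j = k then t j else 0)"
      unfolding f using that by (intro sum.cong refl) (auto simp: inj_on_eq_iff[OF s(1)])
    then show ?thesis using that by simp
  qed
  have sub: "support t \<subseteq> {..p}" by (rule support_standard_simplex[OF t])
  have "support (f t) \<subseteq> s ` {..p}"
  proof
    fix i assume "i \<in> support (f t)"
    then have "(\<Sum>j\<le>p. if i = s j then t j else 0) \<noteq> 0" by (simp add: support_def f)
    then show "i \<in> s ` {..p}" by (rule nonzero_sum_image)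
  qed
  then have fin: "finite (support (f t))" using finite_subset by blast
  have "s ` support t \<subseteq> support (f t)" using fs sub by (auto simp: support_def)
  then have "card (s ` support t) \<le> card (support (f t))" by (rule card_mono[OF fin])
  moreover have "card (s ` support t) = card (support t)"
    by (rule card_image) (rule inj_on_subset[OF s(1) sub])
  ultimately show ?thesis by simp
qed

lemma coordinate_simplex_barycenter:
  assumes "coordinate_simplex p f"
  defines "b \<equiv> \<lambda>i. (\<Sum>j\<le>p. simplicial_vertex j f i) / real (Suc p)"
  shows "card (support b) = Suc p" "\<And>i. 0 \<le> b i"
proof -
  obtain s where s: "inj_on s {..p}" "f = oriented_simplex p (\<lambda>j i. if i = s j then 1 else 0)"
    using assms(1) by (auto simp: coordinate_simplex_def)
  have b: "b = (\<lambda>i. (\<Sum>j\<le>p. if i = s j then 1 else 0) / real (Suc p))"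
    by (simp add: b_def s(2) simplicial_vertex_oriented_simplex)
  show nn: "0 \<le> b i" for i unfolding b by (intro divide_nonneg_nonneg sum_nonneg) auto
  have "support b = s ` {..p}"
  proof (rule equalityI; rule subsetI)
    fix i assume "i \<in> support b"
    then have "(\<Sum>j\<le>p. if i = s j then 1 else 0) \<noteq> (0::real)" by (simp add: support_def b)
    then show "i \<in> s ` {..p}" by (rule nonzero_sum_image)
  next
    fix i assume "i \<in> s ` {..p}"
    then obtain k where k: "k \<le> p" "i = s k" by auto
    have "(1::real) = (\<Sum>j\<in>{k}. if i = s j then 1 else 0)" using k by simp
    also have "\<dots> \<le> (\<Sum>j\<le>p. if i = s j then 1 else 0)" by (rule sum_mono2) (use k in auto)
    finally show "i \<in> support b" by (simp add: support_def b)
  qed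
  then show "card (support b) = Suc p" using card_image[OF s(1)] by simp
qed

text \<open>The coordinate \<open>0\<close> belongs to the apex \<open>b\<close> of the cone.  If it vanishes, the point lies on the base.  Otherwise
  nothing cancels, since all coordinates are nonnegative, and the support of \<open>b\<close> is contained in that of the image.\<close>

lemma simplex_cone_support:
  assumes a: "simplicial_simplex p (standard_simplex n) a" and b: "\<And>i. 0 \<le> b i"
    and t: "t \<in> standard_simplex (Suc p)"
  shows "t 0 = 0 \<Longrightarrow> \<exists>t'\<in>standard_simplex p. simplex_cone p b a t = a t' \<and> card (support t') = card (support t) \<and> t' p = t (Suc p)"
    and "t 0 \<noteq> 0 \<Longrightarrow> support b \<subseteq> support (simplex_cone p b a t)"
proof -
  obtain l where l: "a = oriented_simplex p l" and an: "a ` standard_simplex p \<subseteq> standard_simplex n"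
    using a by (auto simp: simplicial_simplex)
  have c: "simplex_cone p b a t = (\<lambda>i. b i * t 0 + (\<Sum>j\<le>p. l j i * t (Suc j)))"
    unfolding l simplex_cone using t by (simp add: oriented_simplex_def sum.atMost_Suc_shift del: sum.atMost_Suc)
  have t01: "\<And>i. 0 \<le> t i" "\<And>i. t i \<le> 1" "\<And>i. i > Suc p \<Longrightarrow> t i = 0" "(\<Sum>i\<le>Suc p. t i) = 1"
    using t by (auto simp: standard_simplex_def)
  {
    assume t0: "t 0 = 0"
    let ?t = "\<lambda>j. t (Suc j)"
    have "(\<Sum>i\<le>p. t (Suc i)) = 1" using t01(4) t0 by (simp add: sum.atMost_Suc_shift del: sum.atMost_Suc)
    then have t': "?t \<in> standard_simplex p" using t01 by (auto simp: standard_simplex_def)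
    have "support t = Suc ` support ?t"
    proof (rule equalityI; rule subsetI)
      fix l assume "l \<in> support t"
      then show "l \<in> Suc ` support ?t" using t0 by (cases l) (auto simp: support_def)
    qed (auto simp: support_def)
    then have "card (support ?t) = card (support t)" by (simp add: card_image)
    moreover have "simplex_cone p b a t = a ?t"
      unfolding c using t0 t' by (simp add: l oriented_simplex_def)
    ultimately show "\<exists>t'\<in>standard_simplex p. simplex_cone p b a t = a t' \<and> card (support t') = card (support t) \<and> t' p = t (Suc p)"
      using t' by blast
  }
  assume t0: "t 0 \<noteq> 0"
  have l0: "0 \<le> l j i" if "j \<le> p" for j i
  proof -
    have "a (\<lambda>i. if i = j then 1 else 0) \<in> standard_simplex n" using an that basis_in_standard_simplex by blast
    moreover have "a (\<lambda>i. if i = j then 1 else 0) = l j"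
      using simplicial_vertex_oriented_simplex[of j p l] that by (simp add: simplicial_vertex_def l)
    ultimately show ?thesis by (simp add: standard_simplex_def)
  qed
  show "support b \<subseteq> support (simplex_cone p b a t)"
  proof
    fix i assume "i \<in> support b"
    then have "0 < b i * t 0" using b[of i] t01(1)[of 0] t0 by (simp add: support_def less_le)
    moreover have "0 \<le> (\<Sum>j\<le>p. l j i * t (Suc j))" using l0 t01(1) by (intro sum_nonneg mult_nonneg_nonneg) auto
    ultimately show "i \<in> support (simplex_cone p b a t)" unfolding c support_def by simp
  qed
qed

lemma linear_frag_extend:
  fixes F :: "('a \<Rightarrow>\<^sub>0 int) \<Rightarrow> ('b \<Rightarrow>\<^sub>0 int)"
  assumes "F 0 = 0" "\<And>a b. F (a - b) = F a - F b"
  shows "F c = frag_extend (\<lambda>x. F (frag_of x)) c"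
  using subset_UNIV[of "keys c"] by (induction c rule: frag_induction) (simp_all add: assms frag_extend_diff)

lemma keys_linear:
  fixes F :: "('a \<Rightarrow>\<^sub>0 int) \<Rightarrow> ('b \<Rightarrow>\<^sub>0 int)"
  assumes "F 0 = 0" "\<And>a b. F (a - b) = F a - F b" and y: "y \<in> keys (F c)"
  obtains x where "x \<in> keys c" "y \<in> keys (F (frag_of x))"
  using linear_frag_extend[of F c, OF assms(1,2)] y keys_frag_extend[of "\<lambda>x. F (frag_of x)" c] by auto

lemma keys_simplicial_cone:
  assumes "y \<in> keys (simplicial_cone p b c)"
  obtains x where "x \<in> keys c" "y = simplex_cone p b x"
  using assms keys_frag_extend[of "frag_of \<circ> simplex_cone p b" c] by (auto simp: simplicial_cone_def)

lemma keys_chain_boundary: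
  assumes "y \<in> keys (chain_boundary p (frag_of f))"
  obtains k where "p \<noteq> 0" "k \<le> p" "y = singular_face p k f"
proof -
  have p: "p \<noteq> 0" using assms by (auto simp: chain_boundary_of split: if_splits)
  have "y \<in> keys (\<Sum>k\<le>p. frag_cmul ((-1) ^ k) (frag_of (singular_face p k f)))"
    using assms p by (simp add: chain_boundary_of)
  from subsetD[OF keys_sum this] obtain k where "k \<le> p" "y = singular_face p k f" by auto
  then show thesis using that p by blast
qed

lemma simplicial_simplex_keys: "simplicial_chain p S c \<Longrightarrow> a \<in> keys c \<Longrightarrow> simplicial_simplex p S a"
  by (auto simp: simplicial_chain_def)

lemma simplicial_simplex_in: "simplicial_simplex p S a \<Longrightarrow> t \<in> standard_simplex p \<Longrightarrow> a t \<in> S"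
  by (auto simp: simplicial_simplex)

text \<open>A piece is a cone from the barycentre \<open>b\<close> over a piece of the subdivided boundary.  The image of a
  point off the base has full support, because \<open>b\<close> has, and the point itself has less if its last coordinate
  vanishes.  On the base the claim holds by induction, since the cone and its base have the same last vertex.\<close>

lemma vertex_transverse_simplicial_subdivision:
  assumes "coordinate_simplex p f" "simplicial_simplex p (standard_simplex n) f"
    "a \<in> keys (simplicial_subdivision p (frag_of f))"
  shows "vertex_transverse p a"
  using assms
proof (induction p arbitrary: f a)
  case 0
  have "card (support t) + (if t 0 = 0 then 1 else 0) \<le> card (support (f t))" if t: "t \<in> standard_simplex 0" for t
    using coordinate_simplex_support[OF 0(1) t] t by (simp add: standard_simplex_0)
  then show ?case using 0(3) by (simp add: vertex_transverse_def)
next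
  case (Suc p)
  define b where "b = (\<lambda>i. (\<Sum>j\<le>Suc p. simplicial_vertex j f i) / real (Suc (Suc p)))"
  have b: "card (support b) = Suc (Suc p)" "\<And>i. 0 \<le> b i"
    unfolding b_def by (rule coordinate_simplex_barycenter[OF Suc.prems(1)])+
  have "simplicial_subdivision (Suc p) (frag_of f)
      = simplicial_cone p b (simplicial_subdivision p (chain_boundary (Suc p) (frag_of f)))"
    by (simp only: simplicial_subdivision_of[of "Suc p"] b_def nat.simps diff_Suc_1 if_False)
  then obtain a' where a': "a' \<in> keys (simplicial_subdivision p (chain_boundary (Suc p) (frag_of f)))"
    and a: "a = simplex_cone p b a'"
    using Suc.prems(3) keys_simplicial_cone by metis
  obtain g where g: "g \<in> keys (chain_boundary (Suc p) (frag_of f))"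
    "a' \<in> keys (simplicial_subdivision p (frag_of g))"
    using keys_linear[of "simplicial_subdivision p", OF simplicial_subdivision_0 simplicial_subdivision_diff a'] by metis
  obtain k where k: "k \<le> Suc p" "g = singular_face (Suc p) k f" using keys_chain_boundary[OF g(1)] by metis
  have gs: "simplicial_simplex p (standard_simplex n) g"
    using simplicial_simplex_singular_face[OF Suc.prems(2), of k] k by simp
  have IH: "vertex_transverse p a'"
    by (rule Suc.IH[OF _ gs g(2)]) (use coordinate_simplex_face[OF Suc.prems(1) k(1)] k in simp)
  have a's: "simplicial_simplex p (standard_simplex n) a'"
    using simplicial_simplex_keys[OF simplicial_chain_simplicial_subdivision g(2)] gs by simp
  have as: "simplicial_simplex (Suc p) (standard_simplex n) a"
    using simplicial_simplex_keys[OF simplicial_chain_simplicial_subdivision Suc.prems(3)] Suc.prems(2) by simp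
  show ?case
    unfolding vertex_transverse_def
  proof
    fix t assume t: "t \<in> standard_simplex (Suc p)"
    note cone = simplex_cone_support[OF a's, of b, OF b(2) t, folded a]
    show "card (support t) + (if t (Suc p) = 0 then 1 else 0) \<le> card (support (a t))"
    proof (cases "t 0 = 0")
      case True
      obtain t' where t': "t' \<in> standard_simplex p" "a t = a' t'" "card (support t') = card (support t)" "t' p = t (Suc p)"
        using cone(1)[OF True] by blast
      show ?thesis using bspec[OF IH[unfolded vertex_transverse_def] t'(1)] t'(2-4) by simp
    next
      case False
      have "card (support b) \<le> card (support (a t))"
        by (rule card_mono[OF finite_support[OF simplicial_simplex_in[OF as t]] cone(2)[OF False]])
      then have 1: "Suc (Suc p) \<le> card (support (a t))" using b(1) by simp
      have sub: "support t \<subseteq> {..Suc p} - (if t (Suc p) = 0 then {Suc p} else {})"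
        using support_standard_simplex[OF t] by (auto simp: support_def)
      have "card (support t) \<le> card ({..Suc p} - (if t (Suc p) = 0 then {Suc p} else {}))"
        by (rule card_mono[OF _ sub]) simp
      also have "\<dots> = Suc (Suc p) - (if t (Suc p) = 0 then 1 else 0)" by (auto simp: card_Diff_singleton)
      finally show ?thesis using 1 by (auto split: if_splits)
    qed
  qed
qed

text \<open>The pieces of the homotopy are cones from the barycentre as well, and the image of a point off the base has full
  support.  The base is a piece of the subdivision, the simplex itself, or a piece of the homotopy on a face; in each
  case the support of a point has at most one element more than that of its image.\<close>

lemma codimension_preserving_subd:
  assumes "coordinate_simplex p f" "simplicial_simplex p (standard_simplex n) f"
    "a \<in> keys (subd p (frag_of f))"
  shows "codimension_preserving p (Suc p) a"
  using assms
proof (induction p arbitrary: f a)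
  case 0
  then show ?case by simp
next
  case (Suc p)
  define b where "b = (\<lambda>i. (\<Sum>j\<le>Suc p. simplicial_vertex j f i) / real (Suc (Suc p)))"
  have b: "card (support b) = Suc (Suc p)" "\<And>i. 0 \<le> b i"
    unfolding b_def by (rule coordinate_simplex_barycenter[OF Suc.prems(1)])+
  let ?c = "simplicial_subdivision (Suc p) (frag_of f) - frag_of f - subd p (chain_boundary (Suc p) (frag_of f))"
  have "subd (Suc p) (frag_of f) = simplicial_cone (Suc p) b ?c"
    by (simp add: b_def del: simplicial_subdivision.simps)
  then obtain a' where a': "a' \<in> keys ?c" and a: "a = simplex_cone (Suc p) b a'"
    using Suc.prems(3) keys_simplicial_cone by metis
  have fs: "simplicial_chain (Suc p) (standard_simplex n) (frag_of f)" using Suc.prems(2) by simp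
  have dfs: "simplicial_chain p (standard_simplex n) (chain_boundary (Suc p) (frag_of f))"
    using simplicial_chain_boundary[OF fs] by simp
  have cs: "simplicial_chain (Suc p) (standard_simplex n) ?c"
    by (intro simplicial_chain_diff simplicial_chain_simplicial_subdivision fs chain_homotopic_simplicial_subdivision2 dfs)
  have a's: "simplicial_simplex (Suc p) (standard_simplex n) a'" by (rule simplicial_simplex_keys[OF cs a'])
  have as: "simplicial_simplex (Suc (Suc p)) (standard_simplex n) a"
    using simplicial_simplex_keys[OF chain_homotopic_simplicial_subdivision2[OF fs] Suc.prems(3)] .
  have slack: "card (support t) \<le> card (support (a' t)) + 1" if t: "t \<in> standard_simplex (Suc p)" for t
  proof -
    consider "a' \<in> keys (simplicial_subdivision (Suc p) (frag_of f))" | "a' = f"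
      | "a' \<in> keys (subd p (chain_boundary (Suc p) (frag_of f)))"
      using a' keys_diff[of "simplicial_subdivision (Suc p) (frag_of f) - frag_of f" "subd p (chain_boundary (Suc p) (frag_of f))"]
        keys_diff[of "simplicial_subdivision (Suc p) (frag_of f)" "frag_of f"] by auto
    then show ?thesis
    proof cases
      case 1
      have "vertex_transverse (Suc p) a'"
        by (rule vertex_transverse_simplicial_subdivision[OF Suc.prems(1,2) 1])
      then show ?thesis using t by (fastforce simp: vertex_transverse_def)
    next
      case 2
      then show ?thesis using coordinate_simplex_support[OF Suc.prems(1) t] by simp
    next
      case 3
      obtain g where g: "g \<in> keys (chain_boundary (Suc p) (frag_of f))" "a' \<in> keys (subd p (frag_of g))"
        using keys_linear[of "subd p", OF subd_0 subd_diff 3] by metis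
      obtain k where k: "k \<le> Suc p" "g = singular_face (Suc p) k f" using keys_chain_boundary[OF g(1)] by metis
      have gs: "simplicial_simplex p (standard_simplex n) g"
        using simplicial_simplex_singular_face[OF Suc.prems(2), of k] k by simp
      have "codimension_preserving p (Suc p) a'"
        by (rule Suc.IH[OF _ gs g(2)]) (use coordinate_simplex_face[OF Suc.prems(1) k(1)] k in simp)
      then show ?thesis using t by (fastforce simp: codimension_preserving_def)
    qed
  qed
  show ?case
    unfolding codimension_preserving_def
  proof
    fix t assume t: "t \<in> standard_simplex (Suc (Suc p))"
    note cone = simplex_cone_support[OF a's, of b, OF b(2) t, folded a]
    show "card (support t) + Suc p \<le> card (support (a t)) + Suc (Suc p)"
    proof (cases "t 0 = 0")
      case True
      obtain t' where t': "t' \<in> standard_simplex (Suc p)" "a t = a' t'" "card (support t') = card (support t)"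
        using cone(1)[OF True] by blast
      show ?thesis using slack[OF t'(1)] t'(2,3) by simp
    next
      case False
      have "card (support b) \<le> card (support (a t))"
        by (rule card_mono[OF finite_support[OF simplicial_simplex_in[OF as t]] cone(2)[OF False]])
      then show ?thesis using b(1) card_support_le[OF t] by simp
    qed
  qed
qed

section \<open>Iterated subdivision of the standard simplex\<close>

definition iterated_subdivision :: "nat \<Rightarrow> nat \<Rightarrow> (nat \<Rightarrow> real) chain" where
  "iterated_subdivision i m = (simplicial_subdivision i ^^ m) (identity_chain i)"

text \<open>The homotopies from each subdivision to the next add up to one from the identity to the \<open>m\<close>th subdivision.\<close>

definition subdivision_homotopy :: "nat \<Rightarrow> nat \<Rightarrow> (nat \<Rightarrow> real) chain" where
  "subdivision_homotopy i m = (\<Sum>k<m. subd i (iterated_subdivision i k))"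

text \<open>The signed sum of copies of \<open>c\<close> on the faces of the standard \<open>i\<close>-simplex: what becomes of its boundary if \<open>c\<close> is
  substituted for every face.\<close>

definition on_faces :: "nat \<Rightarrow> nat \<Rightarrow> (nat \<Rightarrow> real) chain \<Rightarrow> (nat \<Rightarrow> real) chain" where
  "on_faces i j c = frag_extend (\<lambda>a. chain_map j a c) (chain_boundary i (identity_chain i))"

lemma iterated_subdivision_0 [simp]: "iterated_subdivision i 0 = identity_chain i"
  by (simp add: iterated_subdivision_def)

lemma iterated_subdivision_Suc: "iterated_subdivision i (Suc m) = simplicial_subdivision i (iterated_subdivision i m)"
  by (simp add: iterated_subdivision_def)

lemma simplicial_iterated_subdivision: "simplicial_chain i (standard_simplex i) (iterated_subdivision i m)"
  by (induction m) (simp_all add: iterated_subdivision_Suc simplicial_chain_simplicial_subdivision)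

lemma simplicial_subdivision_homotopy: "simplicial_chain (Suc i) (standard_simplex i) (subdivision_homotopy i m)"
  unfolding subdivision_homotopy_def
  by (intro simplicial_chain_sum chain_homotopic_simplicial_subdivision2 simplicial_iterated_subdivision)

lemma chain_map_identity:
  assumes "simplicial_simplex i S g"
  shows "chain_map i g (identity_chain i) = frag_of g"
  using assms singular_simplex_chain_map_id[of i "subtopology (powertop_real UNIV) S" g]
  by (simp add: identity_chain_def simplicial_simplex_def)

lemma power_simplicial_subdivision_diff:
  "(simplicial_subdivision i ^^ m) (a - b) = (simplicial_subdivision i ^^ m) a - (simplicial_subdivision i ^^ m) b"
  by (induction m) (simp_all add: simplicial_subdivision_diff)

lemma power_simplicial_subdivision_0 [simp]: "(simplicial_subdivision i ^^ m) 0 = 0"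
  by (induction m) simp_all

text \<open>Subdivision is natural with respect to affine simplices, so that everything can be expressed by the subdivisions of
  the standard simplices.\<close>

lemma power_simplicial_subdivision_of:
  assumes g: "simplicial_simplex i (standard_simplex n) g"
  shows "(simplicial_subdivision i ^^ m) (frag_of g) = chain_map i g (iterated_subdivision i m)"
proof (induction m)
  case 0
  then show ?case by (simp add: chain_map_identity[OF g])
next
  case (Suc m)
  then show ?case
    by (simp add: iterated_subdivision_Suc naturality_simplicial_subdivision[OF simplicial_iterated_subdivision g])
qed

lemma chain_boundary_iterated_subdivision:
  "chain_boundary i (iterated_subdivision i m) = (simplicial_subdivision (i - 1) ^^ m) (chain_boundary i (identity_chain i))"
  by (induction m)
     (simp_all add: iterated_subdivision_Suc chain_boundary_simplicial_subdivision[OF simplicial_iterated_subdivision])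

lemma keys_boundary_identity:
  assumes "a \<in> keys (chain_boundary i (identity_chain i))"
  obtains k where "i \<noteq> 0" "k \<le> i" "a = singular_face i k id" "simplicial_simplex (i - 1) (standard_simplex i) a"
proof -
  obtain k where k: "i \<noteq> 0" "k \<le> i" "a = singular_face i k (restrict id (standard_simplex i))"
    using assms keys_chain_boundary unfolding identity_chain_def by metis
  have "simplicial_simplex (i - 1) (standard_simplex i) a"
    using simplicial_simplex_keys[OF simplicial_chain_boundary[OF simplicial_chain_identity] assms] .
  then show thesis using that k by simp
qed

lemma boundary_iterated_subdivision:
  "chain_boundary i (iterated_subdivision i m) = on_faces i (i - 1) (iterated_subdivision (i - 1) m)"
proof -
  have "(simplicial_subdivision (i - 1) ^^ m) (chain_boundary i (identity_chain i))
      = frag_extend (\<lambda>a. (simplicial_subdivision (i - 1) ^^ m) (frag_of a)) (chain_boundary i (identity_chain i))"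
    by (rule linear_frag_extend[of "simplicial_subdivision (i - 1) ^^ m"]) (simp_all add: power_simplicial_subdivision_diff)
  also have "\<dots> = on_faces i (i - 1) (iterated_subdivision (i - 1) m)"
    unfolding on_faces_def
    by (rule frag_extend_eq, erule keys_boundary_identity) (rule power_simplicial_subdivision_of)
  finally show ?thesis by (simp only: chain_boundary_iterated_subdivision)
qed

text \<open>This is the homotopy formula \<open>\<partial>T + T\<partial> + id = S\<^sup>m\<close> of barycentric subdivision \<open>S\<close>.  By naturality, \<open>T\<partial>\<close> consists
  of the homotopies of the faces.\<close>

lemma boundary_subdivision_homotopy:
  "chain_boundary (Suc i) (subdivision_homotopy i m) + on_faces i i (subdivision_homotopy (i - 1) m) + identity_chain i
     = iterated_subdivision i m"
proof -
  let ?B = "chain_boundary i (identity_chain i)"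
  have "chain_boundary (Suc i) (subdivision_homotopy i m)
      = (\<Sum>k<m. chain_boundary (Suc i) (subd i (iterated_subdivision i k)))"
    by (simp add: subdivision_homotopy_def chain_boundary_sum o_def)
  also have "\<dots> = (\<Sum>k<m. iterated_subdivision i (Suc k) - iterated_subdivision i k
      - subd (i - 1) (chain_boundary i (iterated_subdivision i k)))"
    using chain_homotopic_simplicial_subdivision3[OF simplicial_iterated_subdivision[of i]]
    by (simp add: iterated_subdivision_Suc)
  also have "\<dots> = iterated_subdivision i m - identity_chain i
      - (\<Sum>k<m. subd (i - 1) (chain_boundary i (iterated_subdivision i k)))"
    using sum_lessThan_telescope[of "iterated_subdivision i" m] by (simp add: sum_subtractf)
  also have "(\<Sum>k<m. subd (i - 1) (chain_boundary i (iterated_subdivision i k)))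
      = on_faces i i (subdivision_homotopy (i - 1) m)"
  proof -
    let ?F = "\<lambda>c. \<Sum>k<m. subd (i - 1) ((simplicial_subdivision (i - 1) ^^ k) c)"
    have "?F ?B = frag_extend (\<lambda>a. ?F (frag_of a)) ?B"
      by (rule linear_frag_extend[of ?F]) (simp_all add: power_simplicial_subdivision_diff sum_subtractf)
    also have "\<dots> = on_faces i i (subdivision_homotopy (i - 1) m)"
      unfolding on_faces_def
    proof (rule frag_extend_eq, erule keys_boundary_identity)
      fix a k assume i: "i \<noteq> 0" and a: "simplicial_simplex (i - 1) (standard_simplex i) a"
      have "subd (i - 1) ((simplicial_subdivision (i - 1) ^^ k) (frag_of a))
          = chain_map i a (subd (i - 1) (iterated_subdivision (i - 1) k))" for k
        unfolding power_simplicial_subdivision_of[OF a]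
        using chain_homotopic_simplicial_subdivision1[OF simplicial_iterated_subdivision a, of k] i by simp
      then show "?F (frag_of a) = chain_map i a (subdivision_homotopy (i - 1) m)"
        by (simp add: subdivision_homotopy_def chain_map_sum o_def)
    qed
    finally show ?thesis by (simp only: chain_boundary_iterated_subdivision)
  qed
  finally show ?thesis by simp
qed

lemma subdivision_homotopy_diff:
  "m \<le> n \<Longrightarrow> subdivision_homotopy i n - subdivision_homotopy i m = (\<Sum>k\<in>{m..<n}. subd i (iterated_subdivision i k))"
  unfolding subdivision_homotopy_def
  by (simp add: lessThan_atLeast0 sum_diff_nat_ivl)

lemma keys_chain_map:
  assumes "y \<in> keys (chain_map p f c)"
  obtains x where "x \<in> keys c" "y = simplex_map p f x"
  using assms keys_frag_extend[of "frag_of \<circ> simplex_map p f" c] by (auto simp: chain_map_def)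

lemma keys_simplicial_subdivision:
  assumes c: "simplicial_chain i (standard_simplex n) c" and y: "y \<in> keys (simplicial_subdivision i c)"
  obtains f a where "f \<in> keys c" "a \<in> keys (iterated_subdivision i 1)" "y = simplex_map i f a"
proof -
  obtain f where f: "f \<in> keys c" "y \<in> keys (simplicial_subdivision i (frag_of f))"
    using keys_linear[of "simplicial_subdivision i", OF simplicial_subdivision_0 simplicial_subdivision_diff y] by metis
  have "simplicial_subdivision i (frag_of f) = chain_map i f (iterated_subdivision i 1)"
    using power_simplicial_subdivision_of[OF simplicial_simplex_keys[OF c f(1)], of 1] by simp
  then show thesis using f that keys_chain_map by metis
qed

lemma keys_subd:
  assumes c: "simplicial_chain i (standard_simplex i) c" and y: "y \<in> keys (subd i c)"
  obtains f a where "f \<in> keys c" "a \<in> keys (subd i (identity_chain i))" "y = simplex_map (Suc i) f a"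
proof -
  obtain f where f: "f \<in> keys c" "y \<in> keys (subd i (frag_of f))"
    using keys_linear[of "subd i", OF subd_0 subd_diff y] by metis
  have fs: "simplicial_simplex i (standard_simplex i) f" by (rule simplicial_simplex_keys[OF c f(1)])
  have "subd i (frag_of f) = chain_map (Suc i) f (subd i (identity_chain i))"
    using chain_homotopic_simplicial_subdivision1[OF simplicial_chain_identity fs] by (simp add: chain_map_identity[OF fs])
  then show thesis using f that keys_chain_map by metis
qed

lemma simplicial_simplex_image: "simplicial_simplex p S a \<Longrightarrow> a ` standard_simplex p \<subseteq> S"
  by (auto simp: simplicial_simplex)

lemma vertex_transverse_subdivision:
  "a \<in> keys (iterated_subdivision i 1) \<Longrightarrow> vertex_transverse i a"
  using vertex_transverse_simplicial_subdivision[OF coordinate_simplex_id, of i i a]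
  by (simp add: iterated_subdivision_def identity_chain_def)

lemma codimension_preserving_identity:
  "a \<in> keys (identity_chain i) \<Longrightarrow> codimension_preserving i i a"
  by (simp add: identity_chain_def codimension_preserving_def)

lemma codimension_preserving_iterated_subdivision:
  "a \<in> keys (iterated_subdivision i m) \<Longrightarrow> codimension_preserving i i a"
proof (induction m arbitrary: a)
  case 0
  then show ?case by (simp add: codimension_preserving_identity)
next
  case (Suc m)
  obtain f b where fb: "f \<in> keys (iterated_subdivision i m)" "b \<in> keys (iterated_subdivision i 1)"
    "a = simplex_map i f b"
    using keys_simplicial_subdivision[OF simplicial_iterated_subdivision Suc.prems[unfolded iterated_subdivision_Suc]] by metis
  have "codimension_preserving i i b"
    using vertex_transverse_subdivision[OF fb(2)] unfolding vertex_transverse_def codimension_preserving_def by fastforce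
  then show ?case
    unfolding fb(3)
    by (intro codimension_preserving_compose[OF Suc.IH[OF fb(1)]] simplicial_simplex_image
        simplicial_simplex_keys[OF simplicial_iterated_subdivision fb(2)])
qed

lemma keys_subd_iterated:
  assumes "y \<in> keys (\<Sum>k\<in>K. subd i (iterated_subdivision i k))"
  obtains k f a where "k \<in> K" "f \<in> keys (iterated_subdivision i k)"
    "a \<in> keys (subd i (identity_chain i))" "y = simplex_map (Suc i) f a"
proof -
  obtain k where "k \<in> K" "y \<in> keys (subd i (iterated_subdivision i k))"
    using subsetD[OF keys_sum assms] by blast
  then show thesis using that keys_subd[OF simplicial_iterated_subdivision] by metis
qed

lemma simplicial_subd_identity: "simplicial_chain (Suc i) (standard_simplex i) (subd i (identity_chain i))"
  by (rule chain_homotopic_simplicial_subdivision2[OF simplicial_chain_identity])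

lemma codimension_preserving_subdivision_homotopy:
  assumes "a \<in> keys (subdivision_homotopy i m)"
  shows "codimension_preserving i (Suc i) a"
proof -
  obtain k f b where fb: "f \<in> keys (iterated_subdivision i k)"
    "b \<in> keys (subd i (identity_chain i))" "a = simplex_map (Suc i) f b"
    using keys_subd_iterated[OF assms[unfolded subdivision_homotopy_def]] by metis
  have "codimension_preserving i (Suc i) b"
    using codimension_preserving_subd[OF coordinate_simplex_id, of i i b] fb(2) by (simp add: identity_chain_def)
  then show ?thesis
    unfolding fb(3)
    by (intro codimension_preserving_compose[OF codimension_preserving_iterated_subdivision[OF fb(1)]]
        simplicial_simplex_image simplicial_simplex_keys[OF simplicial_subd_identity fb(2)])
qed

lemma singular_subdivision_power_identity:
  "(singular_subdivision i ^^ m) (identity_chain i) = iterated_subdivision i m"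
proof (induction m)
  case (Suc m)
  then show ?case
    using singular_subdivision_simplicial_simplex[OF simplicial_iterated_subdivision]
    by (simp add: iterated_subdivision_Suc)
qed simp

text \<open>Lebesgue's lemma for the preimages of the cover.  It is stated for all large \<open>m\<close>, because neighbouring
  simplices may require additional subdivisions.\<close>

lemma sufficient_subdivision_exists:
  assumes \<sigma>: "singular_simplex i X \<sigma>" and U: "\<And>U. U \<in> \<U> \<Longrightarrow> openin X U" "topspace X \<subseteq> \<Union>\<U>"
  shows "\<exists>n. \<forall>m\<ge>n. \<forall>a\<in>keys (iterated_subdivision i m). \<exists>U\<in>\<U>. \<sigma> ` a ` standard_simplex i \<subseteq> U"
proof -
  have cm: "continuous_map (simplex_space i) X \<sigma>" using \<sigma> by (simp add: singular_simplex_def)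
  let ?C = "(\<lambda>U. {t \<in> topspace (simplex_space i). \<sigma> t \<in> U}) ` \<U>"
  have 1: "\<And>V. V \<in> ?C \<Longrightarrow> openin (simplex_space i) V"
    using openin_continuous_map_preimage[OF cm] U(1) by blast
  have 2: "topspace (simplex_space i) \<subseteq> \<Union>?C"
    using continuous_map_image_subset_topspace[OF cm] U(2) by fastforce
  have 3: "singular_chain i (simplex_space i) (identity_chain i)"
    by (rule simplicial_imp_singular_chain) simp
  show ?thesis
  proof (rule sufficient_iterated_singular_subdivision_exists[OF 1 2 3])
    fix n
    assume n: "\<And>m f. n \<le> m \<Longrightarrow> f \<in> keys ((singular_subdivision i ^^ m) (identity_chain i)) \<Longrightarrow>
      \<exists>V\<in>?C. f \<in> standard_simplex i \<rightarrow> V"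
    have "\<exists>U\<in>\<U>. \<sigma> ` a ` standard_simplex i \<subseteq> U" if m: "n \<le> m" and a: "a \<in> keys (iterated_subdivision i m)" for m a
    proof -
      have "a \<in> keys ((singular_subdivision i ^^ m) (identity_chain i))"
        using a by (simp only: singular_subdivision_power_identity)
      from n[OF m this] obtain U where "U \<in> \<U>" "\<forall>t\<in>standard_simplex i. \<sigma> (a t) \<in> U" by (auto simp: Pi_iff)
      then show ?thesis by (intro bexI[of _ U]) auto
    qed
    then show ?thesis by blast
  qed
qed

section \<open>Intersection chains\<close>

definition last_vertex :: "nat \<Rightarrow> nat \<Rightarrow> real" where "last_vertex i = (\<lambda>j. if j = i then 1 else 0)"

lemma last_vertex_in [simp]: "last_vertex i \<in> standard_simplex i"
  unfolding last_vertex_def using basis_in_standard_simplex[of i i] by simp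

lemma last_vertex_face:
  assumes "k < i"
  shows "simplex_map (i - 1) \<sigma> (singular_face i k id) (last_vertex (i - 1)) = \<sigma> (last_vertex i)"
proof -
  have "simplical_face k (last_vertex (i - 1)) = last_vertex i"
    using assms by (intro ext) (auto simp: simplical_face_def last_vertex_def)
  then show ?thesis
    using last_vertex_in[of "i - 1"] by (simp add: simplex_map_def singular_face_def)
qed

lemma allowable_simplex_map:
  assumes \<sigma>: "allowable_simplex q X i \<sigma>" and a: "codimension_preserving i j a" "a ` standard_simplex j \<subseteq> standard_simplex i"
  shows "allowable_simplex q X j (simplex_map j \<sigma> a)"
  unfolding allowable_simplex_def
proof (intro allI impI subsetI)
  fix k :: nat and t assume k: "1 \<le> k" and "t \<in> {t \<in> standard_simplex j. simplex_map j \<sigma> a t \<in> stratum X (int (fdim X) - int k)}"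
  then have t: "t \<in> standard_simplex j" "\<sigma> (a t) \<in> stratum X (int (fdim X) - int k)" by (auto simp: simplex_map_def)
  then have "a t \<in> {t \<in> standard_simplex i. \<sigma> t \<in> stratum X (int (fdim X) - int k)}" using a(2) by blast
  then have "a t \<in> simplex_skeleton i (int i - int k + q k)" using \<sigma> k unfolding allowable_simplex_def by blast
  then have "int (card (support (a t))) \<le> int i - int k + q k + 1" by (simp add: simplex_skeleton_def support_def)
  moreover have "card (support t) + i \<le> card (support (a t)) + j" using a(1) t(1) by (simp add: codimension_preserving_def)
  ultimately have "int (card (support t)) \<le> int j - int k + q k + 1" by linarith
  then show "t \<in> simplex_skeleton j (int j - int k + q k)" using t(1) by (simp add: simplex_skeleton_def support_def)
qed

lemma on_faces_minus: "on_faces i j (- c) = - on_faces i j c"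
proof -
  have "on_faces i j (0 - c) = frag_extend (\<lambda>a. chain_map j a 0 - chain_map j a c) (chain_boundary i (identity_chain i))"
    by (simp add: on_faces_def chain_map_diff del: diff_0)
  then show ?thesis unfolding frag_extend_diff_fun by (simp add: on_faces_def frag_extend_eq_0)
qed

definition allowable_chain :: "(nat \<Rightarrow> int) \<Rightarrow> ('r, 'a, 'g) sheaf \<Rightarrow> 'a filtered \<Rightarrow> nat \<Rightarrow> ('a, 'g) lf_chain \<Rightarrow> bool" where
  "allowable_chain q G X i \<xi> \<longleftrightarrow> (\<forall>\<sigma>\<in>chain_simplices G i \<xi>. allowable_simplex q X i \<sigma>)"

lemma IC_inf_iff:
  "\<xi> \<in> IC_inf q G X i \<longleftrightarrow> \<xi> \<in> lf_chains G (space_of X) i \<and> allowable_chain q G X i \<xi> \<and>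
     allowable_chain q G X (i - 1) (lf_boundary G i \<xi>)"
  by (auto simp: IC_inf_def allowable_chain_def)

context coefficient_sheaf
begin

lemma lf_boundary_lf_chains: "\<xi> \<in> lf_chains G X i \<Longrightarrow> lf_boundary G i \<xi> \<in> lf_chains G X (i - 1)"
  by (simp only: lf_boundary_substitute substitute_lf_chains[OF _ family_boundary])

lemma lf_boundary_of_substitute:
  assumes \<xi>: "\<xi> \<in> lf_chains G X i" and c: "family i j c"
  shows "lf_boundary G j (substitute G i j c \<xi>) = substitute G i (j - 1) (\<lambda>\<sigma>. chain_boundary j (c \<sigma>)) \<xi>"
proof -
  have "family_compose j (j - 1) c (\<lambda>\<sigma>. chain_boundary j (identity_chain j)) \<sigma> = chain_boundary j (c \<sigma>)" for \<sigma>
  proof -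
    have "chain_map (j - 1) a (chain_boundary j (identity_chain j)) = chain_boundary j (frag_of a)"
      if a: "a \<in> keys (c \<sigma>)" for a
    proof -
      have "chain_boundary j (chain_map j a (identity_chain j)) = chain_map (j - 1) a (chain_boundary j (identity_chain j))"
        using chain_boundary_chain_map[OF simplicial_imp_singular_chain[OF simplicial_chain_identity]] by simp
      then show ?thesis
        using singular_simplex_chain_map_id[OF familyD[OF c, OF a]] by (simp add: identity_chain_def)
    qed
    then have "family_compose j (j - 1) c (\<lambda>\<sigma>. chain_boundary j (identity_chain j)) \<sigma>
        = frag_extend (\<lambda>a. chain_boundary j (frag_of a)) (c \<sigma>)"
      unfolding family_compose_def by (rule frag_extend_eq)
    also have "\<dots> = chain_boundary j (c \<sigma>)"
      by (rule linear_frag_extend[symmetric]) (simp_all add: chain_boundary_diff)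
    finally show ?thesis .
  qed
  then have "family_compose j (j - 1) c (\<lambda>\<sigma>. chain_boundary j (identity_chain j)) = (\<lambda>\<sigma>. chain_boundary j (c \<sigma>))" by blast
  then show ?thesis
    unfolding lf_boundary_substitute[OF substitute_lf_chains[OF \<xi> c]] substitute_substitute[OF \<xi> c family_boundary]
    by simp
qed

lemma substitute_of_lf_boundary:
  assumes \<xi>: "\<xi> \<in> lf_chains G X i" and c: "family (i - 1) j c"
  shows "substitute G (i - 1) j c (lf_boundary G i \<xi>)
    = substitute G i j (\<lambda>\<sigma>. frag_extend (\<lambda>a. chain_map j a (c (simplex_map (i - 1) \<sigma> a))) (chain_boundary i (identity_chain i))) \<xi>"
  unfolding lf_boundary_substitute[OF \<xi>] substitute_substitute[OF \<xi> family_boundary c] family_compose_def ..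

lemma substitute_zero_family: "substitute G i j (\<lambda>\<sigma>. 0) \<xi> = zero_coefficient G j"
  unfolding substitute_def sources_def zero_coefficient_def
  by (intro ext) (auto simp: combination_0[OF lift_stalk])

lemma lf_boundary_lf_boundary:
  assumes \<xi>: "\<xi> \<in> lf_chains G X i"
  shows "lf_boundary G (i - 1) (lf_boundary G i \<xi>) = zero_coefficient G (i - 1 - 1)"
proof -
  have "chain_boundary (i - 1) (chain_boundary i (identity_chain i)) = 0"
    using chain_boundary_boundary[OF simplicial_imp_singular_chain[OF simplicial_chain_identity]] by simp
  then show ?thesis
    unfolding lf_boundary_substitute[OF \<xi>] lf_boundary_of_substitute[OF \<xi> family_boundary]
    by (simp add: substitute_zero_family)
qed

lemma lf_boundary_add:
  assumes "\<xi> \<in> lf_chains G X i" "\<eta> \<in> lf_chains G X i"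
  shows "lf_boundary G i (\<xi> \<oplus>\<^bsub>raw_module G i\<^esub> \<eta>) = lf_boundary G i \<xi> \<oplus>\<^bsub>raw_module G (i - 1)\<^esub> lf_boundary G i \<eta>"
  using substitute_add_chain[OF assms family_boundary] lf_chains_add[OF assms] assms
  by (simp only: lf_boundary_substitute)

lemma lf_boundary_smult:
  assumes "\<xi> \<in> lf_chains G X i" "r \<in> carrier R"
  shows "lf_boundary G i (r \<odot>\<^bsub>raw_module G i\<^esub> \<xi>) = r \<odot>\<^bsub>raw_module G (i - 1)\<^esub> lf_boundary G i \<xi>"
  using substitute_smult[OF assms(1) family_boundary assms(2)] lf_chains_smult[OF assms(2,1)] assms
  by (simp only: lf_boundary_substitute)

lemma allowable_chain_add:
  "allowable_chain q G X i \<xi> \<Longrightarrow> allowable_chain q G X i \<eta> \<Longrightarrow> allowable_chain q G X i (\<xi> \<oplus>\<^bsub>raw_module G i\<^esub> \<eta>)"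
  using chain_simplices_add[of i "raw_chains G i" \<xi> \<eta>] by (auto simp: allowable_chain_def)

lemma allowable_chain_substitute:
  assumes c: "\<And>\<sigma> a. \<sigma> \<in> chain_simplices G i \<xi> \<Longrightarrow> a \<in> keys (c \<sigma>) \<Longrightarrow> allowable_simplex q X j (simplex_map j \<sigma> a)"
  shows "allowable_chain q G X j (substitute G i j c \<xi>)"
  unfolding allowable_chain_def
proof
  fix \<tau> assume \<tau>: "\<tau> \<in> chain_simplices G j (substitute G i j c \<xi>)"
  obtain \<sigma> a where "\<sigma> \<in> chain_simplices G i \<xi>" "a \<in> keys (c \<sigma>)" "\<tau> = simplex_map j \<sigma> a"
    using chain_simplices_substitute[OF \<tau>] by metis
  then show "allowable_simplex q X j \<tau>" using c by simp
qed

lemma allowable_chain_substitute_preserving: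
  assumes \<xi>: "allowable_chain q G X i \<xi>" and s: "\<And>\<sigma>. simplicial_chain j (standard_simplex i) (c \<sigma>)"
    and c: "\<And>\<sigma> a. a \<in> keys (c \<sigma>) \<Longrightarrow> codimension_preserving i j a"
  shows "allowable_chain q G X j (substitute G i j c \<xi>)"
proof (rule allowable_chain_substitute)
  fix \<sigma> a assume \<sigma>: "\<sigma> \<in> chain_simplices G i \<xi>" and a: "a \<in> keys (c \<sigma>)"
  show "allowable_simplex q X j (simplex_map j \<sigma> a)"
    by (rule allowable_simplex_map[OF _ c[OF a] simplicial_simplex_image[OF simplicial_simplex_keys[OF s a]]])
      (use \<xi> \<sigma> in \<open>simp add: allowable_chain_def\<close>)
qed

text \<open>Let every simplex \<open>\<sigma>\<close> of \<open>\<zeta>\<close> be replaced by \<open>K i b\<close>, where \<open>b\<close> depends only on the last vertex of \<open>\<sigma>\<close>.  The boundary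
  of \<open>K i b\<close> is an inner part \<open>L i b\<close> and copies of \<open>K' (i - 1) b\<close> on the faces.  The last vertex of \<open>\<sigma>\<close> is also
  the last vertex of all faces but the one opposite to it.  So the copies on these faces are determined by the
  faces alone, and together they are the result of substituting \<open>K'\<close> in \<open>\<partial>\<zeta>\<close>, whose simplices are allowable.  The
  error \<open>?e\<close> is concentrated on the opposite face.  By the last hypothesis this face is allowable, or its last vertex
  gives the same \<open>b\<close> and there is no error.

  The dimension shift \<open>d\<close> is \<open>0\<close> for subdivision and restriction and \<open>1\<close> for homotopies.\<close>

lemma vertexwise_IC:
  fixes K K' L :: "nat \<Rightarrow> 'b \<Rightarrow> (nat \<Rightarrow> real) chain" and f :: "'a \<Rightarrow> 'b"
  assumes \<zeta>: "\<zeta> \<in> IC_inf q G X i"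
    and K: "\<And>i b. simplicial_chain (i + d) (standard_simplex i) (K i b)"
      "\<And>i b a. a \<in> keys (K i b) \<Longrightarrow> codimension_preserving i (i + d) a"
    and K': "\<And>i b. simplicial_chain (i + d) (standard_simplex i) (K' i b)"
      "\<And>i b a. a \<in> keys (K' i b) \<Longrightarrow> codimension_preserving i (i + d) a"
    and L: "\<And>i b. simplicial_chain (i + d - 1) (standard_simplex i) (L i b)"
      "\<And>i b a. a \<in> keys (L i b) \<Longrightarrow> codimension_preserving i (i + d - 1) a"
    and eq: "\<And>i b. chain_boundary (i + d) (K i b) = L i b + on_faces i (i + d - 1) (K' (i - 1) b)"
    and face: "\<And>\<sigma>. \<sigma> \<in> chain_simplices G i \<zeta> \<Longrightarrow> i \<noteq> 0 \<Longrightarrow> allowable_simplex q X (i - 1) (singular_face i i \<sigma>) \<or>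
       f (singular_face i i \<sigma> (last_vertex (i - 1))) = f (\<sigma> (last_vertex i))"
  shows "substitute G i (i + d) (\<lambda>\<sigma>. K i (f (\<sigma> (last_vertex i)))) \<zeta> \<in> IC_inf q G X (i + d)"
proof -
  have lf: "\<zeta> \<in> lf_chains G (space_of X) i" and al: "allowable_chain q G X i \<zeta>"
    and dal: "allowable_chain q G X (i - 1) (lf_boundary G i \<zeta>)"
    using \<zeta> by (simp_all add: IC_inf_iff)
  let ?c = "\<lambda>\<sigma>. K i (f (\<sigma> (last_vertex i)))"
  have c: "family i (i + d) ?c" by (intro family_simplicial K(1))
  have fL: "family i (i + d - 1) (\<lambda>\<sigma>. L i (f (\<sigma> (last_vertex i))))" by (intro family_simplicial L(1))
  have aL: "allowable_chain q G X (i + d - 1) (substitute G i (i + d - 1) (\<lambda>\<sigma>. L i (f (\<sigma> (last_vertex i)))) \<zeta>)"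
    by (rule allowable_chain_substitute_preserving[OF al L(1) L(2)])
  have "allowable_chain q G X (i + d - 1) (lf_boundary G (i + d) (substitute G i (i + d) ?c \<zeta>))"
  proof (cases "i = 0")
    case True
    have "chain_boundary (i + d) (?c \<sigma>) = L i (f (\<sigma> (last_vertex i)))" for \<sigma>
      using eq[of i "f (\<sigma> (last_vertex i))"] True by (simp add: on_faces_def chain_boundary_identity)
    then show ?thesis unfolding lf_boundary_of_substitute[OF lf c] using aL by simp
  next
    case False
    then have dim: "i - 1 + d = i + d - 1" by simp
    let ?B = "chain_boundary i (identity_chain i)"
    let ?c' = "\<lambda>\<sigma>. K' (i - 1) (f (\<sigma> (last_vertex (i - 1))))"
    \<comment> \<open>\<open>?comp\<close> computes the substitution of \<open>K'\<close> in the boundary; it uses the value of \<open>f\<close> at the last vertex of each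
      face instead of that at the last vertex of \<open>\<sigma>\<close>.\<close>
    let ?comp = "\<lambda>\<sigma>. frag_extend (\<lambda>a. chain_map (i + d - 1) a (?c' (simplex_map (i - 1) \<sigma> a))) ?B"
    let ?e = "\<lambda>\<sigma>. frag_extend (\<lambda>a. chain_map (i + d - 1) a
        (K' (i - 1) (f (\<sigma> (last_vertex i))) - ?c' (simplex_map (i - 1) \<sigma> a))) ?B"
    have c': "family (i - 1) (i + d - 1) ?c'" using K'(1)[of "i - 1"] dim by (intro family_simplicial) simp
    have fc: "family i (i + d - 1) ?comp"
      using family_family_compose[OF family_boundary c'] by (simp only: family_compose_def[abs_def])
    have keys_e: "\<exists>b. e = simplex_map (i + d - 1) (singular_face i i id) b \<and>
        simplicial_simplex (i + d - 1) (standard_simplex (i - 1)) b \<and> codimension_preserving (i - 1) (i + d - 1) b \<and>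
        f (singular_face i i \<sigma> (last_vertex (i - 1))) \<noteq> f (\<sigma> (last_vertex i))"
      if e: "e \<in> keys (?e \<sigma>)" for e \<sigma>
    proof -
      obtain a where a: "a \<in> keys ?B" "e \<in> keys (chain_map (i + d - 1) a
        (K' (i - 1) (f (\<sigma> (last_vertex i))) - ?c' (simplex_map (i - 1) \<sigma> a)))"
        using subsetD[OF keys_frag_extend e] by blast
      obtain k where k: "k \<le> i" "a = singular_face i k id" using keys_boundary_identity[OF a(1)] by metis
      have "k = i"
      proof (rule ccontr)
        assume "k \<noteq> i"
        then have "simplex_map (i - 1) \<sigma> a (last_vertex (i - 1)) = \<sigma> (last_vertex i)"
          unfolding k(2) using k(1) by (intro last_vertex_face) simp
        then show False using a(2) by simp
      qed
      have sf: "simplex_map (i - 1) \<sigma> a = singular_face i i \<sigma>"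
        unfolding k(2) \<open>k = i\<close> using False by (intro simplex_map_face) auto
      obtain b where b: "b \<in> keys (K' (i - 1) (f (\<sigma> (last_vertex i))) - ?c' (singular_face i i \<sigma>))"
        "e = simplex_map (i + d - 1) a b"
        using keys_chain_map[OF a(2)] unfolding sf by metis
      have "f (singular_face i i \<sigma> (last_vertex (i - 1))) \<noteq> f (\<sigma> (last_vertex i))" using b(1) by auto
      moreover have "b \<in> keys (K' (i - 1) (f (\<sigma> (last_vertex i)))) \<union> keys (?c' (singular_face i i \<sigma>))"
        using subsetD[OF keys_diff b(1)] .
      then have "simplicial_simplex (i + d - 1) (standard_simplex (i - 1)) b \<and> codimension_preserving (i - 1) (i + d - 1) b"
        using simplicial_simplex_keys[OF K'(1)] K'(2) dim by (metis Un_iff)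
      ultimately show ?thesis using b(2) k(2) \<open>k = i\<close> by blast
    qed
    have face_simplex: "simplicial_simplex (i - 1) (standard_simplex i) (singular_face i i id)"
      using simplicial_simplex_singular_face[of i "standard_simplex i" "restrict id (standard_simplex i)" i] False by simp
    have fe: "family i (i + d - 1) ?e"
      unfolding family_def singular_chain_def
    proof (intro allI subsetI CollectI)
      fix \<sigma> e assume "e \<in> keys (?e \<sigma>)"
      then obtain b where b: "e = simplex_map (i + d - 1) (singular_face i i id) b"
        "simplicial_simplex (i + d - 1) (standard_simplex (i - 1)) b" using keys_e by blast
      have "simplicial_chain (i + d - 1) (standard_simplex i) (chain_map (i + d - 1) (singular_face i i id) (frag_of b))"
        by (rule simplicial_chain_chain_map[OF face_simplex]) (simp only: simplicial_chain_of b(2))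
      then show "singular_simplex (i + d - 1) (simplex_space i) e"
        unfolding b(1) chain_map_of simplicial_chain_of by (rule simplicial_imp_singular_simplex)
    qed
    have ae: "allowable_chain q G X (i + d - 1) (substitute G i (i + d - 1) ?e \<zeta>)"
    proof (rule allowable_chain_substitute)
      fix \<sigma> e assume \<sigma>: "\<sigma> \<in> chain_simplices G i \<zeta>" and "e \<in> keys (?e \<sigma>)"
      then obtain b where b: "e = simplex_map (i + d - 1) (singular_face i i id) b"
        "simplicial_simplex (i + d - 1) (standard_simplex (i - 1)) b" "codimension_preserving (i - 1) (i + d - 1) b"
        "f (singular_face i i \<sigma> (last_vertex (i - 1))) \<noteq> f (\<sigma> (last_vertex i))" using keys_e by blast
      then have "allowable_simplex q X (i - 1) (singular_face i i \<sigma>)" using face[OF \<sigma> False] by simp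
      then have "allowable_simplex q X (i + d - 1) (simplex_map (i + d - 1) (singular_face i i \<sigma>) b)"
        by (rule allowable_simplex_map[OF _ b(3) simplicial_simplex_image[OF b(2)]])
      moreover have "simplex_map (i + d - 1) (singular_face i i \<sigma>) b = simplex_map (i + d - 1) \<sigma> e"
      proof -
        have "singular_face i i \<sigma> = simplex_map (i - 1) \<sigma> (singular_face i i id)"
          using simplex_map_face[of i i \<sigma>] False by simp
        then show ?thesis unfolding b(1) using simplex_map_simplex_map[OF simplicial_simplex_image[OF b(2)]] by simp
      qed
      ultimately show "allowable_simplex q X (i + d - 1) (simplex_map (i + d - 1) \<sigma> e)" by simp
    qed
    have acomp: "allowable_chain q G X (i + d - 1) (substitute G i (i + d - 1) ?comp \<zeta>)"
      unfolding substitute_of_lf_boundary[OF lf c', symmetric]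
      by (rule allowable_chain_substitute_preserving[OF dal]) (use K'(1)[of "i - 1"] K'(2)[of _ "i - 1"] dim in simp_all)
    have "chain_boundary (i + d) (?c \<sigma>) = L i (f (\<sigma> (last_vertex i))) + (?comp \<sigma> + ?e \<sigma>)" for \<sigma>
    proof -
      have "?comp \<sigma> + ?e \<sigma> = on_faces i (i + d - 1) (K' (i - 1) (f (\<sigma> (last_vertex i))))"
        by (simp add: on_faces_def frag_extend_add_fun[symmetric] chain_map_diff)
      then show ?thesis by (simp add: eq)
    qed
    then have "lf_boundary G (i + d) (substitute G i (i + d) ?c \<zeta>)
        = substitute G i (i + d - 1) (\<lambda>\<sigma>. L i (f (\<sigma> (last_vertex i))) + (?comp \<sigma> + ?e \<sigma>)) \<zeta>"
      unfolding lf_boundary_of_substitute[OF lf c] by simp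
    also have "\<dots> = substitute G i (i + d - 1) (\<lambda>\<sigma>. L i (f (\<sigma> (last_vertex i)))) \<zeta> \<oplus>\<^bsub>raw_module G (i + d - 1)\<^esub>
        (substitute G i (i + d - 1) ?comp \<zeta> \<oplus>\<^bsub>raw_module G (i + d - 1)\<^esub> substitute G i (i + d - 1) ?e \<zeta>)"
      by (simp only: substitute_add_family[OF lf fL family_add[OF fc fe]] substitute_add_family[OF lf fc fe])
    finally show ?thesis
      using allowable_chain_add[OF aL allowable_chain_add[OF acomp ae]] by (simp only:)
  qed
  then show ?thesis
    using substitute_lf_chains[OF lf c] allowable_chain_substitute_preserving[OF al K(1) K(2)] by (simp add: IC_inf_iff)
qed

end

section \<open>Subdivision and restriction of intersection chains\<close>

definition last_face_allowable :: "(nat \<Rightarrow> int) \<Rightarrow> ('r, 'a, 'g) sheaf \<Rightarrow> 'a filtered \<Rightarrow> nat \<Rightarrow> ('a, 'g) lf_chain \<Rightarrow> bool" where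
  "last_face_allowable q G X i \<xi> \<longleftrightarrow>
     (\<forall>\<sigma>\<in>chain_simplices G i \<xi>. i \<noteq> 0 \<longrightarrow> allowable_simplex q X (i - 1) (singular_face i i \<sigma>))"

definition subdivide :: "('r, 'a, 'g) sheaf \<Rightarrow> nat \<Rightarrow> ('a, 'g) lf_chain \<Rightarrow> ('a, 'g) lf_chain" where
  "subdivide G i = substitute G i i (\<lambda>\<sigma>. iterated_subdivision i 1)"

definition homotopy_family :: "nat \<Rightarrow> ('a \<Rightarrow> nat) \<Rightarrow> 'a sing \<Rightarrow> (nat \<Rightarrow> real) chain" where
  "homotopy_family i M \<sigma> = subdivision_homotopy i (M (\<sigma> (last_vertex i)))"

definition restriction_family :: "nat \<Rightarrow> 'a set \<Rightarrow> 'a sing \<Rightarrow> (nat \<Rightarrow> real) chain" where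
  "restriction_family i V \<sigma> = (if \<sigma> (last_vertex i) \<in> V then identity_chain i else 0)"

text \<open>The pieces that are left if simplices are subdivided \<open>M\<close> times and the homotopy on the boundary is
  taken up to depth \<open>M'\<close> only: on each face there remains the part of the homotopy between the depths \<open>M'\<close> and \<open>M\<close>.\<close>

definition small_family :: "nat \<Rightarrow> ('a \<Rightarrow> nat) \<Rightarrow> ('a \<Rightarrow> nat) \<Rightarrow> 'a sing \<Rightarrow> (nat \<Rightarrow> real) chain" where
  "small_family i M M' \<sigma> = iterated_subdivision i (M (\<sigma> (last_vertex i))) -
     frag_extend (\<lambda>a. chain_map i a (subdivision_homotopy (i - 1) (M (\<sigma> (last_vertex i))) -
        homotopy_family (i - 1) M' (simplex_map (i - 1) \<sigma> a))) (chain_boundary i (identity_chain i))"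

text \<open>A point is its own subdivision and the homotopy vanishes.  This makes statements about the homotopy in
  degree \<open>i - 1\<close> meaningful for \<open>i = 0\<close>, where \<open>i - 1 = 0\<close> on natural numbers.\<close>

lemma subdivision_homotopy_degree_0 [simp]: "subdivision_homotopy 0 m = 0"
  by (simp add: subdivision_homotopy_def)

lemma family_subdivide: "family i i (\<lambda>\<sigma>. iterated_subdivision i 1)"
  by (intro family_simplicial simplicial_iterated_subdivision)

lemma family_homotopy: "family i (Suc i) (homotopy_family i M)"
  unfolding homotopy_family_def by (intro family_simplicial simplicial_subdivision_homotopy)

lemma family_homotopy_faces: "family (i - 1) i (homotopy_family (i - 1) M)"
proof (cases "i = 0")
  case True
  then show ?thesis by (auto simp: homotopy_family_def intro!: family_simplicial)
next
  case False
  then show ?thesis using family_homotopy[of "i - 1" M] by simp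
qed

lemma family_restriction: "family i i (restriction_family i V)"
  by (intro family_simplicial) (simp add: restriction_family_def)

lemma boundary_identity_on_faces: "chain_boundary i (identity_chain i) = on_faces i (i - 1) (identity_chain (i - 1))"
  using boundary_iterated_subdivision[of i 0] by simp

lemma on_faces_0 [simp]: "on_faces i j 0 = 0"
  by (simp add: on_faces_def frag_extend_eq_0)

text \<open>The dimension lost by passing to the opposite face is gained back by transversality.\<close>

lemma last_face_codimension_preserving:
  assumes a: "vertex_transverse i a" and i: "i \<noteq> 0"
  shows "codimension_preserving i (i - 1) (singular_face i i a)"
  unfolding codimension_preserving_def
proof
  fix t assume t: "t \<in> standard_simplex (i - 1)"
  then have t0: "t l = 0" if "i \<le> l" for l using that i by (simp add: standard_simplex_def)
  have s: "simplical_face i t = t"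
    using t0 by (intro ext) (simp add: simplical_face_def)
  have "t \<in> standard_simplex i" using t standard_simplex_mono[of "i - 1" i] by auto
  then have "card (support t) + 1 \<le> card (support (a t))" using a t0 unfolding vertex_transverse_def by fastforce
  then show "card (support t) + i \<le> card (support (singular_face i i a t)) + (i - 1)"
    using t s i by (simp add: singular_face_def)
qed

context coefficient_sheaf
begin

lemma subdivide_IC:
  assumes "\<xi> \<in> IC_inf q G X i"
  shows "subdivide G i \<xi> \<in> IC_inf q G X i"
  using vertexwise_IC[OF assms, where d = 0 and f = "\<lambda>_. ()" and K = "\<lambda>i _. iterated_subdivision i 1"
      and K' = "\<lambda>i _. iterated_subdivision i 1" and L = "\<lambda>_ _. 0"]
  by (simp add: subdivide_def simplicial_iterated_subdivision[of _ 1, simplified] codimension_preserving_iterated_subdivision[of _ _ 1, simplified]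
      boundary_iterated_subdivision[of _ 1, simplified])

text \<open>After one subdivision the hypothesis of \<open>vertexwise_IC\<close> on opposite faces holds for all functions of the
  last vertex.\<close>

lemma subdivide_last_face:
  assumes \<xi>: "\<xi> \<in> IC_inf q G X i"
  shows "last_face_allowable q G X i (subdivide G i \<xi>)"
  unfolding last_face_allowable_def
proof (intro ballI impI)
  fix \<tau> assume \<tau>: "\<tau> \<in> chain_simplices G i (subdivide G i \<xi>)" and i: "i \<noteq> 0"
  obtain \<sigma> a where sa: "\<sigma> \<in> chain_simplices G i \<xi>" "a \<in> keys (iterated_subdivision i 1)" "\<tau> = simplex_map i \<sigma> a"
    using chain_simplices_substitute[OF \<tau>[unfolded subdivide_def]] by metis
  have as: "simplicial_simplex i (standard_simplex i) a" by (rule simplicial_simplex_keys[OF simplicial_iterated_subdivision sa(2)])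
  have "simplicial_simplex (i - 1) (standard_simplex i) (singular_face i i a)"
    using simplicial_simplex_singular_face[OF as, of i] i by simp
  then have im: "singular_face i i a ` standard_simplex (i - 1) \<subseteq> standard_simplex i" by (rule simplicial_simplex_image)
  have "allowable_simplex q X i \<sigma>" using \<xi> sa(1) by (simp add: IC_inf_iff allowable_chain_def)
  then have "allowable_simplex q X (i - 1) (simplex_map (i - 1) \<sigma> (singular_face i i a))"
    by (rule allowable_simplex_map[OF _ last_face_codimension_preserving[OF vertex_transverse_subdivision[OF sa(2)] i] im])
  moreover have "singular_face i i \<tau> = simplex_map (i - 1) \<sigma> (singular_face i i a)"
    unfolding sa(3) using i simplical_face_in_standard_simplex[of i i]
    by (auto simp: singular_face_def simplex_map_def)
  ultimately show "allowable_simplex q X (i - 1) (singular_face i i \<tau>)" by simp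
qed

text \<open>Varying depths require a previous subdivision.  A constant depth is the same on all faces, and is what
  compares a chain with its first subdivision.\<close>

lemma homotopy_IC:
  assumes \<xi>: "\<xi> \<in> IC_inf q G X i"
    and M: "last_face_allowable q G X i \<xi> \<or> (\<forall>x y. M x = M y)"
  shows "substitute G i (Suc i) (homotopy_family i M) \<xi> \<in> IC_inf q G X (Suc i)"
proof -
  have "substitute G i (i + 1) (\<lambda>\<sigma>. subdivision_homotopy i (M (\<sigma> (last_vertex i)))) \<xi> \<in> IC_inf q G X (i + 1)"
  proof (rule vertexwise_IC[OF \<xi>, where K' = "\<lambda>i m. - subdivision_homotopy i m"
        and L = "\<lambda>i m. iterated_subdivision i m - identity_chain i"])
    fix i b a
    show "simplicial_chain (i + 1) (standard_simplex i) (subdivision_homotopy i b)"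
      using simplicial_subdivision_homotopy by simp
    show "simplicial_chain (i + 1) (standard_simplex i) (- subdivision_homotopy i b)"
      using simplicial_subdivision_homotopy[of i b] by (simp add: simplicial_chain_def)
    show "codimension_preserving i (i + 1) a" if "a \<in> keys (subdivision_homotopy i b)"
      using codimension_preserving_subdivision_homotopy[OF that] by simp
    show "codimension_preserving i (i + 1) a" if "a \<in> keys (- subdivision_homotopy i b)"
      using codimension_preserving_subdivision_homotopy[of a i b] that by simp
    show "simplicial_chain (i + 1 - 1) (standard_simplex i) (iterated_subdivision i b - identity_chain i)"
      using simplicial_iterated_subdivision[of i b] by (simp add: simplicial_chain_diff)
    show "codimension_preserving i (i + 1 - 1) a" if "a \<in> keys (iterated_subdivision i b - identity_chain i)"
      using codimension_preserving_iterated_subdivision[of a i b] codimension_preserving_identity[of a i] subsetD[OF keys_diff that] by auto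
    show "chain_boundary (i + 1) (subdivision_homotopy i b)
        = iterated_subdivision i b - identity_chain i + on_faces i (i + 1 - 1) (- subdivision_homotopy (i - 1) b)"
      using boundary_subdivision_homotopy[of i b] by (simp add: on_faces_minus algebra_simps)
  next
    fix \<sigma> assume "\<sigma> \<in> chain_simplices G i \<xi>" "i \<noteq> 0"
    then show "allowable_simplex q X (i - 1) (singular_face i i \<sigma>) \<or>
        M (singular_face i i \<sigma> (last_vertex (i - 1))) = M (\<sigma> (last_vertex i))"
      using M by (auto simp: last_face_allowable_def)
  qed
  then show ?thesis by (simp add: homotopy_family_def[abs_def])
qed

text \<open>Simplices with a common face that contains their last vertices are kept or dropped together.  This is the
  operation that cuts a chain into parts.\<close>

lemma restriction_IC:
  assumes \<xi>: "\<xi> \<in> IC_inf q G X i" and face: "last_face_allowable q G X i \<xi>"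
  shows "substitute G i i (restriction_family i V) \<xi> \<in> IC_inf q G X i"
proof -
  let ?K = "\<lambda>i b. if b then identity_chain i else 0"
  have "substitute G i (i + 0) (\<lambda>\<sigma>. ?K i (\<sigma> (last_vertex i) \<in> V)) \<xi> \<in> IC_inf q G X (i + 0)"
  proof (rule vertexwise_IC[OF \<xi>, where K' = ?K and K = ?K and L = "\<lambda>i m. 0"])
    fix i :: nat and b :: bool and a
    show "chain_boundary (i + 0) (?K i b) = 0 + on_faces i (i + 0 - 1) (?K (i - 1) b)"
      using boundary_identity_on_faces[of i] by simp
  next
    fix \<sigma> assume "\<sigma> \<in> chain_simplices G i \<xi>" "i \<noteq> 0"
    then show "allowable_simplex q X (i - 1) (singular_face i i \<sigma>) \<or>
        (singular_face i i \<sigma> (last_vertex (i - 1)) \<in> V) = (\<sigma> (last_vertex i) \<in> V)"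
      using face by (auto simp: last_face_allowable_def)
  qed (auto simp: codimension_preserving_identity split: if_splits)
  then show ?thesis by (simp add: restriction_family_def[abs_def])
qed

text \<open>The depth \<open>M'\<close> on the boundary is a function of the last vertex of the face, so that it agrees for all simplices
  with that face, but it is unrelated to \<open>M\<close>.  The resulting correction is part of \<open>small_family\<close>.\<close>

lemma homotopy_formula:
  assumes \<xi>: "\<xi> \<in> lf_chains G X i"
  shows "lf_boundary G (Suc i) (substitute G i (Suc i) (homotopy_family i M) \<xi>) \<oplus>\<^bsub>raw_module G i\<^esub>
      (\<xi> \<oplus>\<^bsub>raw_module G i\<^esub> substitute G (i - 1) i (homotopy_family (i - 1) M') (lf_boundary G i \<xi>))
    = substitute G i i (small_family i M M') \<xi>"
proof -
  let ?B = "chain_boundary i (identity_chain i)"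
  let ?d = "\<lambda>\<sigma>. chain_boundary (Suc i) (homotopy_family i M \<sigma>)"
  let ?comp = "\<lambda>\<sigma>. frag_extend (\<lambda>a. chain_map i a (homotopy_family (i - 1) M' (simplex_map (i - 1) \<sigma> a))) ?B"
  have fd: "family i i ?d"
    using family_homotopy[of i M] singular_chain_boundary_alt unfolding family_def by blast
  have fc: "family i i ?comp"
    using family_family_compose[OF family_boundary family_homotopy_faces] by (simp only: family_compose_def[abs_def])
  have fi: "family i i (\<lambda>\<sigma>. identity_chain i)" by (intro family_simplicial) simp
  have "?d \<sigma> + (identity_chain i + ?comp \<sigma>) = small_family i M M' \<sigma>" for \<sigma>
  proof -
    have s: "small_family i M M' \<sigma> = iterated_subdivision i (M (\<sigma> (last_vertex i)))
        - on_faces i i (subdivision_homotopy (i - 1) (M (\<sigma> (last_vertex i)))) + ?comp \<sigma>"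
      unfolding small_family_def on_faces_def chain_map_diff frag_extend_diff_fun by simp
    show ?thesis
      unfolding s boundary_subdivision_homotopy[symmetric] by (simp add: homotopy_family_def)
  qed
  then have "substitute G i i (small_family i M M') \<xi> = substitute G i i (\<lambda>\<sigma>. ?d \<sigma> + (identity_chain i + ?comp \<sigma>)) \<xi>"
    by simp
  also have "\<dots> = substitute G i i ?d \<xi> \<oplus>\<^bsub>raw_module G i\<^esub> (substitute G i i (\<lambda>\<sigma>. identity_chain i) \<xi> \<oplus>\<^bsub>raw_module G i\<^esub> substitute G i i ?comp \<xi>)"
    by (simp only: substitute_add_family[OF \<xi> fd family_add[OF fi fc]] substitute_add_family[OF \<xi> fi fc])
  finally show ?thesis
    unfolding lf_boundary_of_substitute[OF \<xi> family_homotopy] substitute_of_lf_boundary[OF \<xi> family_homotopy_faces]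
      substitute_identity[OF \<xi>] by simp
qed

lemma small_family_constant: "small_family i (\<lambda>_. m) (\<lambda>_. m) = (\<lambda>\<sigma>. iterated_subdivision i m)"
  by (intro ext) (simp add: small_family_def homotopy_family_def frag_extend_eq_0)

lemma lf_boundary_subdivide:
  assumes \<xi>: "\<xi> \<in> lf_chains G X i"
  shows "lf_boundary G i (subdivide G i \<xi>) = subdivide G (i - 1) (lf_boundary G i \<xi>)"
  unfolding subdivide_def lf_boundary_of_substitute[OF \<xi> family_subdivide] substitute_of_lf_boundary[OF \<xi> family_subdivide]
    boundary_iterated_subdivision on_faces_def ..

end

section \<open>Chains with fibrewise compact support\<close>

lemma compactin_meets_finitely_many:
  assumes K: "compactin X K" and fin: "\<And>x. x \<in> topspace X \<Longrightarrow> \<exists>U. openin X U \<and> x \<in> U \<and> finite {i \<in> I. S i \<inter> U \<noteq> {}}"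
  shows "finite {i \<in> I. S i \<inter> K \<noteq> {}}"
proof -
  let ?U = "{U. openin X U \<and> finite {i \<in> I. S i \<inter> U \<noteq> {}}}"
  have "K \<subseteq> \<Union>?U" using compactin_subset_topspace[OF K] fin by blast
  then obtain \<F> where \<F>: "finite \<F>" "\<F> \<subseteq> ?U" "K \<subseteq> \<Union>\<F>"
    using K unfolding compactin_def by (metis (no_types, lifting) mem_Collect_eq)
  have "{i \<in> I. S i \<inter> K \<noteq> {}} \<subseteq> (\<Union>U\<in>\<F>. {i \<in> I. S i \<inter> U \<noteq> {}})" using \<F>(3) by blast
  moreover have "finite (\<Union>U\<in>\<F>. {i \<in> I. S i \<inter> U \<noteq> {}})" using \<F>(1,2) by auto
  ultimately show ?thesis by (rule finite_subset)
qed

lemma locally_finite_precompact_cover: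
  assumes par: "paracompact_space Y" and lc: "locally_compact_space Y"
  obtains \<V> where "\<And>V. V \<in> \<V> \<Longrightarrow> openin Y V" "\<Union>\<V> = topspace Y" "locally_finite_in Y \<V>"
    "\<And>V. V \<in> \<V> \<Longrightarrow> \<exists>K. compactin Y K \<and> V \<subseteq> K"
proof -
  define \<U> where "\<U> = {U. openin Y U \<and> (\<exists>K. compactin Y K \<and> U \<subseteq> K)}"
  have "\<Union>\<U> = topspace Y"
  proof
    show "\<Union>\<U> \<subseteq> topspace Y" using openin_subset by (auto simp: \<U>_def)
    show "topspace Y \<subseteq> \<Union>\<U>" using lc unfolding locally_compact_space_def \<U>_def by blast
  qed
  moreover have "\<forall>U\<in>\<U>. openin Y U" by (simp add: \<U>_def)
  ultimately obtain \<V> where \<V>: "\<forall>V\<in>\<V>. openin Y V \<and> (\<exists>U\<in>\<U>. V \<subseteq> U)" "\<Union>\<V> = topspace Y" "locally_finite_in Y \<V>"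
    using par unfolding paracompact_space_def by metis
  have "\<exists>K. compactin Y K \<and> V \<subseteq> K" if V: "V \<in> \<V>" for V
  proof -
    obtain U where U: "U \<in> \<U>" "V \<subseteq> U" using \<V>(1) V by blast
    then obtain K where "compactin Y K" "U \<subseteq> K" by (auto simp: \<U>_def)
    then show ?thesis using U(2) by blast
  qed
  then show thesis using that \<V> by blast
qed

locale fibred_pair = coefficient_sheaf R G
  for R :: "'r ring" and G :: "('r, 'a, 'g) sheaf" +
  fixes q :: "nat \<Rightarrow> int" and E :: "'a filtered" and A :: "'a set" and Y :: "'y topology" and p :: "'a \<Rightarrow> 'y"
  assumes A_subset: "A \<subseteq> topspace (space_of E)" and p: "continuous_map (space_of E) Y p"
begin

abbreviation "lf i \<equiv> lf_chains G (space_of E) i"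
abbreviation "IC i \<equiv> IC_inf q G E i"
abbreviation "IC_A i \<equiv> IC_inf_in q G E A i"
abbreviation "IC_c i \<equiv> IC_fc q G E Y p i"

lemma IC_lf: "\<xi> \<in> IC i \<Longrightarrow> \<xi> \<in> lf i"
  by (simp add: IC_inf_iff)

lemma IC_A_iff: "\<xi> \<in> IC_A i \<longleftrightarrow> \<xi> \<in> IC i \<and> (\<forall>\<sigma>\<in>chain_simplices G i \<xi>. \<sigma> ` standard_simplex i \<subseteq> A)"
  by (auto simp: IC_inf_in_def chain_support_def)

lemma finite_simplices_meeting_compact:
  assumes \<xi>: "\<xi> \<in> lf_chains G X i" and K: "compactin X K"
  shows "finite {\<sigma> \<in> chain_simplices G i \<xi>. \<sigma> ` standard_simplex i \<inter> K \<noteq> {}}"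
  by (rule compactin_meets_finitely_many[OF K]) (use \<xi> in \<open>simp add: lf_chains_def\<close>)

lemma compactin_singular_simplex:
  assumes "singular_simplex i X \<sigma>"
  shows "compactin X (\<sigma> ` standard_simplex i)"
proof -
  have "compactin (simplex_space i) (standard_simplex i)"
    using compactin_standard_simplex[of i] by (simp add: compactin_subtopology)
  then show ?thesis using assms image_compactin unfolding singular_simplex_def by blast
qed

definition over :: "nat \<Rightarrow> ('a, 'g) lf_chain \<Rightarrow> 'y set \<Rightarrow> 'a sing set" where
  "over i \<xi> N = {\<sigma> \<in> chain_simplices G i \<xi>. \<exists>t\<in>standard_simplex i. p (\<sigma> t) \<in> N}"

text \<open>A compact set meets only finitely many simplices of a locally finite chain, and conversely finitely many simplices
  have a compact union.\<close>

lemma fc_condition_iff: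
  assumes \<xi>: "\<And>\<sigma>. \<sigma> \<in> chain_simplices G i \<xi> \<Longrightarrow> singular_simplex i X \<sigma>"
    and lf: "\<And>K. compactin X K \<Longrightarrow> finite {\<sigma> \<in> chain_simplices G i \<xi>. \<sigma> ` standard_simplex i \<inter> K \<noteq> {}}"
  shows "(\<exists>K. compactin X K \<and> chain_support G i \<xi> \<inter> {x \<in> topspace X. p x \<in> N} = K \<inter> {x \<in> topspace X. p x \<in> N})
    \<longleftrightarrow> finite (over i \<xi> N)"
proof
  assume "\<exists>K. compactin X K \<and> chain_support G i \<xi> \<inter> {x \<in> topspace X. p x \<in> N} = K \<inter> {x \<in> topspace X. p x \<in> N}"
  then obtain K where K: "compactin X K" "chain_support G i \<xi> \<inter> {x \<in> topspace X. p x \<in> N} = K \<inter> {x \<in> topspace X. p x \<in> N}" by blast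
  have "over i \<xi> N \<subseteq> {\<sigma> \<in> chain_simplices G i \<xi>. \<sigma> ` standard_simplex i \<inter> K \<noteq> {}}"
  proof
    fix \<sigma> assume "\<sigma> \<in> over i \<xi> N"
    then obtain t where t: "\<sigma> \<in> chain_simplices G i \<xi>" "t \<in> standard_simplex i" "p (\<sigma> t) \<in> N" by (auto simp: over_def)
    then have "\<sigma> t \<in> chain_support G i \<xi> \<inter> {x \<in> topspace X. p x \<in> N}"
      using singular_simplex_in[OF \<xi>] by (auto simp: chain_support_def)
    then have "\<sigma> t \<in> K" using K(2) by blast
    then show "\<sigma> \<in> {\<sigma> \<in> chain_simplices G i \<xi>. \<sigma> ` standard_simplex i \<inter> K \<noteq> {}}" using t by blast
  qed
  then show "finite (over i \<xi> N)" using lf[OF K(1)] by (rule finite_subset)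
next
  assume fin: "finite (over i \<xi> N)"
  let ?K = "\<Union>\<sigma>\<in>over i \<xi> N. \<sigma> ` standard_simplex i"
  have "compactin X ?K"
    by (rule compactin_Union) (use fin \<xi> compactin_singular_simplex in \<open>auto simp: over_def\<close>)
  moreover have "chain_support G i \<xi> \<inter> {x \<in> topspace X. p x \<in> N} = ?K \<inter> {x \<in> topspace X. p x \<in> N}"
    by (auto simp: chain_support_def over_def)
  ultimately show "\<exists>K. compactin X K \<and> chain_support G i \<xi> \<inter> {x \<in> topspace X. p x \<in> N} = K \<inter> {x \<in> topspace X. p x \<in> N}"
    by blast
qed

lemma IC_c_iff: "\<xi> \<in> IC_c i \<longleftrightarrow> \<xi> \<in> IC i \<and> (\<forall>y\<in>topspace Y. \<exists>N. openin Y N \<and> y \<in> N \<and> finite (over i \<xi> N))"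
proof (cases "\<xi> \<in> IC i")
  case True
  have "(\<exists>K. compactin (space_of E) K \<and> chain_support G i \<xi> \<inter> {x \<in> topspace (space_of E). p x \<in> N}
      = K \<inter> {x \<in> topspace (space_of E). p x \<in> N}) \<longleftrightarrow> finite (over i \<xi> N)" for N
    by (intro fc_condition_iff finite_simplices_meeting_compact[OF IC_lf[OF True]] lf_chains_simplex[OF IC_lf[OF True]])
  then show ?thesis using True by (simp add: IC_fc_def)
qed (simp add: IC_fc_def)

lemma restrict_allowable:
  assumes "\<sigma> ` standard_simplex i \<subseteq> A"
  shows "allowable_simplex q (restrict_filtered E A) i \<sigma> \<longleftrightarrow> allowable_simplex q E i \<sigma>"
proof -
  have "{t \<in> standard_simplex i. \<sigma> t \<in> stratum (restrict_filtered E A) l} = {t \<in> standard_simplex i. \<sigma> t \<in> stratum E l}" for l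
    using assms by (auto simp: stratum_def restrict_filtered_def)
  then show ?thesis by (simp add: allowable_simplex_def restrict_filtered_def)
qed

lemma boundary_simplices_in:
  assumes \<xi>: "\<xi> \<in> lf_chains G X i" and B: "\<And>\<sigma>. \<sigma> \<in> chain_simplices G i \<xi> \<Longrightarrow> \<sigma> ` standard_simplex i \<subseteq> B"
    and \<tau>: "\<tau> \<in> chain_simplices G (i - 1) (lf_boundary G i \<xi>)"
  shows "\<tau> ` standard_simplex (i - 1) \<subseteq> B"
proof -
  obtain \<sigma> a where sa: "\<sigma> \<in> chain_simplices G i \<xi>" "a \<in> keys (chain_boundary i (identity_chain i))" "\<tau> = simplex_map (i - 1) \<sigma> a"
    using chain_simplices_substitute[OF \<tau>[unfolded lf_boundary_substitute[OF \<xi>]]] by metis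
  have "simplicial_simplex (i - 1) (standard_simplex i) a" using keys_boundary_identity[OF sa(2)] by metis
  then show ?thesis using B[OF sa(1)] simplicial_simplex_in unfolding sa(3) by (fastforce simp: simplex_map_def)
qed

text \<open>The left side is defined by local finiteness and compactness in \<open>A\<close>, the right side by those in \<open>E\<close>.  Both
  amount to finiteness over small open subsets of \<open>Y\<close>; the preimages of these cover all of \<open>E\<close>, so that a
  chain of the left side is locally finite also at the points outside \<open>A\<close>.\<close>

lemma IC_fc_restrict: "IC_fc q G (restrict_filtered E A) Y p i = IC_c i \<inter> IC_A i"
proof (intro equalityI subsetI)
  let ?A = "subtopology (space_of E) A"
  have tA: "topspace ?A = A" using A_subset by auto
  have sp: "space_of (restrict_filtered E A) = ?A" by (simp add: restrict_filtered_def)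
  fix \<xi> assume \<xi>: "\<xi> \<in> IC_fc q G (restrict_filtered E A) Y p i"
  then have IC: "\<xi> \<in> IC_inf q G (restrict_filtered E A) i" by (simp add: IC_fc_def)
  then have lfA: "\<xi> \<in> lf_chains G ?A i" by (simp add: IC_inf_iff sp)
  have ss: "singular_simplex i ?A \<sigma>" if "\<sigma> \<in> chain_simplices G i \<xi>" for \<sigma>
    using lf_chains_simplex[OF lfA that] .
  then have inA: "\<sigma> ` standard_simplex i \<subseteq> A" and sE: "singular_simplex i (space_of E) \<sigma>" if "\<sigma> \<in> chain_simplices G i \<xi>" for \<sigma>
    using that by (simp_all add: singular_simplex_subtopology)
  have fin: "\<exists>N. openin Y N \<and> y \<in> N \<and> finite (over i \<xi> N)" if y: "y \<in> topspace Y" for y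
  proof -
    have "(\<exists>K. compactin ?A K \<and> chain_support G i \<xi> \<inter> {x \<in> topspace ?A. p x \<in> N} = K \<inter> {x \<in> topspace ?A. p x \<in> N})
      \<longleftrightarrow> finite (over i \<xi> N)" for N
      by (intro fc_condition_iff ss finite_simplices_meeting_compact[OF lfA])
    then show ?thesis using \<xi> y by (simp add: IC_fc_def sp)
  qed
  have "\<exists>U. openin (space_of E) U \<and> x \<in> U \<and> finite {\<sigma> \<in> chain_simplices G i \<xi>. \<sigma> ` standard_simplex i \<inter> U \<noteq> {}}"
    if x: "x \<in> topspace (space_of E)" for x
  proof -
    have "p x \<in> topspace Y" using continuous_map_image_subset_topspace[OF p] x by blast
    then obtain N where N: "openin Y N" "p x \<in> N" "finite (over i \<xi> N)" using fin by blast
    let ?U = "{x \<in> topspace (space_of E). p x \<in> N}"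
    have "{\<sigma> \<in> chain_simplices G i \<xi>. \<sigma> ` standard_simplex i \<inter> ?U \<noteq> {}} \<subseteq> over i \<xi> N" by (auto simp: over_def)
    then have "finite {\<sigma> \<in> chain_simplices G i \<xi>. \<sigma> ` standard_simplex i \<inter> ?U \<noteq> {}}" using N(3) by (rule finite_subset)
    then show ?thesis using openin_continuous_map_preimage[OF p N(1)] x N(2) by (intro exI[of _ ?U]) auto
  qed
  then have lf: "\<xi> \<in> lf i" using lfA sE by (simp add: lf_chains_def)
  have bd: "\<tau> ` standard_simplex (i - 1) \<subseteq> A" if "\<tau> \<in> chain_simplices G (i - 1) (lf_boundary G i \<xi>)" for \<tau>
    by (rule boundary_simplices_in[OF lf inA that])
  have "\<xi> \<in> IC i"
    using IC lf restrict_allowable[OF inA] restrict_allowable[OF bd] by (simp add: IC_inf_iff allowable_chain_def)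
  then show "\<xi> \<in> IC_c i \<inter> IC_A i" using fin inA by (simp add: IC_c_iff IC_A_iff)
next
  let ?A = "subtopology (space_of E) A"
  have tA: "topspace ?A = A" using A_subset by auto
  have sp: "space_of (restrict_filtered E A) = ?A" by (simp add: restrict_filtered_def)
  fix \<xi> assume "\<xi> \<in> IC_c i \<inter> IC_A i"
  then have IC: "\<xi> \<in> IC i" and inA: "\<And>\<sigma>. \<sigma> \<in> chain_simplices G i \<xi> \<Longrightarrow> \<sigma> ` standard_simplex i \<subseteq> A"
    and fin: "\<forall>y\<in>topspace Y. \<exists>N. openin Y N \<and> y \<in> N \<and> finite (over i \<xi> N)"
    by (simp_all add: IC_c_iff IC_A_iff)
  have lf: "\<xi> \<in> lf i" by (rule IC_lf[OF IC])
  have ss: "singular_simplex i ?A \<sigma>" if "\<sigma> \<in> chain_simplices G i \<xi>" for \<sigma>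
    using lf_chains_simplex[OF lf that] inA[OF that] by (simp add: singular_simplex_subtopology)
  have "\<exists>U. openin ?A U \<and> x \<in> U \<and> finite {\<sigma> \<in> chain_simplices G i \<xi>. \<sigma> ` standard_simplex i \<inter> U \<noteq> {}}"
    if x: "x \<in> topspace ?A" for x
  proof -
    have "x \<in> topspace (space_of E)" using x by simp
    then obtain U where U: "openin (space_of E) U" "x \<in> U" "finite {\<sigma> \<in> chain_simplices G i \<xi>. \<sigma> ` standard_simplex i \<inter> U \<noteq> {}}"
      using lf unfolding lf_chains_def by blast
    have "finite {\<sigma> \<in> chain_simplices G i \<xi>. \<sigma> ` standard_simplex i \<inter> (U \<inter> A) \<noteq> {}}"
      by (rule finite_subset[OF _ U(3)]) auto
    moreover have "openin ?A (U \<inter> A)" using U(1) by (auto simp: openin_subtopology)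
    ultimately show ?thesis using U(2) x by (intro exI[of _ "U \<inter> A"]) auto
  qed
  then have lfA: "\<xi> \<in> lf_chains G ?A i" using lf ss by (simp add: lf_chains_def)
  have bd: "\<tau> ` standard_simplex (i - 1) \<subseteq> A" if "\<tau> \<in> chain_simplices G (i - 1) (lf_boundary G i \<xi>)" for \<tau>
    by (rule boundary_simplices_in[OF lf inA that])
  have ICA: "\<xi> \<in> IC_inf q G (restrict_filtered E A) i"
    using IC lfA restrict_allowable[OF inA] restrict_allowable[OF bd] by (simp add: IC_inf_iff allowable_chain_def sp)
  have "(\<exists>K. compactin ?A K \<and> chain_support G i \<xi> \<inter> {x \<in> topspace ?A. p x \<in> N} = K \<inter> {x \<in> topspace ?A. p x \<in> N})
      \<longleftrightarrow> finite (over i \<xi> N)" for N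
    by (intro fc_condition_iff ss finite_simplices_meeting_compact[OF lfA])
  then show "\<xi> \<in> IC_fc q G (restrict_filtered E A) Y p i" using ICA fin by (simp add: IC_fc_def sp)
qed

lemma substitute_IC_A:
  assumes \<xi>: "\<xi> \<in> IC_A i" and c: "family i j c" and "substitute G i j c \<xi> \<in> IC j"
  shows "substitute G i j c \<xi> \<in> IC_A j"
  unfolding IC_A_iff
proof (intro conjI ballI)
  fix \<tau> assume "\<tau> \<in> chain_simplices G j (substitute G i j c \<xi>)"
  then obtain \<sigma> a where sa: "\<sigma> \<in> chain_simplices G i \<xi>" "a \<in> keys (c \<sigma>)" "\<tau> = simplex_map j \<sigma> a"
    using chain_simplices_substitute by metis
  have "\<sigma> ` standard_simplex i \<subseteq> A" using \<xi> sa(1) by (simp add: IC_A_iff)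
  then show "\<tau> ` standard_simplex j \<subseteq> A"
    using familyD_in[OF c, OF sa(2)] unfolding sa(3) by (auto simp: simplex_map_def)
qed fact

lemma over_substitute:
  assumes c: "family i j c" and fin: "finite (over i \<xi> N)"
  shows "finite (over j (substitute G i j c \<xi>) N)"
proof (rule finite_subset)
  show "over j (substitute G i j c \<xi>) N \<subseteq> (\<Union>\<sigma>\<in>over i \<xi> N. simplex_map j \<sigma> ` keys (c \<sigma>))"
  proof
    fix \<tau> assume "\<tau> \<in> over j (substitute G i j c \<xi>) N"
    then obtain t where t: "\<tau> \<in> chain_simplices G j (substitute G i j c \<xi>)" "t \<in> standard_simplex j" "p (\<tau> t) \<in> N"
      by (auto simp: over_def)
    obtain \<sigma> a where sa: "\<sigma> \<in> chain_simplices G i \<xi>" "a \<in> keys (c \<sigma>)" "\<tau> = simplex_map j \<sigma> a"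
      using chain_simplices_substitute[OF t(1)] by metis
    have "a t \<in> standard_simplex i" by (rule familyD_in[OF c, OF sa(2) t(2)])
    then have "\<sigma> \<in> over i \<xi> N" using sa t(2,3) by (auto simp: over_def simplex_map_def)
    then show "\<tau> \<in> (\<Union>\<sigma>\<in>over i \<xi> N. simplex_map j \<sigma> ` keys (c \<sigma>))" using sa by blast
  qed
qed (use fin in simp)

lemma substitute_IC_c:
  assumes \<xi>: "\<xi> \<in> IC_c i" and c: "family i j c" and "substitute G i j c \<xi> \<in> IC j"
  shows "substitute G i j c \<xi> \<in> IC_c j"
  unfolding IC_c_iff
proof (intro conjI ballI)
  fix y assume "y \<in> topspace Y"
  then obtain N where "openin Y N" "y \<in> N" "finite (over i \<xi> N)" using \<xi> by (auto simp: IC_c_iff)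
  then show "\<exists>N. openin Y N \<and> y \<in> N \<and> finite (over j (substitute G i j c \<xi>) N)"
    using over_substitute[OF c] by blast
qed fact

end

section \<open>Submodules of the intersection chains\<close>

context coefficient_sheaf
begin

lemma zero_lf: "zero_coefficient G i \<in> lf_chains G X i"
  using submodule_ofD(2)[OF submodule_lf_chains] by (simp add: chain_module_simps)

lemma substitute_zero: "substitute G i j c (zero_coefficient G i) = zero_coefficient G j"
  unfolding substitute_def sources_def
  by (intro ext) (auto simp: combination_0[OF lift_stalk] zero_coefficient_def[of G j])

lemma lf_boundary_zero: "lf_boundary G i (zero_coefficient G i) = zero_coefficient G (i - 1)"
  by (simp only: lf_boundary_substitute[OF zero_lf] substitute_zero)

lemma allowable_chain_smult:
  "a \<in> carrier R \<Longrightarrow> allowable_chain q G X i \<xi> \<Longrightarrow> allowable_chain q G X i (a \<odot>\<^bsub>raw_module G i\<^esub> \<xi>)"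
  using chain_simplices_smult[of a i "raw_chains G i" \<xi>] by (auto simp: allowable_chain_def)

lemma allowable_chain_zero [simp]: "allowable_chain q G X i (zero_coefficient G i)"
  by (simp add: allowable_chain_def)

lemma submodule_IC: "submodule_of R (raw_module G i) (IC_inf q G X i)"
  unfolding submodule_of_def
proof (intro conjI ballI)
  show "IC_inf q G X i \<subseteq> carrier (raw_module G i)"
    using lf_chains_raw[of "space_of X" i] unfolding IC_inf_iff chain_module_simps(1) subset_iff by blast
  show "\<zero>\<^bsub>raw_module G i\<^esub> \<in> IC_inf q G X i"
    using zero_lf by (simp add: IC_inf_iff chain_module_simps(2) lf_boundary_zero)
next
  fix \<xi> \<eta> assume "\<xi> \<in> IC_inf q G X i" "\<eta> \<in> IC_inf q G X i"
  then show "\<xi> \<oplus>\<^bsub>raw_module G i\<^esub> \<eta> \<in> IC_inf q G X i"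
    by (simp only: IC_inf_iff lf_chains_add allowable_chain_add lf_boundary_add[of _ "space_of X"] simp_thms)
next
  fix a \<xi> assume "a \<in> carrier R" "\<xi> \<in> IC_inf q G X i"
  then show "a \<odot>\<^bsub>raw_module G i\<^esub> \<xi> \<in> IC_inf q G X i"
    by (simp only: IC_inf_iff lf_chains_smult allowable_chain_smult lf_boundary_smult[of _ "space_of X"] simp_thms)
qed

lemma boundary_IC:
  assumes "\<xi> \<in> IC_inf q G X i"
  shows "lf_boundary G i \<xi> \<in> IC_inf q G X (i - 1)"
proof -
  have lf: "\<xi> \<in> lf_chains G (space_of X) i" using assms by (simp add: IC_inf_iff)
  have "allowable_chain q G X (i - 1 - 1) (lf_boundary G (i - 1) (lf_boundary G i \<xi>))"
    by (simp only: lf_boundary_lf_boundary[OF lf] allowable_chain_zero)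
  then show ?thesis using assms lf_boundary_lf_chains[OF lf] by (simp only: IC_inf_iff simp_thms)
qed

end

context fibred_pair
begin

lemma submodule_IC_A: "submodule_of R (raw_module G i) (IC_A i)"
  unfolding submodule_of_def
proof (intro conjI ballI)
  show "IC_A i \<subseteq> carrier (raw_module G i)"
    using submodule_ofD(1)[OF submodule_IC] by (auto simp: IC_A_iff)
  show "\<zero>\<^bsub>raw_module G i\<^esub> \<in> IC_A i"
    using submodule_ofD(2)[OF submodule_IC[of i q E]] by (simp add: IC_A_iff chain_module_simps(2))
next
  fix \<xi> \<eta> assume "\<xi> \<in> IC_A i" "\<eta> \<in> IC_A i"
  then show "\<xi> \<oplus>\<^bsub>raw_module G i\<^esub> \<eta> \<in> IC_A i"
    using submodule_ofD(3)[OF submodule_IC, of \<xi> q E i \<eta>] by (auto simp: IC_A_iff dest!: subsetD[OF chain_simplices_add])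
next
  fix a \<xi> assume a: "a \<in> carrier R" and "\<xi> \<in> IC_A i"
  then show "a \<odot>\<^bsub>raw_module G i\<^esub> \<xi> \<in> IC_A i"
    using submodule_ofD(4)[OF submodule_IC a, of \<xi> q E i] by (auto simp: IC_A_iff dest!: subsetD[OF chain_simplices_smult[OF a]])
qed

lemma submodule_IC_c: "submodule_of R (raw_module G i) (IC_c i)"
  unfolding submodule_of_def
proof (intro conjI ballI)
  show "IC_c i \<subseteq> carrier (raw_module G i)"
    using submodule_ofD(1)[OF submodule_IC] by (auto simp: IC_c_iff)
  have "over i (zero_coefficient G i) N = {}" for N by (simp add: over_def)
  then show "\<zero>\<^bsub>raw_module G i\<^esub> \<in> IC_c i"
    using submodule_ofD(2)[OF submodule_IC[of i q E]] by (auto simp: IC_c_iff chain_module_simps(2))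
next
  fix \<xi> \<eta> assume x: "\<xi> \<in> IC_c i" "\<eta> \<in> IC_c i"
  let ?z = "\<xi> \<oplus>\<^bsub>raw_module G i\<^esub> \<eta>"
  have "\<exists>N. openin Y N \<and> y \<in> N \<and> finite (over i ?z N)" if y: "y \<in> topspace Y" for y
  proof -
    obtain N where N: "openin Y N" "y \<in> N" "finite (over i \<xi> N)" using x(1) y by (auto simp: IC_c_iff)
    obtain N' where N': "openin Y N'" "y \<in> N'" "finite (over i \<eta> N')" using x(2) y by (auto simp: IC_c_iff)
    have "over i ?z (N \<inter> N') \<subseteq> over i \<xi> N \<union> over i \<eta> N'"
      using chain_simplices_add[of i "raw_chains G i" \<xi> \<eta>] unfolding over_def by blast
    then have "finite (over i ?z (N \<inter> N'))" using N(3) N'(3) finite_subset by blast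
    then show ?thesis using N N' by (intro exI[of _ "N \<inter> N'"]) (auto simp: openin_Int)
  qed
  then show "?z \<in> IC_c i" using x submodule_ofD(3)[OF submodule_IC, of \<xi> q E i \<eta>] by (simp add: IC_c_iff)
next
  fix a \<xi> assume a: "a \<in> carrier R" and x: "\<xi> \<in> IC_c i"
  let ?z = "a \<odot>\<^bsub>raw_module G i\<^esub> \<xi>"
  have "over i ?z N \<subseteq> over i \<xi> N" for N
    using chain_simplices_smult[OF a, of i "raw_chains G i" \<xi>] unfolding over_def by blast
  then have "finite (over i \<xi> N) \<Longrightarrow> finite (over i ?z N)" for N using finite_subset by blast
  then have "\<exists>N. openin Y N \<and> y \<in> N \<and> finite (over i ?z N)" if "y \<in> topspace Y" for y
    using x that unfolding IC_c_iff by blast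
  then show "?z \<in> IC_c i" using x submodule_ofD(4)[OF submodule_IC a, of \<xi> q E i] by (simp add: IC_c_iff)
qed

lemma boundary_IC_A: "\<xi> \<in> IC_A i \<Longrightarrow> lf_boundary G i \<xi> \<in> IC_A (i - 1)"
proof -
  assume \<xi>: "\<xi> \<in> IC_A i"
  then have IC: "\<xi> \<in> IC i" by (simp add: IC_A_iff)
  show ?thesis
    using substitute_IC_A[OF \<xi> family_boundary] boundary_IC[OF IC] by (simp only: lf_boundary_substitute[OF IC_lf[OF IC]])
qed

lemma boundary_IC_c: "\<xi> \<in> IC_c i \<Longrightarrow> lf_boundary G i \<xi> \<in> IC_c (i - 1)"
proof -
  assume \<xi>: "\<xi> \<in> IC_c i"
  then have IC: "\<xi> \<in> IC i" by (simp add: IC_c_iff)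
  show ?thesis
    using substitute_IC_c[OF \<xi> family_boundary] boundary_IC[OF IC] by (simp only: lf_boundary_substitute[OF IC_lf[OF IC]])
qed

definition decomposable :: "nat \<Rightarrow> ('a, 'g) lf_chain set" where
  "decomposable i = {\<pi> \<oplus>\<^bsub>raw_module G i\<^esub> \<alpha> | \<pi> \<alpha>. \<pi> \<in> IC_c i \<and> \<alpha> \<in> IC_A i}"

lemma submodule_decomposable: "submodule_of R (raw_module G i) (decomposable i)"
  unfolding decomposable_def by (rule submodule_of_sum[OF raw_module submodule_IC_c submodule_IC_A])

lemma decomposable_cases:
  assumes "\<xi> \<in> decomposable i"
  obtains \<pi> \<alpha> where "\<xi> = \<pi> \<oplus>\<^bsub>raw_module G i\<^esub> \<alpha>" "\<pi> \<in> IC_c i" "\<alpha> \<in> IC_A i"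
  using assms by (auto simp: decomposable_def)

lemma decomposable_IC: "\<xi> \<in> decomposable i \<Longrightarrow> \<xi> \<in> IC i"
  using submodule_ofD(3)[OF submodule_IC] by (auto simp: decomposable_def IC_c_iff IC_A_iff)

lemma substitute_decomposable:
  assumes \<xi>: "\<xi> \<in> decomposable i" and c: "family i j c" and IC: "\<And>\<eta>. \<eta> \<in> IC i \<Longrightarrow> substitute G i j c \<eta> \<in> IC j"
  shows "substitute G i j c \<xi> \<in> decomposable j"
proof -
  obtain \<pi> \<alpha> where pa: "\<xi> = \<pi> \<oplus>\<^bsub>raw_module G i\<^esub> \<alpha>" "\<pi> \<in> IC_c i" "\<alpha> \<in> IC_A i"
    using decomposable_cases[OF \<xi>] by metis
  have pl: "\<pi> \<in> IC i" "\<alpha> \<in> IC i" using pa(2,3) by (simp_all add: IC_c_iff IC_A_iff)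
  have "substitute G i j c \<xi> = substitute G i j c \<pi> \<oplus>\<^bsub>raw_module G j\<^esub> substitute G i j c \<alpha>"
    unfolding pa(1) by (rule substitute_add_chain[OF IC_lf[OF pl(1)] IC_lf[OF pl(2)] c])
  then show ?thesis
    using substitute_IC_c[OF pa(2) c IC[OF pl(1)]] substitute_IC_A[OF pa(3) c IC[OF pl(2)]] unfolding decomposable_def by blast
qed

lemma boundary_decomposable: "\<xi> \<in> decomposable i \<Longrightarrow> lf_boundary G i \<xi> \<in> decomposable (i - 1)"
  using substitute_decomposable[OF _ family_boundary] boundary_IC lf_boundary_substitute[OF IC_lf] decomposable_IC
  by metis

lemma homotopy_faces_decomposable:
  assumes \<xi>: "\<xi> \<in> decomposable (i - 1)"
  shows "substitute G (i - 1) i (homotopy_family (i - 1) (\<lambda>_. m)) \<xi> \<in> decomposable i"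
proof (cases "i = 0")
  case True
  then show ?thesis
    using submodule_ofD(2)[OF submodule_decomposable[of 0]]
    by (simp add: homotopy_family_def[abs_def] substitute_zero_family chain_module_simps(2))
next
  case False
  then show ?thesis
    using substitute_decomposable[OF \<xi> family_homotopy_faces] homotopy_IC[of _ q E "i - 1" "\<lambda>_. m"] by simp
qed

text \<open>The summands of \<open>\<xi>\<close> are subdivided separately.  A decomposition of the subdivided chain would not do,
  because its summands need not have allowable last faces.\<close>

lemma homotopy_faces_subdivide_decomposable:
  assumes \<xi>: "\<xi> \<in> decomposable (i - 1)"
  shows "substitute G (i - 1) i (homotopy_family (i - 1) M) (subdivide G (i - 1) \<xi>) \<in> decomposable i"
proof (cases "i = 0")
  case True
  then show ?thesis
    using submodule_ofD(2)[OF submodule_decomposable[of 0]]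
    by (simp add: homotopy_family_def[abs_def] substitute_zero_family chain_module_simps(2))
next
  case False
  obtain \<pi> \<alpha> where pa: "\<xi> = \<pi> \<oplus>\<^bsub>raw_module G (i - 1)\<^esub> \<alpha>" "\<pi> \<in> IC_c (i - 1)" "\<alpha> \<in> IC_A (i - 1)"
    using decomposable_cases[OF \<xi>] by metis
  have pl: "\<pi> \<in> IC (i - 1)" "\<alpha> \<in> IC (i - 1)" using pa(2,3) by (simp_all add: IC_c_iff IC_A_iff)
  let ?S = "subdivide G (i - 1)" and ?H = "substitute G (i - 1) i (homotopy_family (i - 1) M)"
  have S: "?S \<xi> = ?S \<pi> \<oplus>\<^bsub>raw_module G (i - 1)\<^esub> ?S \<alpha>"
    unfolding pa(1) subdivide_def by (rule substitute_add_chain[OF IC_lf[OF pl(1)] IC_lf[OF pl(2)] family_subdivide])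
  have Sp: "?S \<pi> \<in> IC_c (i - 1)" and Sa: "?S \<alpha> \<in> IC_A (i - 1)"
    using substitute_IC_c[OF pa(2) family_subdivide] substitute_IC_A[OF pa(3) family_subdivide]
      subdivide_IC[OF pl(1)] subdivide_IC[OF pl(2)] by (simp_all add: subdivide_def)
  have "?H (?S \<eta>) \<in> IC i" if "\<eta> \<in> IC (i - 1)" for \<eta>
    using homotopy_IC[OF subdivide_IC[OF that], of M] subdivide_last_face[OF that] False by simp
  then have "?H (?S \<pi>) \<in> IC_c i" "?H (?S \<alpha>) \<in> IC_A i"
    using substitute_IC_c[OF Sp family_homotopy_faces] substitute_IC_A[OF Sa family_homotopy_faces] pl by blast+
  moreover have "?H (?S \<xi>) = ?H (?S \<pi>) \<oplus>\<^bsub>raw_module G i\<^esub> ?H (?S \<alpha>)"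
    unfolding S by (rule substitute_add_chain[OF IC_lf[OF subdivide_IC[OF pl(1)]] IC_lf[OF subdivide_IC[OF pl(2)]] family_homotopy_faces])
  ultimately show ?thesis unfolding decomposable_def by blast
qed

end

section \<open>Decomposition of small chains\<close>

locale cocompact_pair = fibred_pair R G q E A Y p
  for R :: "'r ring" and G :: "('r, 'a, 'g) sheaf" and q E A and Y :: "'y topology" and p +
  fixes \<V> :: "'y set set"
  assumes cover: "\<And>V. V \<in> \<V> \<Longrightarrow> openin Y V" "\<Union>\<V> = topspace Y" "locally_finite_in Y \<V>"
      "\<And>V. V \<in> \<V> \<Longrightarrow> \<exists>K. compactin Y K \<and> V \<subseteq> K"
    and cocompact: "\<And>K. compactin Y K \<Longrightarrow> compactin (space_of E) ({x \<in> topspace (space_of E). p x \<in> K} - A)"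
begin

definition small :: "nat \<Rightarrow> 'a sing \<Rightarrow> bool" where
  "small i \<sigma> \<longleftrightarrow> (\<exists>V\<in>\<V>. \<forall>t\<in>standard_simplex i. p (\<sigma> t) \<in> V)"

lemma small_simplex_map: "small i \<sigma> \<Longrightarrow> a ` standard_simplex j \<subseteq> standard_simplex i \<Longrightarrow> small j (simplex_map j \<sigma> a)"
  unfolding small_def by (auto simp: simplex_map_def image_subset_iff)

lemma finite_cover_meeting:
  assumes K: "compactin Y K"
  shows "finite {V \<in> \<V>. V \<inter> K \<noteq> {}}"
  by (rule compactin_meets_finitely_many[OF K]) (use cover(3) in \<open>simp add: locally_finite_in_def\<close>)

lemma compact_hull:
  assumes "finite \<F>" "\<F> \<subseteq> \<V>"
  obtains K where "compactin Y K" "\<Union>\<F> \<subseteq> K"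
proof -
  obtain k where k: "\<And>V. V \<in> \<V> \<Longrightarrow> compactin Y (k V) \<and> V \<subseteq> k V" using cover(4) by metis
  have "compactin Y (\<Union>(k ` \<F>))" by (rule compactin_Union) (use assms k in auto)
  moreover have "\<Union>\<F> \<subseteq> \<Union>(k ` \<F>)" using assms(2) k by blast
  ultimately show thesis by (rule that)
qed

text \<open>Let \<open>V\<close> be the set of last vertices of the simplices that are not contained in \<open>A\<close>.  Simplices with last vertex
  outside \<open>V\<close> are contained in \<open>A\<close>.  The other simplices over a small set share their last vertices with simplices
  that meet a compact set outside \<open>A\<close>; there are finitely many of these vertices, and finitely many
  simplices through each of them.\<close>

lemma small_chain_decomposable:
  assumes \<xi>: "\<xi> \<in> IC i" and face: "last_face_allowable q G E i \<xi>"
    and small: "\<And>\<sigma>. \<sigma> \<in> chain_simplices G i \<xi> \<Longrightarrow> small i \<sigma>"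
  shows "\<xi> \<in> decomposable i"
proof -
  define V where "V = (\<lambda>\<sigma>. \<sigma> (last_vertex i)) ` {\<sigma> \<in> chain_simplices G i \<xi>. \<not> \<sigma> ` standard_simplex i \<subseteq> A}"
  note lf = IC_lf[OF \<xi>]
  let ?r = "\<lambda>V. substitute G i i (restriction_family i V) \<xi>"
  have IC: "?r V \<in> IC i" for V by (rule restriction_IC[OF \<xi> face])
  have simp_r: "\<sigma> \<in> chain_simplices G i \<xi> \<and> \<sigma> (last_vertex i) \<in> W" if \<sigma>: "\<sigma> \<in> chain_simplices G i (?r W)" for \<sigma> W
  proof -
    obtain \<tau> a where ta: "\<tau> \<in> chain_simplices G i \<xi>" "a \<in> keys (restriction_family i W \<tau>)" "\<sigma> = simplex_map i \<tau> a"
      using chain_simplices_substitute[OF \<sigma>] by metis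
    then have "\<tau> (last_vertex i) \<in> W" "a = restrict id (standard_simplex i)"
      by (auto simp: restriction_family_def identity_chain_def split: if_splits)
    then show ?thesis using ta simplex_map_identity[OF lf_chains_simplex[OF lf ta(1)]] by simp
  qed
  have id: "(\<lambda>\<sigma>. identity_chain i) = (\<lambda>\<sigma>. restriction_family i V \<sigma> + restriction_family i (- V) \<sigma>)"
    by (intro ext) (simp add: restriction_family_def)
  have sum: "?r V \<oplus>\<^bsub>raw_module G i\<^esub> ?r (- V) = \<xi>"
    using substitute_identity[OF lf] unfolding id substitute_add_family[OF lf family_restriction family_restriction] .
  have "?r (- V) \<in> IC_A i"
    unfolding IC_A_iff using IC simp_r by (fastforce simp: V_def)
  moreover have "?r V \<in> IC_c i"
    unfolding IC_c_iff
  proof (intro conjI ballI IC)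
    fix y assume y: "y \<in> topspace Y"
    obtain N where N: "openin Y N" "y \<in> N" "finite {U \<in> \<V>. U \<inter> N \<noteq> {}}"
      using cover(3) y unfolding locally_finite_in_def by blast
    \<comment> \<open>A simplex over \<open>N\<close> lies over \<open>K1\<close>, and every simplex with the same last vertex lies over \<open>K2\<close>.\<close>
    obtain K1 where K1: "compactin Y K1" "\<Union>{U \<in> \<V>. U \<inter> N \<noteq> {}} \<subseteq> K1" using compact_hull[OF N(3)] by blast
    obtain K2 where K2: "compactin Y K2" "\<Union>{U \<in> \<V>. U \<inter> K1 \<noteq> {}} \<subseteq> K2" using compact_hull[OF finite_cover_meeting[OF K1(1)]] by blast
    define C where "C = {x \<in> topspace (space_of E). p x \<in> K2} - A"
    have "finite {\<sigma> \<in> chain_simplices G i \<xi>. \<sigma> ` standard_simplex i \<inter> C \<noteq> {}}"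
      unfolding C_def by (rule finite_simplices_meeting_compact[OF lf cocompact[OF K2(1)]])
    then have finX: "finite ((\<lambda>\<sigma>. \<sigma> (last_vertex i)) ` {\<sigma> \<in> chain_simplices G i \<xi>. \<sigma> ` standard_simplex i \<inter> C \<noteq> {}})" (is "finite ?X")
      by simp
    have "over i (?r V) N \<subseteq> (\<Union>x\<in>?X. {\<sigma> \<in> chain_simplices G i \<xi>. x \<in> \<sigma> ` standard_simplex i})"
    proof
      fix \<sigma> assume "\<sigma> \<in> over i (?r V) N"
      then obtain t where t: "\<sigma> \<in> chain_simplices G i (?r V)" "t \<in> standard_simplex i" "p (\<sigma> t) \<in> N" by (auto simp: over_def)
      have \<sigma>: "\<sigma> \<in> chain_simplices G i \<xi>" "\<sigma> (last_vertex i) \<in> V" using simp_r[OF t(1)] by auto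
      obtain U where U: "U \<in> \<V>" "\<And>t. t \<in> standard_simplex i \<Longrightarrow> p (\<sigma> t) \<in> U" using small[OF \<sigma>(1)] by (auto simp: small_def)
      then have "U \<subseteq> K1" using t(2,3) K1(2) by blast
      then have x1: "p (\<sigma> (last_vertex i)) \<in> K1" using U(2) by auto
      obtain \<tau> where \<tau>: "\<tau> \<in> chain_simplices G i \<xi>" "\<not> \<tau> ` standard_simplex i \<subseteq> A" "\<sigma> (last_vertex i) = \<tau> (last_vertex i)"
        using \<sigma>(2) by (auto simp: V_def)
      obtain U' where U': "U' \<in> \<V>" "\<And>t. t \<in> standard_simplex i \<Longrightarrow> p (\<tau> t) \<in> U'" using small[OF \<tau>(1)] by (auto simp: small_def)
      then have "p (\<tau> (last_vertex i)) \<in> U' \<inter> K1" using x1 \<tau>(3) by simp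
      then have "U' \<subseteq> K2" using U'(1) K2(2) by blast
      obtain u where u: "u \<in> standard_simplex i" "\<tau> u \<notin> A" using \<tau>(2) by blast
      have "\<tau> u \<in> C"
        unfolding C_def using u U'(2)[OF u(1)] \<open>U' \<subseteq> K2\<close> singular_simplex_in[OF lf_chains_simplex[OF lf \<tau>(1)] u(1)] by auto
      then have "\<sigma> (last_vertex i) \<in> ?X" using \<tau>(1,3) u(1) by (intro image_eqI[of _ _ \<tau>]) auto
      then show "\<sigma> \<in> (\<Union>x\<in>?X. {\<sigma> \<in> chain_simplices G i \<xi>. x \<in> \<sigma> ` standard_simplex i})" using \<sigma>(1) last_vertex_in by blast
    qed
    moreover have "finite (\<Union>x\<in>?X. {\<sigma> \<in> chain_simplices G i \<xi>. x \<in> \<sigma> ` standard_simplex i})"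
      using finX finite_simplices_through[OF lf] by (intro finite_UN_I) auto
    ultimately have "finite (over i (?r V) N)" by (rule finite_subset)
    then show "\<exists>N. openin Y N \<and> y \<in> N \<and> finite (over i (?r V) N)" using N by blast
  qed
  ultimately show ?thesis unfolding decomposable_def using sum[symmetric] by blast
qed

definition depth :: "nat \<Rightarrow> 'a sing \<Rightarrow> nat" where
  "depth i \<sigma> = (SOME n. \<forall>m\<ge>n. \<forall>a\<in>keys (iterated_subdivision i m). small i (simplex_map i \<sigma> a))"

lemma depth:
  assumes \<sigma>: "singular_simplex i (space_of E) \<sigma>" and m: "depth i \<sigma> \<le> m" and a: "a \<in> keys (iterated_subdivision i m)"
  shows "small i (simplex_map i \<sigma> a)"
proof -
  let ?U = "(\<lambda>V. {x \<in> topspace (space_of E). p x \<in> V}) ` \<V>"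
  have 1: "\<And>U. U \<in> ?U \<Longrightarrow> openin (space_of E) U"
    using openin_continuous_map_preimage[OF p] cover(1) by blast
  have 2: "topspace (space_of E) \<subseteq> \<Union>?U"
    using continuous_map_image_subset_topspace[OF p] cover(2) by fastforce
  obtain n where n: "\<forall>m\<ge>n. \<forall>a\<in>keys (iterated_subdivision i m). \<exists>U\<in>?U. \<sigma> ` a ` standard_simplex i \<subseteq> U"
    using sufficient_subdivision_exists[OF \<sigma>, of ?U, OF 1 2] by blast
  have "\<forall>m\<ge>n. \<forall>a\<in>keys (iterated_subdivision i m). small i (simplex_map i \<sigma> a)"
  proof (intro allI impI ballI)
    fix m a assume "n \<le> m" "a \<in> keys (iterated_subdivision i m)"
    then obtain V where "V \<in> \<V>" "\<sigma> ` a ` standard_simplex i \<subseteq> {x \<in> topspace (space_of E). p x \<in> V}" using n by blast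
    then show "small i (simplex_map i \<sigma> a)" unfolding small_def by (intro bexI[of _ V]) (auto simp: simplex_map_def)
  qed
  then have "\<forall>m\<ge>depth i \<sigma>. \<forall>a\<in>keys (iterated_subdivision i m). small i (simplex_map i \<sigma> a)"
    unfolding depth_def by (rule someI[of "\<lambda>n. \<forall>m\<ge>n. \<forall>a\<in>keys (iterated_subdivision i m). small i (simplex_map i \<sigma> a)"])
  then show ?thesis using m a by blast
qed

text \<open>The number \<open>M' x\<close> makes all faces of simplices through \<open>x\<close> small, and \<open>M x\<close> makes the simplices through \<open>x\<close> small.
  If \<open>M x\<close> is also at least \<open>M'\<close> at the last vertices of the faces of these simplices, then the homotopy between \<open>M'\<close> and \<open>M\<close>
  on a face only involves subdivisions of depth at least \<open>M'\<close>, whose pieces are small.  Local finiteness keeps all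
  maxima finite.\<close>

lemma small_family_small:
  assumes \<eta>: "\<eta> \<in> lf i"
  obtains M M' where "\<And>\<tau>. \<tau> \<in> chain_simplices G i (substitute G i i (small_family i M M') \<eta>) \<Longrightarrow> small i \<tau>"
proof -
  \<comment> \<open>The depth of a face is counted at all points of the simplex, in particular at the last vertex of the face.  The
    element \<open>0\<close> is inserted below as there may be no simplex through \<open>x\<close>.\<close>
  define D' where "D' x = {depth (i - 1) (singular_face i k \<sigma>) | \<sigma> k. \<sigma> \<in> chain_simplices G i \<eta> \<and> x \<in> \<sigma> ` standard_simplex i \<and> k \<le> i}" for x
  define M' where "M' x = Max (insert 0 (D' x))" for x
  define D where "D x = {depth i \<sigma> | \<sigma>. \<sigma> \<in> chain_simplices G i \<eta> \<and> x \<in> \<sigma> ` standard_simplex i} \<union>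
      {M' (singular_face i k \<sigma> (last_vertex (i - 1))) | \<sigma> k. \<sigma> \<in> chain_simplices G i \<eta> \<and> x \<in> \<sigma> ` standard_simplex i \<and> k \<le> i}" for x
  define M where "M x = Max (insert 0 (D x))" for x
  have fin: "finite {f \<sigma> k | \<sigma> k. \<sigma> \<in> chain_simplices G i \<eta> \<and> x \<in> \<sigma> ` standard_simplex i \<and> k \<le> i}" for f :: "_ \<Rightarrow> nat \<Rightarrow> nat" and x
  proof (rule finite_subset)
    show "{f \<sigma> k | \<sigma> k. \<sigma> \<in> chain_simplices G i \<eta> \<and> x \<in> \<sigma> ` standard_simplex i \<and> k \<le> i}
        \<subseteq> (\<lambda>(\<sigma>, k). f \<sigma> k) ` ({\<sigma> \<in> chain_simplices G i \<eta>. x \<in> \<sigma> ` standard_simplex i} \<times> {..i})" by auto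
    show "finite ((\<lambda>(\<sigma>, k). f \<sigma> k) ` ({\<sigma> \<in> chain_simplices G i \<eta>. x \<in> \<sigma> ` standard_simplex i} \<times> {..i}))"
      using finite_simplices_through[OF \<eta>, of x] by simp
  qed
  have finD': "finite (D' x)" for x unfolding D'_def by (rule fin)
  have "finite {depth i \<sigma> | \<sigma>. \<sigma> \<in> chain_simplices G i \<eta> \<and> x \<in> \<sigma> ` standard_simplex i}" for x
    using fin[of "\<lambda>\<sigma> k. depth i \<sigma>" x] by (rule finite_subset[rotated]) auto
  then have finD: "finite (D x)" for x unfolding D_def using fin[of "\<lambda>\<sigma> k. M' (singular_face i k \<sigma> (last_vertex (i - 1)))" x] by simp
  show thesis
  proof
    fix \<tau> assume "\<tau> \<in> chain_simplices G i (substitute G i i (small_family i M M') \<eta>)"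
    then obtain \<sigma> a where \<sigma>: "\<sigma> \<in> chain_simplices G i \<eta>" and a: "a \<in> keys (small_family i M M' \<sigma>)"
      and \<tau>: "\<tau> = simplex_map i \<sigma> a" using chain_simplices_substitute by metis
    have ss: "singular_simplex i (space_of E) \<sigma>" by (rule lf_chains_simplex[OF \<eta> \<sigma>])
    define x where "x = \<sigma> (last_vertex i)"
    have x: "x \<in> \<sigma> ` standard_simplex i" unfolding x_def by simp
    have Mx: "depth i \<sigma> \<le> M x" unfolding M_def using \<sigma> x by (intro Max_ge finite.insertI finD) (auto simp: D_def)
    let ?f = "\<lambda>b. chain_map i b (subdivision_homotopy (i - 1) (M x) - homotopy_family (i - 1) M' (simplex_map (i - 1) \<sigma> b))"
    have "a \<in> keys (iterated_subdivision i (M x)) \<union> keys (frag_extend ?f (chain_boundary i (identity_chain i)))"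
      using subsetD[OF keys_diff a[unfolded small_family_def]] unfolding x_def .
    then show "small i \<tau>"
    proof
      assume "a \<in> keys (iterated_subdivision i (M x))"
      then show ?thesis unfolding \<tau> by (rule depth[OF ss Mx])
    next
      assume a: "a \<in> keys (frag_extend ?f (chain_boundary i (identity_chain i)))"
      obtain b where b: "b \<in> keys (chain_boundary i (identity_chain i))" "a \<in> keys (?f b)"
        using subsetD[OF keys_frag_extend a] by blast
      obtain k where k: "i \<noteq> 0" "k \<le> i" "b = singular_face i k id" "simplicial_simplex (i - 1) (standard_simplex i) b"
        using keys_boundary_identity[OF b(1)] by metis
      define \<rho> where "\<rho> = singular_face i k \<sigma>"
      have \<rho>: "simplex_map (i - 1) \<sigma> b = \<rho>" unfolding \<rho>_def k(3) using k(1,2) by (intro simplex_map_face) auto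
      have \<rho>s: "singular_simplex (i - 1) (space_of E) \<rho>"
        unfolding \<rho>_def using singular_simplex_singular_face[OF ss, of k] k(1,2) by simp
      define z where "z = \<rho> (last_vertex (i - 1))"
      have z: "z \<in> \<sigma> ` standard_simplex i"
        unfolding z_def \<rho>[symmetric] using simplicial_simplex_in[OF k(4) last_vertex_in] by (simp add: simplex_map_def)
      have zM: "M' z \<le> M x"
        unfolding M_def by (intro Max_ge finite.insertI finD) (use \<sigma> x k(2) in \<open>auto simp: D_def z_def \<rho>_def\<close>)
      have M'z: "depth (i - 1) \<rho> \<le> M' z"
        unfolding M'_def by (intro Max_ge finite.insertI finD') (use \<sigma> z k(2) in \<open>auto simp: D'_def \<rho>_def\<close>)
      have "?f b = chain_map i b (subdivision_homotopy (i - 1) (M x) - subdivision_homotopy (i - 1) (M' z))"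
        unfolding homotopy_family_def \<rho> z_def ..
      then have fb: "?f b = chain_map i b (\<Sum>k\<in>{M' z..<M x}. subd (i - 1) (iterated_subdivision (i - 1) k))"
        unfolding subdivision_homotopy_diff[OF zM, of "i - 1"] .
      obtain c where c: "c \<in> keys (\<Sum>k\<in>{M' z..<M x}. subd (i - 1) (iterated_subdivision (i - 1) k))" "a = simplex_map i b c"
        using keys_chain_map[OF b(2)[unfolded fb]] by metis
      obtain m f e where e: "m \<in> {M' z..<M x}" "f \<in> keys (iterated_subdivision (i - 1) m)"
        "e \<in> keys (subd (i - 1) (identity_chain (i - 1)))" "c = simplex_map (Suc (i - 1)) f e"
        using keys_subd_iterated[OF c(1)] by metis
      have i: "Suc (i - 1) = i" using k(1) by simp
      have fs: "f ` standard_simplex (i - 1) \<subseteq> standard_simplex (i - 1)"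
        by (rule simplicial_simplex_image[OF simplicial_simplex_keys[OF simplicial_iterated_subdivision e(2)]])
      have es: "e ` standard_simplex i \<subseteq> standard_simplex (i - 1)"
        using simplicial_simplex_image[OF simplicial_simplex_keys[OF simplicial_subd_identity e(3)]] i by simp
      have "small (i - 1) (simplex_map (i - 1) \<rho> f)" using depth[OF \<rho>s _ e(2)] M'z e(1) by auto
      then have "small i (simplex_map i (simplex_map (i - 1) \<rho> f) e)" using es by (rule small_simplex_map)
      moreover have "simplex_map i (simplex_map (i - 1) \<rho> f) e = \<tau>"
      proof -
        have cs: "c ` standard_simplex i \<subseteq> standard_simplex (i - 1)"
          using fs es unfolding e(4) i by (auto simp: simplex_map_def)
        have "simplex_map i (simplex_map (i - 1) \<rho> f) e = simplex_map i \<rho> c"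
          using simplex_map_simplex_map[OF es] unfolding e(4) i by simp
        also have "\<dots> = \<tau>" unfolding \<tau> c(2) \<rho>[symmetric] by (rule simplex_map_simplex_map[OF cs])
        finally show ?thesis .
      qed
      ultimately show ?thesis by simp
    qed
  qed
qed

text \<open>Three homotopies are composed.  The first subdivision makes last faces allowable, so that the second homotopy may have
  variable depth and makes all simplices small.  The left-over homotopies on faces spoil the allowability of
  last faces; the third homotopy, again a single subdivision, restores it, and the chain splits.  Each homotopy also
  produces a term from the boundary of \<open>\<xi>\<close>, which is decomposable since that boundary is.\<close>

lemma decomposable_up_to_boundary:
  assumes \<xi>: "\<xi> \<in> IC i" and d\<xi>: "lf_boundary G i \<xi> \<in> decomposable (i - 1)"
  obtains W where "W \<in> IC (Suc i)" "\<xi> \<oplus>\<^bsub>raw_module G i\<^esub> lf_boundary G (Suc i) W \<in> decomposable i"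
proof -
  let ?H = "\<lambda>M. substitute G i (Suc i) (homotopy_family i M)"
  let ?F = "\<lambda>M. substitute G (i - 1) i (homotopy_family (i - 1) M)"
  let ?d = "lf_boundary G (Suc i)"
  note add = submodule_ofD(3)[OF submodule_decomposable]
  note car = submodule_ofD(1)[OF submodule_IC]
  interpret W: abelian_group "raw_module G i" using left_moduleD(2)[OF raw_module] .
  interpret W': abelian_group "raw_module G (Suc i)" using left_moduleD(2)[OF raw_module] .
  define \<eta> where "\<eta> = subdivide G i \<xi>"
  have \<eta>: "\<eta> \<in> IC i" "last_face_allowable q G E i \<eta>"
    unfolding \<eta>_def by (rule subdivide_IC[OF \<xi>], rule subdivide_last_face[OF \<xi>])
  have d\<eta>: "lf_boundary G i \<eta> = subdivide G (i - 1) (lf_boundary G i \<xi>)"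
    unfolding \<eta>_def by (rule lf_boundary_subdivide[OF IC_lf[OF \<xi>]])
  have d\<eta>': "lf_boundary G i \<eta> \<in> decomposable (i - 1)"
    unfolding d\<eta> subdivide_def
    by (rule substitute_decomposable[OF d\<xi> family_subdivide]) (rule subdivide_IC[unfolded subdivide_def])
  obtain M M' where small: "\<And>\<tau>. \<tau> \<in> chain_simplices G i (substitute G i i (small_family i M M') \<eta>) \<Longrightarrow> small i \<tau>"
    using small_family_small[OF IC_lf[OF \<eta>(1)]] by metis
  define W1 where "W1 = ?H (\<lambda>_. 1) \<xi>"
  define n1 where "n1 = ?F (\<lambda>_. 1) (lf_boundary G i \<xi>)"
  have W1: "W1 \<in> IC (Suc i)" unfolding W1_def by (rule homotopy_IC[OF \<xi>]) simp
  have n1: "n1 \<in> decomposable i" unfolding n1_def by (rule homotopy_faces_decomposable[OF d\<xi>])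
  have e1: "?d W1 \<oplus>\<^bsub>raw_module G i\<^esub> (\<xi> \<oplus>\<^bsub>raw_module G i\<^esub> n1) = \<eta>"
    unfolding W1_def n1_def \<eta>_def homotopy_formula[OF IC_lf[OF \<xi>]] small_family_constant subdivide_def ..
  define W2 where "W2 = ?H M \<eta>"
  define n2 where "n2 = ?F M' (lf_boundary G i \<eta>)"
  define \<rho> where "\<rho> = substitute G i i (small_family i M M') \<eta>"
  have W2: "W2 \<in> IC (Suc i)" unfolding W2_def by (rule homotopy_IC[OF \<eta>(1)]) (simp add: \<eta>(2))
  have n2: "n2 \<in> decomposable i" unfolding n2_def d\<eta> by (rule homotopy_faces_subdivide_decomposable[OF d\<xi>])
  have e2: "?d W2 \<oplus>\<^bsub>raw_module G i\<^esub> (\<eta> \<oplus>\<^bsub>raw_module G i\<^esub> n2) = \<rho>"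
    unfolding W2_def n2_def \<rho>_def by (rule homotopy_formula[OF IC_lf[OF \<eta>(1)]])
  have b: "?d W \<in> IC i" if "W \<in> IC (Suc i)" for W using boundary_IC[OF that] by simp
  have \<eta>n2: "\<eta> \<oplus>\<^bsub>raw_module G i\<^esub> n2 \<in> IC i" using submodule_ofD(3)[OF submodule_IC \<eta>(1) decomposable_IC[OF n2]] .
  have \<rho>: "\<rho> \<in> IC i" using submodule_ofD(3)[OF submodule_IC b[OF W2] \<eta>n2] e2 by simp
  have d\<rho>: "lf_boundary G i \<rho> \<in> decomposable (i - 1)"
  proof -
    have "lf_boundary G i \<rho> = lf_boundary G i (?d W2) \<oplus>\<^bsub>raw_module G (i - 1)\<^esub> (lf_boundary G i \<eta> \<oplus>\<^bsub>raw_module G (i - 1)\<^esub> lf_boundary G i n2)"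
      unfolding e2[symmetric]
      by (simp only: lf_boundary_add[OF IC_lf[OF b[OF W2]] IC_lf[OF \<eta>n2]] lf_boundary_add[OF IC_lf[OF \<eta>(1)] IC_lf[OF decomposable_IC[OF n2]]])
    moreover have "lf_boundary G i (?d W2) \<in> decomposable (i - 1)"
      using lf_boundary_lf_boundary[OF IC_lf[OF W2]] submodule_ofD(2)[OF submodule_decomposable[of "i - 1"]]
      by (simp add: chain_module_simps(2))
    ultimately show ?thesis using add[OF _ add[OF d\<eta>' boundary_decomposable[OF n2]]] by simp
  qed
  \<comment> \<open>Subdividing again keeps the simplices small.\<close>
  define \<omega> where "\<omega> = subdivide G i \<rho>"
  define W3 where "W3 = ?H (\<lambda>_. 1) \<rho>"
  define n3 where "n3 = ?F (\<lambda>_. 1) (lf_boundary G i \<rho>)"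
  have W3: "W3 \<in> IC (Suc i)" unfolding W3_def by (rule homotopy_IC[OF \<rho>]) simp
  have n3: "n3 \<in> decomposable i" unfolding n3_def by (rule homotopy_faces_decomposable[OF d\<rho>])
  have e3: "?d W3 \<oplus>\<^bsub>raw_module G i\<^esub> (\<rho> \<oplus>\<^bsub>raw_module G i\<^esub> n3) = \<omega>"
    unfolding W3_def n3_def \<omega>_def homotopy_formula[OF IC_lf[OF \<rho>]] small_family_constant subdivide_def ..
  have \<omega>: "\<omega> \<in> decomposable i"
  proof (rule small_chain_decomposable)
    show "\<omega> \<in> IC i" "last_face_allowable q G E i \<omega>"
      unfolding \<omega>_def by (rule subdivide_IC[OF \<rho>], rule subdivide_last_face[OF \<rho>])
    fix \<tau> assume "\<tau> \<in> chain_simplices G i \<omega>"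
    then obtain \<sigma> a where sa: "\<sigma> \<in> chain_simplices G i \<rho>" "a \<in> keys (iterated_subdivision i 1)" "\<tau> = simplex_map i \<sigma> a"
      using chain_simplices_substitute unfolding \<omega>_def subdivide_def by metis
    show "small i \<tau>"
      unfolding sa(3) using small sa(1) simplicial_simplex_image[OF simplicial_simplex_keys[OF simplicial_iterated_subdivision sa(2)]]
      by (intro small_simplex_map) (simp_all add: \<rho>_def)
  qed
  let ?W = "W1 \<oplus>\<^bsub>raw_module G (Suc i)\<^esub> (W2 \<oplus>\<^bsub>raw_module G (Suc i)\<^esub> W3)"
  let ?n = "n1 \<oplus>\<^bsub>raw_module G i\<^esub> (n2 \<oplus>\<^bsub>raw_module G i\<^esub> n3)"
  have W23: "W2 \<oplus>\<^bsub>raw_module G (Suc i)\<^esub> W3 \<in> IC (Suc i)" by (rule submodule_ofD(3)[OF submodule_IC W2 W3])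
  have W: "?W \<in> IC (Suc i)" by (rule submodule_ofD(3)[OF submodule_IC W1 W23])
  have dW: "?d ?W = ?d W1 \<oplus>\<^bsub>raw_module G i\<^esub> (?d W2 \<oplus>\<^bsub>raw_module G i\<^esub> ?d W3)"
    using lf_boundary_add[OF IC_lf[OF W1] IC_lf[OF W23]] lf_boundary_add[OF IC_lf[OF W2] IC_lf[OF W3]] by simp
  have "(\<xi> \<oplus>\<^bsub>raw_module G i\<^esub> ?d ?W) \<oplus>\<^bsub>raw_module G i\<^esub> ?n = \<omega>"
    unfolding dW e3[symmetric] e2[symmetric] e1[symmetric]
    using car[OF \<xi>] car[OF b[OF W1]] car[OF b[OF W2]] car[OF b[OF W3]] car[OF decomposable_IC[OF n1]]
      car[OF decomposable_IC[OF n2]] car[OF decomposable_IC[OF n3]]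
    by (simp add: W.a_ac)
  then have "\<xi> \<oplus>\<^bsub>raw_module G i\<^esub> ?d ?W \<in> decomposable i"
    using \<omega> add[OF n1 add[OF n2 n3]] car[OF submodule_ofD(3)[OF submodule_IC \<xi> b[OF W]]]
    by (intro submodule_of_cancel[OF raw_module submodule_decomposable, of "\<xi> \<oplus>\<^bsub>raw_module G i\<^esub> ?d ?W" i ?n]) simp_all
  then show thesis using that W by blast
qed

end

section \<open>Comparison of the relative homology modules\<close>

context cocompact_pair
begin

lemma boundary_boundary_zero: "\<xi> \<in> IC (Suc i) \<Longrightarrow> lf_boundary G i (lf_boundary G (Suc i) \<xi>) = \<zero>\<^bsub>raw_module G (i - 1)\<^esub>"
  using lf_boundary_lf_boundary[OF IC_lf, of \<xi> "Suc i"] by (simp add: chain_module_simps(2))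

lemma boundary_linear:
  assumes "C j \<subseteq> IC j" "\<And>\<xi>. \<xi> \<in> C j \<Longrightarrow> lf_boundary G j \<xi> \<in> C (j - 1)"
  shows "lf_boundary G j \<in> linear_maps R (raw_module G j\<lparr>carrier := C j\<rparr>) (raw_module G (j - 1)\<lparr>carrier := C (j - 1)\<rparr>)"
proof -
  have lf: "\<xi> \<in> lf j" if "\<xi> \<in> C j" for \<xi> using that assms(1) IC_lf by blast
  show ?thesis
    using assms(2) lf_boundary_add[OF lf lf] lf_boundary_smult[OF lf] unfolding linear_maps_def by simp
qed

text \<open>Both modules are described by relative cycles.  A relative cycle \<open>z\<close> becomes \<open>\<pi> + \<alpha>\<close> after adding a boundary, and
  \<open>\<pi>\<close> represents its class; this gives surjectivity.  For injectivity, let \<open>y = \<partial>w + b\<close> with \<open>y\<close> fibrewise compact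
  and \<open>b\<close> in \<open>A\<close>.  Then \<open>\<partial>w\<close> is decomposable, so \<open>w\<close> itself may be replaced by some \<open>\<pi> + \<alpha>\<close> with
  the same boundary, and \<open>y = \<partial>\<pi> + (\<partial>\<alpha> + b)\<close>, where the second term is fibrewise compact because the others are.\<close>

lemma relative_homology_iso:
  "module_isomorphic R (relative_homology (\<lambda>j. chain_module G j (IC j)) IC_A (lf_boundary G) i)
     (relative_homology (\<lambda>j. chain_module G j (IC_c j)) (\<lambda>j. IC_c j \<inter> IC_A j) (lf_boundary G) i)"
proof -
  let ?H = "relative_homology (\<lambda>j. raw_module G j\<lparr>carrier := IC j\<rparr>) IC_A (lf_boundary G) i"
  let ?Hc = "relative_homology (\<lambda>j. raw_module G j\<lparr>carrier := IC_c j\<rparr>) (\<lambda>j. IC_c j \<inter> IC_A j) (lf_boundary G) i"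
  let ?d = "lf_boundary G (Suc i)"
  have sub_cA: "submodule_of R (raw_module G j) (IC_c j \<inter> IC_A j)" for j
    using submodule_ofD[OF submodule_IC_c[of j]] submodule_ofD[OF submodule_IC_A[of j]] by (simp add: submodule_of_def subset_iff)
  have c_IC: "IC_c j \<subseteq> IC j" and A_IC: "IC_A j \<subseteq> IC j" for j by (auto simp: IC_c_iff IC_A_iff)
  have d0: "lf_boundary G 0 x = \<zero>\<^bsub>raw_module G 0\<^esub>" for x by (simp add: lf_boundary_def chain_module_simps(2))
  have dd: "lf_boundary G (j - 1) (lf_boundary G j x) = \<zero>\<^bsub>raw_module G (j - 1 - 1)\<^esub>" if "x \<in> IC j" for j x
    using lf_boundary_lf_boundary[OF IC_lf[OF that]] by (simp add: chain_module_simps(2))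
  have dcA: "lf_boundary G j x \<in> IC_c (j - 1) \<inter> IC_A (j - 1)" if "x \<in> IC_c j \<inter> IC_A j" for j x
    using that boundary_IC_A boundary_IC_c by blast
  define Z where "Z = {z \<in> IC i. lf_boundary G i z \<in> IC_A (i - 1)}"
  define Zc where "Zc = {z \<in> IC_c i. lf_boundary G i z \<in> IC_c (i - 1) \<inter> IC_A (i - 1)}"
  let ?M = "raw_module G i"
  interpret M: abelian_group ?M using left_moduleD(2)[OF raw_module] .
  have lin: "lf_boundary G j \<in> linear_maps R (raw_module G j\<lparr>carrier := IC j\<rparr>) (raw_module G (j - 1)\<lparr>carrier := IC (j - 1)\<rparr>)"
    "lf_boundary G j \<in> linear_maps R (raw_module G j\<lparr>carrier := IC_c j\<rparr>) (raw_module G (j - 1)\<lparr>carrier := IC_c (j - 1)\<rparr>)" for j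
    using boundary_linear[of IC j] boundary_linear[of IC_c j] boundary_IC[of _ q E j] boundary_IC_c[of _ j] c_IC by auto
  obtain \<kappa> where \<kappa>: "left_module R ?H"
      "submodule_of R ?M Z"
      "\<kappa> \<in> linear_maps R (?M\<lparr>carrier := Z\<rparr>) ?H"
      "carrier ?H = \<kappa> ` Z"
    and \<kappa>0: "\<forall>z\<in>Z. \<kappa> z = \<zero>\<^bsub>?H\<^esub> \<longleftrightarrow>
        (\<exists>w\<in>IC (Suc i). \<exists>b\<in>IC_A i. z = ?d w \<oplus>\<^bsub>?M\<^esub> b)"
    by (rule relative_homology_representatives[of R "raw_module G" IC IC_A "lf_boundary G" i,
          OF raw_module submodule_IC submodule_IC_A A_IC lin(1) boundary_IC_A dd d0, folded Z_def]) ((assumption | rule that)+)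
  obtain \<mu> where \<mu>: "left_module R ?Hc"
      "submodule_of R ?M Zc"
      "\<mu> \<in> linear_maps R (?M\<lparr>carrier := Zc\<rparr>) ?Hc"
      "carrier ?Hc = \<mu> ` Zc"
    and \<mu>0: "\<forall>z\<in>Zc. \<mu> z = \<zero>\<^bsub>?Hc\<^esub> \<longleftrightarrow>
        (\<exists>w\<in>IC_c (Suc i). \<exists>b\<in>IC_c i \<inter> IC_A i. z = ?d w \<oplus>\<^bsub>?M\<^esub> b)"
    by (rule relative_homology_representatives[of R "raw_module G" IC_c "\<lambda>j. IC_c j \<inter> IC_A j" "lf_boundary G" i,
          OF raw_module submodule_IC_c sub_cA Int_lower1 lin(2) dcA dd[OF subsetD[OF c_IC]] d0, folded Zc_def]) ((assumption | rule that)+)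
  note addA = submodule_ofD(3)[OF submodule_IC_A] and addc = submodule_ofD(3)[OF submodule_IC_c]
  note car = submodule_ofD(1)[OF submodule_IC]
  have zA: "\<zero>\<^bsub>raw_module G j\<^esub> \<in> IC_A j" "\<zero>\<^bsub>raw_module G j\<^esub> \<in> IC j" for j
    using submodule_ofD(2)[OF submodule_IC_A[of j]] submodule_ofD(2)[OF submodule_IC[of j q E]] by blast+
  have ZcZ: "Zc \<subseteq> Z" using c_IC by (auto simp: Zc_def Z_def)
  have surj: "\<kappa> ` Z \<subseteq> \<kappa> ` Zc"
  proof
    fix X assume "X \<in> \<kappa> ` Z"
    then obtain z where z: "z \<in> IC i" "lf_boundary G i z \<in> IC_A (i - 1)" "X = \<kappa> z" by (auto simp: Z_def)
    have "\<zero>\<^bsub>raw_module G (i - 1)\<^esub> \<oplus>\<^bsub>raw_module G (i - 1)\<^esub> lf_boundary G i z \<in> decomposable (i - 1)"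
      unfolding decomposable_def using z(2) submodule_ofD(2)[OF submodule_IC_c] by blast
    then have "lf_boundary G i z \<in> decomposable (i - 1)"
      using abelian_monoid.l_zero[OF abelian_group.axioms(1)[OF left_moduleD(2)[OF raw_module]]] submodule_ofD(1)[OF submodule_IC_A z(2)] by simp
    then obtain W where W: "W \<in> IC (Suc i)" "z \<oplus>\<^bsub>?M\<^esub> ?d W \<in> decomposable i"
      using decomposable_up_to_boundary[OF z(1)] by metis
    obtain \<pi> \<alpha> where pa: "z \<oplus>\<^bsub>?M\<^esub> ?d W = \<pi> \<oplus>\<^bsub>?M\<^esub> \<alpha>" "\<pi> \<in> IC_c i" "\<alpha> \<in> IC_A i"
      using decomposable_cases[OF W(2)] by metis
    have dW: "?d W \<in> IC i" using boundary_IC[OF W(1)] by simp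
    have pIC: "\<pi> \<in> IC i" and aIC: "\<alpha> \<in> IC i" using pa(2,3) c_IC A_IC by blast+
    have dz: "?d \<zero>\<^bsub>raw_module G (Suc i)\<^esub> = \<zero>\<^bsub>?M\<^esub>"
      using lf_boundary_zero[of "Suc i"] by (simp add: chain_module_simps(2))
    have dWZ: "?d W \<in> Z" and aZ: "\<alpha> \<in> Z" and zZ: "z \<in> Z"
      using dW boundary_boundary_zero[OF W(1)] zA(1) aIC boundary_IC_A[OF pa(3)] z by (simp_all add: Z_def)
    have "lf_boundary G i \<pi> \<oplus>\<^bsub>raw_module G (i - 1)\<^esub> lf_boundary G i \<alpha> \<in> IC_A (i - 1)"
      using lf_boundary_add[OF IC_lf[OF pIC] IC_lf[OF aIC]] lf_boundary_add[OF IC_lf[OF z(1)] IC_lf[OF dW]]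
        addA[OF z(2), of "lf_boundary G i (?d W)"] zA(1) boundary_boundary_zero[OF W(1)] pa(1) by simp
    then have "lf_boundary G i \<pi> \<in> IC_A (i - 1)"
      by (rule submodule_of_cancel[OF raw_module submodule_IC_A car[OF boundary_IC[OF pIC]] _ boundary_IC_A[OF pa(3)]])
    then have pZc: "\<pi> \<in> Zc" using pa(2) boundary_IC_c[OF pa(2)] by (simp add: Zc_def)
    have kW: "\<kappa> (?d W) = \<zero>\<^bsub>?H\<^esub>"
      unfolding \<kappa>0[rule_format, OF dWZ] using W(1) zA(1)[of i] car[OF dW] by (intro bexI[of _ W] bexI[of _ "\<zero>\<^bsub>?M\<^esub>"]) simp_all
    have ka: "\<kappa> \<alpha> = \<zero>\<^bsub>?H\<^esub>"
      unfolding \<kappa>0[rule_format, OF aZ]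
    proof (rule bexI[OF _ zA(2)], rule bexI[OF _ pa(3)])
      show "\<alpha> = ?d \<zero>\<^bsub>raw_module G (Suc i)\<^esub> \<oplus>\<^bsub>?M\<^esub> \<alpha>" using dz car[OF aIC] by simp
    qed
    have kadd: "\<kappa> (x \<oplus>\<^bsub>?M\<^esub> y) = \<kappa> x \<oplus>\<^bsub>?H\<^esub> \<kappa> y" if "x \<in> Z" "y \<in> Z" for x y
      using \<kappa>(3) that by (simp add: linear_maps_def)
    have kzero: "\<kappa> x \<oplus>\<^bsub>?H\<^esub>
        \<zero>\<^bsub>?H\<^esub> = \<kappa> x" if "x \<in> Z" for x
      using abelian_monoid.r_zero[OF abelian_group.axioms(1)[OF left_moduleD(2)[OF \<kappa>(1)]]] \<kappa>(4) that by blast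
    have "\<kappa> z = \<kappa> (z \<oplus>\<^bsub>?M\<^esub> ?d W)" unfolding kadd[OF zZ dWZ] kW kzero[OF zZ] ..
    also have "\<dots> = \<kappa> \<pi>" unfolding pa(1) kadd[OF subsetD[OF ZcZ pZc] aZ] ka kzero[OF subsetD[OF ZcZ pZc]] ..
    finally have "\<kappa> z = \<kappa> \<pi>" .
    then show "X \<in> \<kappa> ` Zc" using z(3) pZc by blast
  qed
  have ker: "(\<exists>w\<in>IC (Suc i). \<exists>b\<in>IC_A i. y = ?d w \<oplus>\<^bsub>?M\<^esub> b) \<longleftrightarrow>
      (\<exists>w\<in>IC_c (Suc i). \<exists>b\<in>IC_c i \<inter> IC_A i. y = ?d w \<oplus>\<^bsub>?M\<^esub> b)" if y: "y \<in> Zc" for y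
  proof
    assume "\<exists>w\<in>IC (Suc i). \<exists>b\<in>IC_A i. y = ?d w \<oplus>\<^bsub>?M\<^esub> b"
    then obtain w b where wb: "w \<in> IC (Suc i)" "b \<in> IC_A i" "y = ?d w \<oplus>\<^bsub>?M\<^esub> b" by blast
    have yc: "y \<in> IC_c i" using y by (simp add: Zc_def)
    have dw: "?d w \<in> IC i" using boundary_IC[OF wb(1)] by simp
    have bM: "b \<in> carrier ?M" using wb(2) submodule_ofD(1)[OF submodule_IC_A] by blast
    have "y \<oplus>\<^bsub>?M\<^esub> \<ominus>\<^bsub>?M\<^esub> b \<in> decomposable i"
      unfolding decomposable_def using yc submodule_of_minus[OF raw_module submodule_IC_A wb(2)] by blast
    then have "?d w \<in> decomposable (Suc i - 1)"
      unfolding wb(3) using car[OF dw] bM by (simp add: M.a_assoc M.r_neg)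
    then obtain W where W: "W \<in> IC (Suc (Suc i))" "w \<oplus>\<^bsub>raw_module G (Suc i)\<^esub> lf_boundary G (Suc (Suc i)) W \<in> decomposable (Suc i)"
      using decomposable_up_to_boundary[OF wb(1)] by metis
    obtain \<pi> \<alpha> where pa: "w \<oplus>\<^bsub>raw_module G (Suc i)\<^esub> lf_boundary G (Suc (Suc i)) W = \<pi> \<oplus>\<^bsub>raw_module G (Suc i)\<^esub> \<alpha>"
      "\<pi> \<in> IC_c (Suc i)" "\<alpha> \<in> IC_A (Suc i)"
      using decomposable_cases[OF W(2)] by metis
    have pIC: "\<pi> \<in> IC (Suc i)" and aIC: "\<alpha> \<in> IC (Suc i)" using pa(2,3) c_IC A_IC by blast+
    have dp: "?d \<pi> \<in> IC_c i" and da: "?d \<alpha> \<in> IC_A i"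
      using boundary_IC_c[OF pa(2)] boundary_IC_A[OF pa(3)] by simp_all
    have dWIC: "lf_boundary G (Suc (Suc i)) W \<in> IC (Suc i)" using boundary_IC[OF W(1)] by simp
    have "?d w \<oplus>\<^bsub>?M\<^esub> ?d (lf_boundary G (Suc (Suc i)) W)
        = ?d \<pi> \<oplus>\<^bsub>?M\<^esub> ?d \<alpha>"
      using lf_boundary_add[OF IC_lf[OF wb(1)] IC_lf[OF dWIC]] lf_boundary_add[OF IC_lf[OF pIC] IC_lf[OF aIC]] pa(1) by simp
    then have dw_eq: "?d w = ?d \<pi> \<oplus>\<^bsub>?M\<^esub> ?d \<alpha>"
      using boundary_boundary_zero[OF W(1)] car[OF dw] by simp
    let ?b = "?d \<alpha> \<oplus>\<^bsub>?M\<^esub> b"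
    have dpM: "?d \<pi> \<in> carrier ?M" and daM: "?d \<alpha> \<in> carrier ?M"
      using dp da submodule_ofD(1)[OF submodule_IC_c] submodule_ofD(1)[OF submodule_IC_A] by blast+
    have yb: "y = ?d \<pi> \<oplus>\<^bsub>?M\<^esub> ?b" unfolding wb(3) dw_eq using dpM daM bM by (simp add: M.a_assoc)
    have bA: "?b \<in> IC_A i" by (rule addA[OF da wb(2)])
    have "?b \<oplus>\<^bsub>?M\<^esub> ?d \<pi> = y" unfolding yb using dpM daM bM by (simp add: M.a_ac)
    then have "?b \<oplus>\<^bsub>?M\<^esub> ?d \<pi> \<in> IC_c i" using yc by simp
    then have "?b \<in> IC_c i"
      by (rule submodule_of_cancel[OF raw_module submodule_IC_c submodule_ofD(1)[OF submodule_IC_A bA] _ dp])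
    then show "\<exists>w\<in>IC_c (Suc i). \<exists>b\<in>IC_c i \<inter> IC_A i. y = ?d w \<oplus>\<^bsub>?M\<^esub> b"
      using pa(2) bA yb by blast
  next
    assume "\<exists>w\<in>IC_c (Suc i). \<exists>b\<in>IC_c i \<inter> IC_A i. y = ?d w \<oplus>\<^bsub>?M\<^esub> b"
    then show "\<exists>w\<in>IC (Suc i). \<exists>b\<in>IC_A i. y = ?d w \<oplus>\<^bsub>?M\<^esub> b" using c_IC by blast
  qed
  have "module_isomorphic R ?H
      ?Hc"
  proof (rule module_isomorphicI_representatives[OF \<kappa>(1) \<mu>(1) raw_module \<kappa>(2) \<mu>(2) ZcZ \<kappa>(3) \<mu>(3)])
    show "carrier ?H \<subseteq> \<kappa> ` Zc"
      unfolding \<kappa>(4) by (rule surj)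
    show "carrier ?Hc \<subseteq> \<mu> ` Zc"
      unfolding \<mu>(4) ..
    fix y assume y: "y \<in> Zc"
    then show "\<kappa> y = \<zero>\<^bsub>?H\<^esub> \<longleftrightarrow>
        \<mu> y = \<zero>\<^bsub>?Hc\<^esub>"
      unfolding \<mu>0[rule_format, OF y] \<kappa>0[rule_format, OF subsetD[OF ZcZ y]] by (rule ker)
  qed
  then show ?thesis by (simp only: chain_module_simps(5))
qed

end

theorem proposition4p2:
  fixes R :: "'r ring" and q :: "nat \<Rightarrow> int"
    and E :: "'e filtered" and A :: "'e set" and Y :: "'y filtered" and p :: "'e \<Rightarrow> 'y"
    and G :: "('r, 'e, 'g) sheaf"
  assumes "ring R" and "finite_cohomological_dimension_ring R"
    and "perversity q"
    and "filtered_space E" and "filtered_space Y"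
    and "coefficient_system R E G"
    and "stratified_fibration_pair E A Y p"
    and "paracompact_space (space_of E)"
    and "paracompact_space (subtopology (space_of E) A)"
    and "paracompact_space (space_of Y)"
    and "finite_cohomological_dimension R (space_of E)"
    and "finite_cohomological_dimension R (subtopology (space_of E) A)"
    and "finite_cohomological_dimension R (space_of Y)"
    and "locally_compact_space (space_of Y)"
    and "\<And>K. compactin (space_of Y) K \<Longrightarrow>
           compactin (space_of E)
             ({x \<in> topspace (space_of E). p x \<in> K} - {x \<in> topspace (space_of E). p x \<in> K} \<inter> A)"
  shows "\<forall>i. module_isomorphic R (IH_inf q G E A i) (IH_fc q G E A (space_of Y) p i)"
proof
  fix i
  have R: "ring R" by fact
  have G: "sheaf_of_modules R G"
    using \<open>coefficient_system R E G\<close> by (auto simp: coefficient_system_def constant_system_def local_system_def)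
  have A: "A \<subseteq> topspace (space_of E)" and p: "continuous_map (space_of E) (space_of Y) p"
    using \<open>stratified_fibration_pair E A Y p\<close> by (simp_all add: stratified_fibration_pair_def)
  obtain \<V> where \<V>: "\<And>V. V \<in> \<V> \<Longrightarrow> openin (space_of Y) V" "\<Union>\<V> = topspace (space_of Y)" "locally_finite_in (space_of Y) \<V>"
    "\<And>V. V \<in> \<V> \<Longrightarrow> \<exists>K. compactin (space_of Y) K \<and> V \<subseteq> K"
    using locally_finite_precompact_cover[OF \<open>paracompact_space (space_of Y)\<close> \<open>locally_compact_space (space_of Y)\<close>] by metis
  have K: "compactin (space_of E) ({x \<in> topspace (space_of E). p x \<in> K} - A)" if "compactin (space_of Y) K" for K
    using assms(15)[OF that] by (simp add: Diff_Int_distrib Diff_Int)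
  interpret cocompact_pair R G q E A "space_of Y" p \<V>
    by (intro cocompact_pair.intro fibred_pair.intro coefficient_sheaf.intro fibred_pair_axioms.intro
        cocompact_pair_axioms.intro R G A p \<V> K)
  show "module_isomorphic R (IH_inf q G E A i) (IH_fc q G E A (space_of Y) p i)"
    unfolding IH_inf_def IH_fc_def IC_fc_restrict[abs_def] by (rule relative_homology_iso)
qed

end
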